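(* Let $\mathcal{H}_1$ and $\mathcal{H}_2$ be infinite-dimensional separable Hilbert spaces, and let $K_1\subset\mathcal{H}_1$ and $K_2\subset\mathcal{H}_2$ be infinite-dimensional ellipsoids such that $d_n(K_2)=O(d_n(K_1))$. Then: (A) If all left shifts of the sequence $\{d_n(K_1)\}_{n=0}^\infty$ majorize the sequence $\{d_n(K_2)\}_{n=0}^\infty$, then $WG(K_1,K_2)=\mathcal{L}(\mathcal{H}_1,\mathcal{H}_2)$. (B) If, for some integer $k\ge 0$, the $k$-th left shift of $\{d_n(K_1)\}_{n=0}^\infty$ majorizes the sequence $\{d_n(K_2)\}_{n=0}^\infty$, but the $(k+1)$-th left shift does not, then $WG(K_1,K_2)$ is the set of those operators $T\in\mathcal{L}(\mathcal{H}_1,\mathcal{H}_2)$ for which the image of the space $T(V_{K_1})$ in the quotient space $\mathcal{H}_2/V_{K_2}$ is at most $k$-dimensional.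
   Context: An (infinite-dimensional) ellipsoid in a Hilbert space $\mathcal{H}$ is a set of the form $A(B_{\mathcal{H}'})$, where $\mathcal{H}'$ is a Hilbert space, $B_{\mathcal{H}'}$ its closed unit ball, and $A:\mathcal{H}'\to\mathcal{H}$ a compact linear operator with infinite-dimensional range. $\mathcal{L}(\mathcal{H}_1,\mathcal{H}_2)$ is the space of bounded linear operators from $\mathcal{H}_1$ to $\mathcal{H}_2$; $G(K_1,K_2)=\{T\in\mathcal{L}(\mathcal{H}_1,\mathcal{H}_2): TK_1\supset K_2\}$; $WG(K_1,K_2)$ is the closure of $G(K_1,K_2)$ in the weak operator topology. $V_K=\overline{\mathrm{lin}(K)}$ is the closed linear span of $K$. The Kolmogorov $n$-width ($n\ge 0$) of $K\subset\mathcal{H}$ is $d_n(K)=\inf_{\mathcal{X}_n}\sup_{x\in K}\inf_{z\in \mathcal{X}_n}\|x-z\|$, the outer infimum being over all $n$-dimensional linear subspaces $\mathcal{X}_n$ of $\mathcal{H}$. The $k$-th left shift ($k\ge0$) of a sequence $\{a_n\}_{n=0}^\infty$ is $\{a_{n+k}\}_{n=0}^\infty$. For sequences of non-negative numbers, $\{a_n\}_{n=0}^\infty$ majorizes $\{b_n\}_{n=0}^\infty$ if there is $0<C<\infty$ with $b_n\le Ca_n$ for all $n=0,1,2,\dots$. *)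

theory Defs
  imports "HOL-Analysis.Analysis" "HOL-Library.Landau_Symbols" "HOL-Library.Set_Algebras"
begin

text \<open>
  Hilbert spaces are taken over a scalar field \<open>'k\<close> of sort
  \<open>{real_normed_field, euclidean_space}\<close>; up to isomorphism this is exactly the real or the
  complex field, so both cases are covered uniformly. The type class supplies completeness and a
  norm that comes from a real inner product; the multiplication by scalars of \<open>'k\<close> is an explicit
  parameter \<open>scale\<close>, required to extend the real one and to satisfy \<open>\<bar>cx\<bar> = \<bar>c\<bar>\<bar>x\<bar>\<close>. For
  \<open>'k = real\<close> this forces \<open>scale = scaleR\<close>. For \<open>'k = complex\<close> the Hermitian inner product is
  recovered from the norm by polarization, and the class operation \<open>inner\<close> is its real part.
\<close>

locale hilbert_space = vector_space scale
  for scale :: "'k::{real_normed_field,euclidean_space} \<Rightarrow> 'a::{real_inner,complete_space} \<Rightarrow> 'a" +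
  assumes scale_of_real: "scale (of_real r) x = r *\<^sub>R x"
    and norm_scale: "norm (scale c x) = norm c * norm x"

lemma hilbert_space_real:
  "hilbert_space (scaleR :: real \<Rightarrow> 'a::{real_inner,complete_space} \<Rightarrow> 'a)"
  by unfold_locales (auto simp: algebra_simps)

lemma hilbert_space_complex: "hilbert_space ((*) :: complex \<Rightarrow> complex \<Rightarrow> complex)"
  by unfold_locales (auto simp: algebra_simps norm_mult scaleR_conv_of_real)

definition infinite_dimensional :: "('k::field \<Rightarrow> 'a::ab_group_add \<Rightarrow> 'a) \<Rightarrow> 'a set \<Rightarrow> bool" where
  "infinite_dimensional s S \<longleftrightarrow> \<not> (\<exists>B. finite B \<and> S \<subseteq> module.span s B)"

definition n_dim_subspace ::
    "('k::field \<Rightarrow> 'a::ab_group_add \<Rightarrow> 'a) \<Rightarrow> nat \<Rightarrow> 'a set \<Rightarrow> bool" where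
  "n_dim_subspace s n X \<longleftrightarrow>
     (\<exists>B. finite B \<and> card B = n \<and> \<not> module.dependent s B \<and> X = module.span s B)"

definition bounded_ops ::
    "('k::field \<Rightarrow> 'a::real_normed_vector \<Rightarrow> 'a) \<Rightarrow> ('k \<Rightarrow> 'b::real_normed_vector \<Rightarrow> 'b)
      \<Rightarrow> ('a \<Rightarrow> 'b) set" where
  "bounded_ops s1 s2 =
     {T. Vector_Spaces.linear s1 s2 T \<and> (\<exists>M. \<forall>x. norm (T x) \<le> M * norm x)}"

definition compact_operator ::
    "('k::field \<Rightarrow> 'a::real_normed_vector \<Rightarrow> 'a) \<Rightarrow> ('k \<Rightarrow> 'b::real_normed_vector \<Rightarrow> 'b)
      \<Rightarrow> ('a \<Rightarrow> 'b) \<Rightarrow> bool" where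
  "compact_operator s1 s2 A \<longleftrightarrow> A \<in> bounded_ops s1 s2 \<and> compact (closure (A ` cball 0 1))"

text \<open>
  \<open>K\<close> is an infinite-dimensional ellipsoid in the space with scaling \<open>s\<close>, presented by an operator
  \<open>A\<close> from the space with scaling \<open>s'\<close>. HOL cannot quantify existentially over the type of the
  auxiliary Hilbert space, so that space and \<open>A\<close> are parameters; a statement about all ellipsoids
  quantifies universally over them.
\<close>

definition ellipsoid ::
    "('k::field \<Rightarrow> 'c::real_normed_vector \<Rightarrow> 'c) \<Rightarrow> ('k \<Rightarrow> 'a::real_normed_vector \<Rightarrow> 'a)
      \<Rightarrow> ('c \<Rightarrow> 'a) \<Rightarrow> 'a set \<Rightarrow> bool" where
  "ellipsoid s' s A K \<longleftrightarrow>
     compact_operator s' s A \<and> infinite_dimensional s (range A) \<and> K = A ` cball 0 1"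

definition G_ops ::
    "('k::field \<Rightarrow> 'a::real_normed_vector \<Rightarrow> 'a) \<Rightarrow> ('k \<Rightarrow> 'b::real_normed_vector \<Rightarrow> 'b)
      \<Rightarrow> 'a set \<Rightarrow> 'b set \<Rightarrow> ('a \<Rightarrow> 'b) set" where
  "G_ops s1 s2 K1 K2 = {T \<in> bounded_ops s1 s2. K2 \<subseteq> T ` K1}"

text \<open>
  The weak operator topology: the coarsest topology on the bounded operators for which all the
  maps \<open>T \<mapsto> f (T x)\<close>, with \<open>f\<close> a bounded linear functional on the target, are continuous.
\<close>

definition weak_op_topology ::
    "('k::real_normed_field \<Rightarrow> 'a::real_normed_vector \<Rightarrow> 'a)
      \<Rightarrow> ('k \<Rightarrow> 'b::real_normed_vector \<Rightarrow> 'b) \<Rightarrow> ('a \<Rightarrow> 'b) topology" where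
  "weak_op_topology s1 s2 =
     topology_generated_by
       {{T \<in> bounded_ops s1 s2. f (T x) \<in> U} | f x U. f \<in> bounded_ops s2 (*) \<and> open U}"

definition WG ::
    "('k::real_normed_field \<Rightarrow> 'a::real_normed_vector \<Rightarrow> 'a)
      \<Rightarrow> ('k \<Rightarrow> 'b::real_normed_vector \<Rightarrow> 'b) \<Rightarrow> 'a set \<Rightarrow> 'b set \<Rightarrow> ('a \<Rightarrow> 'b) set" where
  "WG s1 s2 K1 K2 = weak_op_topology s1 s2 closure_of G_ops s1 s2 K1 K2"

definition closed_span ::
    "('k::field \<Rightarrow> 'a::real_normed_vector \<Rightarrow> 'a) \<Rightarrow> 'a set \<Rightarrow> 'a set" where
  "closed_span s K = closure (module.span s K)"

definition kolmogorov_width ::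
    "('k::field \<Rightarrow> 'a::real_normed_vector \<Rightarrow> 'a) \<Rightarrow> nat \<Rightarrow> 'a set \<Rightarrow> real" where
  "kolmogorov_width s n K =
     (INF X\<in>{X. n_dim_subspace s n X}. SUP x\<in>K. INF z\<in>X. norm (x - z))"

definition left_shift :: "nat \<Rightarrow> (nat \<Rightarrow> real) \<Rightarrow> nat \<Rightarrow> real" where
  "left_shift k a = (\<lambda>n. a (n + k))"

definition majorizes :: "(nat \<Rightarrow> real) \<Rightarrow> (nat \<Rightarrow> real) \<Rightarrow> bool" where
  "majorizes a b \<longleftrightarrow> (\<exists>C>0. \<forall>n. b n \<le> C * a n)"

text \<open>
  Elements of the quotient by a subspace \<open>V\<close> are the cosets \<open>x +o V\<close>. Linear combinations of cosets
  are formed with Minkowski sums and elementwise scaling; the summand \<open>V\<close> (the zero of the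
  quotient) turns the degenerate values \<open>{0}\<close>, arising from the empty sum or from a zero
  coefficient, into cosets again.
\<close>

definition quotient_image :: "'a::ab_group_add set \<Rightarrow> 'a set \<Rightarrow> 'a set set" where
  "quotient_image V W = (\<lambda>x. x +o V) ` W"

definition quotient_span ::
    "('k::field \<Rightarrow> 'a::ab_group_add \<Rightarrow> 'a) \<Rightarrow> 'a set \<Rightarrow> 'a set set \<Rightarrow> 'a set set" where
  "quotient_span s V F = {V + (\<Sum>X\<in>F. s (c X) ` X) | c. True}"

definition quotient_dim_le ::
    "('k::field \<Rightarrow> 'a::ab_group_add \<Rightarrow> 'a) \<Rightarrow> 'a set \<Rightarrow> 'a set set \<Rightarrow> nat \<Rightarrow> bool" where
  "quotient_dim_le s V Q k \<longleftrightarrow>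
     (\<exists>F\<subseteq>Q. finite F \<and> card F \<le> k \<and> Q = quotient_span s V F)"

end

theory Submission
  imports Defs
begin

text \<open>
  By the singular value decomposition every ellipsoid has the form
  \<open>{\<Sum>j. a j c j e j | \<Sum>j. \<bar>c j\<bar>\<^sup>2 \<le> 1}\<close> with \<open>e\<close> orthonormal and \<open>a\<close> positive and decreasing to \<open>0\<close>, and
  then \<open>d\<^sub>n = a n\<close>. Let \<open>(e, a)\<close> and \<open>(f, b)\<close> be such data for \<open>K\<^sub>1\<close> and \<open>K\<^sub>2\<close>.

  Sufficiency. Suppose that \<open>T V\<^sub>1 \<subseteq> V\<^sub>2 + W\<close> with \<open>W \<bottom> V\<^sub>2\<close>, \<open>dim W = k\<close> and \<open>b n \<le> C a (n + k)\<close>. For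
  large \<open>m\<close> the space \<open>F\<close> spanned by \<open>e 0, \<dots>, e (m - 1)\<close> and the space
  \<open>E\<close> spanned by \<open>f 0, \<dots>, f (m - k - 1)\<close> and \<open>W\<close> both have dimension \<open>m\<close>. On \<open>F\<close> replace \<open>T\<close> by its
  compression to \<open>E\<close> plus a large multiple of an isometry of \<open>F\<close> onto \<open>E\<close> that the finitely
  many vectors and functionals of a given weak neighbourhood do not see; on the remaining \<open>e j\<close> use
  the diagonal operator \<open>e j \<mapsto> (2 b (j - k) / a j) f (j - k)\<close>. The result covers \<open>K\<^sub>2\<close> and tends weakly
  to \<open>T\<close>. In case (A) one first replaces \<open>T\<close> on \<open>V\<^sub>1\<close> by an operator of finite rank that agrees with
  \<open>T\<close> on the given vectors.

  Necessity. If \<open>T V\<^sub>1\<close> has dimension greater than \<open>k\<close> modulo \<open>V\<^sub>2\<close>, then so has \<open>S V\<^sub>1\<close> for every \<open>S\<close> in a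
  weak neighbourhood of \<open>T\<close>. If in addition \<open>S K\<^sub>1 \<supseteq> K\<^sub>2\<close>, then \<open>K\<^sub>2\<close> is covered by the image of the
  part of \<open>K\<^sub>1\<close> on which \<open>k + 1\<close> independent functionals vanish. The functionals cut the span of
  \<open>e 0, \<dots>, e (n + k)\<close> down to dimension \<open>n\<close> and cost only a constant factor in the approximation, so
  that \<open>b n \<le> C a (n + k + 1)\<close>.
\<close>

subsection \<open>The scalar-valued inner product\<close>

context hilbert_space
begin

text \<open>
  The scalar \<open>ip x y\<close> represents the real functional \<open>c \<mapsto> inner x (scale c y)\<close> on the scalar field, which
  makes \<open>ip\<close> linear in the first argument. Over the complex field it is the Hermitian inner product.
\<close>

definition ip :: "'a \<Rightarrow> 'a \<Rightarrow> 'k" where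
  "ip x y = (\<Sum>b\<in>Basis. inner x (scale b y) *\<^sub>R b)"

lemma scale_scaleR: "scale (r *\<^sub>R c) x = r *\<^sub>R scale c x"
  by (metis scale_of_real scale_scale scaleR_conv_of_real)

lemma scale_scaleR_right: "scale c (r *\<^sub>R x) = r *\<^sub>R scale c x"
  by (metis scale_of_real scale_left_commute)

lemma inner_ip: "inner (ip x y) c = inner x (scale c y)"
proof -
  have "scale c y = (\<Sum>b\<in>Basis. inner c b *\<^sub>R scale b y)"
    by (subst euclidean_representation[symmetric, of c])
       (simp only: scale_sum_left scale_scaleR)
  moreover have "inner (ip x y) c = (\<Sum>b\<in>Basis. inner x (scale b y) * inner b c)"
    by (simp add: ip_def inner_sum_left)
  ultimately show ?thesis
    by (simp add: inner_sum_right inner_commute mult.commute)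
qed

text \<open>By polarization (\<open>dot_norm\<close>) the inner product is a combination of squared
  norms, and \<open>scale c\<close> multiplies each of them by \<open>(norm c)\<^sup>2\<close>. The
  next lemma is the same fact for multiplication on the scalar field.\<close>

lemma inner_scale_scale: "inner (scale c x) (scale c y) = (norm c)\<^sup>2 * inner x y"
  by (simp add: dot_norm norm_scale power_mult_distrib flip: scale_right_distrib)
     (simp add: algebra_simps)

lemma inner_mult_mult: "inner (c * d) (c * e) = (norm c)\<^sup>2 * inner d e" for c d e :: 'k
  by (simp add: dot_norm norm_mult power_mult_distrib flip: distrib_left)
     (simp add: algebra_simps)

lemma ip_eqI: "(\<And>c. inner x (scale c y) = inner d c) \<Longrightarrow> ip x y = d"
  by (metis inner_ip vector_eq_rdot)

lemma ip_add_left: "ip (x + x') y = ip x y + ip x' y"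
  by (rule ip_eqI) (simp add: inner_add_left inner_ip)

text \<open>For \<open>d \<noteq> 0\<close> write \<open>c = d * (c / d)\<close>. Both sides then
  carry the factor \<open>(norm d)\<^sup>2\<close>, so linearity over \<open>'k\<close> follows
  without a conjugation on \<open>'k\<close>.\<close>

lemma ip_scale_left: "ip (scale d x) y = d * ip x y"
proof (rule ip_eqI)
  fix c
  show "inner (scale d x) (scale c y) = inner (d * ip x y) c"
  proof (cases "d = 0")
    case False
    have "inner (scale d x) (scale c y) = inner (scale d x) (scale d (scale (c / d) y))"
      using False by simp
    also have "\<dots> = inner (d * ip x y) (d * (c / d))"
      unfolding inner_scale_scale inner_mult_mult inner_ip ..
    finally show ?thesis using False by simp
  qed simp
qed

lemma ip_zero_left [simp]: "ip 0 y = 0"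
  by (rule ip_eqI) simp

lemma ip_zero_right [simp]: "ip x 0 = 0"
  by (rule ip_eqI) simp

lemma ip_minus_left: "ip (- x) y = - ip x y"
  using ip_add_left[of x "- x" y] by (simp add: eq_neg_iff_add_eq_0 add.commute)

lemma ip_diff_left: "ip (x - x') y = ip x y - ip x' y"
  using ip_add_left[of x "- x'" y] by (simp add: ip_minus_left)

lemma ip_scaleR_left: "ip (r *\<^sub>R x) y = r *\<^sub>R ip x y"
  by (metis ip_scale_left scale_of_real scaleR_conv_of_real)

lemma ip_sum_left: "ip (\<Sum>i\<in>I. f i) y = (\<Sum>i\<in>I. ip (f i) y)"
  by (induction I rule: infinite_finite_induct) (auto simp: ip_add_left)

lemma norm_ip_le: "norm (ip x y) \<le> norm x * norm y"
proof (cases "ip x y = 0")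
  case False
  \<comment> \<open>The real Cauchy-Schwarz inequality is applied at the scalar
    \<open>c = ip x y\<close>, in whose direction the represented functional attains its
    norm.\<close>
  have "norm (ip x y) * norm (ip x y) = inner x (scale (ip x y) y)"
    by (metis inner_ip power2_norm_eq_inner power2_eq_square)
  also have "\<dots> \<le> norm x * norm (scale (ip x y) y)"
    by (rule norm_cauchy_schwarz)
  also have "\<dots> = norm (ip x y) * (norm x * norm y)"
    by (simp add: norm_scale)
  finally show ?thesis using False by simp
qed simp

lemma inner_eq_ip: "inner x y = inner (ip x y) 1"
  by (simp add: inner_ip)

text \<open>Since \<open>x + scale c x = scale (1 + c) x\<close>, its squared norm can be expanded
  in two ways; comparing the terms linear in \<open>c\<close> gives the represented
  functional.\<close>

lemma ip_self: "ip x x = of_real ((norm x)\<^sup>2)"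
proof (rule ip_eqI)
  fix c :: 'k
  have "norm (x + scale c x) = norm (1 + c) * norm x"
    by (metis norm_scale scale_left_distrib scale_one)
  then have "(norm (x + scale c x))\<^sup>2 = (norm (1 + c))\<^sup>2 * (norm x)\<^sup>2"
    by (simp add: power_mult_distrib)
  moreover have "(norm (x + scale c x))\<^sup>2
      = (norm x)\<^sup>2 + 2 * inner x (scale c x) + (norm c)\<^sup>2 * (norm x)\<^sup>2"
    unfolding power2_norm_eq_inner
    by (simp add: inner_add_left inner_add_right inner_scale_scale inner_commute
        power2_norm_eq_inner)
  moreover have "(norm (1 + c))\<^sup>2 = 1 + 2 * inner 1 c + (norm c)\<^sup>2"
    by (simp add: power2_norm_eq_inner inner_add_left inner_add_right inner_commute[of c 1])
       (simp flip: power2_norm_eq_inner)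
  ultimately have "inner x (scale c x) = inner 1 c * (norm x)\<^sup>2"
    by (simp add: algebra_simps)
  then show "inner x (scale c x) = inner (of_real ((norm x)\<^sup>2)) c"
    by (simp add: of_real_def)
qed

text \<open>Hermitian symmetry would need a conjugation on \<open>'k\<close>. Symmetry of
  orthogonality does not: multiplying both arguments by the same scalar changes the inner product
  only by a positive factor.\<close>

lemma ip_eq_0_commute: "ip x y = 0 \<longleftrightarrow> ip y x = 0"
proof -
  have "ip y x = 0" if "ip x y = 0" for x y
  proof (rule ip_eqI)
    fix c
    show "inner y (scale c x) = inner 0 c"
    proof (cases "c = 0")
      case False
      have "inner y (scale c x) = inner (scale c (scale (1 / c) y)) (scale c x)"
        using False by simp
      also have "\<dots> = (norm c)\<^sup>2 * inner (ip x y) (1 / c)"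
        unfolding inner_scale_scale inner_ip by (simp add: inner_commute)
      finally show ?thesis using that by simp
    qed simp
  qed
  then show ?thesis by blast
qed

lemma bounded_linear_ip: "bounded_linear (\<lambda>x. ip x y)"
  by (rule bounded_linear_intro[where K = "norm y"])
     (auto simp: ip_add_left ip_scaleR_left norm_ip_le)

lemmas continuous_on_ip [continuous_intros] = bounded_linear.continuous_on[OF bounded_linear_ip]
lemmas tendsto_ip [tendsto_intros] = bounded_linear.tendsto[OF bounded_linear_ip]

text \<open>Pythagoras: the mixed term is twice the real inner product, which by
  \<open>inner_eq_ip\<close> is determined by \<open>ip x y\<close>.\<close>

lemma norm_add_ip_0: "ip x y = 0 \<Longrightarrow> (norm (x + y))\<^sup>2 = (norm x)\<^sup>2 + (norm y)\<^sup>2"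
  using inner_eq_ip[of x y]
  by (simp add: power2_norm_eq_inner inner_add_left inner_add_right inner_commute)

lemma bounded_linear_scale: "bounded_linear (scale c)"
  by (rule bounded_linear_intro[where K = "norm c"])
     (auto simp: scale_right_distrib scale_scaleR_right norm_scale mult.commute)

lemma bounded_linear_scale_left: "bounded_linear (\<lambda>c. scale c x)"
  by (rule bounded_linear_intro[where K = "norm x"])
     (auto simp: scale_left_distrib scale_scaleR norm_scale mult.commute)

lemma ip_span_0: "\<lbrakk>z \<in> span B; \<And>b. b \<in> B \<Longrightarrow> ip b y = 0\<rbrakk> \<Longrightarrow> ip z y = 0"
  by (induction rule: span_induct_alt) (auto simp: ip_add_left ip_scale_left)

subsection \<open>Orthonormal families\<close>

text \<open>An indexed family rather than a set: sequences are used with the index set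
  \<open>UNIV\<close>, finite sets with the identity as family.\<close>

definition orthonormal :: "'i set \<Rightarrow> ('i \<Rightarrow> 'a) \<Rightarrow> bool" where
  "orthonormal I e \<longleftrightarrow> (\<forall>i\<in>I. \<forall>j\<in>I. ip (e i) (e j) = (if i = j then 1 else 0))"

definition proj :: "'i set \<Rightarrow> ('i \<Rightarrow> 'a) \<Rightarrow> 'a \<Rightarrow> 'a" where
  "proj I e x = (\<Sum>i\<in>I. scale (ip x (e i)) (e i))"

lemma orthonormal_subset: "orthonormal I e \<Longrightarrow> J \<subseteq> I \<Longrightarrow> orthonormal J e"
  unfolding orthonormal_def by blast

lemma orthonormal_norm: "orthonormal I e \<Longrightarrow> i \<in> I \<Longrightarrow> norm (e i) = 1"
  by (metis orthonormal_def ip_self of_real_eq_1_iff norm_ge_zero power2_eq_1_iff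
      not_numeral_le_zero
    zero_neq_neg_one neg_one_eq_numeral_iff abs_norm_cancel abs_1 abs_minus_cancel)

lemma orthonormal_ip: "orthonormal I e \<Longrightarrow> i \<in> I \<Longrightarrow> j \<in> I \<Longrightarrow> ip (e i) (e j) = (if i = j then 1 else 0)"
  by (simp add: orthonormal_def)

lemma orthonormal_inj: "orthonormal I e \<Longrightarrow> inj_on e I"
  unfolding inj_on_def orthonormal_def by (metis (full_types) zero_neq_one)

lemma orthonormal_image: "orthonormal I e \<Longrightarrow> orthonormal (e ` I) (\<lambda>x. x)"
  using orthonormal_inj[of I e] unfolding orthonormal_def by (auto dest: inj_onD)

lemma ip_sum_orthonormal:
  assumes "orthonormal I e" "finite I" "j \<in> I"
  shows "ip (\<Sum>i\<in>I. scale (c i) (e i)) (e j) = c j"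
proof -
  have "ip (\<Sum>i\<in>I. scale (c i) (e i)) (e j) = (\<Sum>i\<in>I. c i * (if i = j then 1 else 0))"
    using assms(1,3) by (auto simp: ip_sum_left ip_scale_left orthonormal_def intro!: sum.cong)
  then show ?thesis using assms(2,3) by (simp add: if_distrib sum.delta cong: if_cong)
qed

lemma norm_sum_orthonormal:
  assumes "orthonormal I e" "finite I"
  shows "(norm (\<Sum>i\<in>I. scale (c i) (e i)))\<^sup>2 = (\<Sum>i\<in>I. (norm (c i))\<^sup>2)"
  using assms(2,1)
proof (induction I rule: finite_induct)
  case (insert i I)
  have "ip (scale (c i) (e i)) (\<Sum>i\<in>I. scale (c i) (e i)) = 0"
    unfolding ip_eq_0_commute[of "scale (c i) (e i)"]
  proof -
    have "ip (scale (c j) (e j)) (scale (c i) (e i)) = 0" if "j \<in> I" for j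
    proof -
      have "ip (e i) (e j) = 0" using insert that by (auto simp: orthonormal_def)
      then show ?thesis by (metis ip_eq_0_commute ip_scale_left mult_zero_right)
    qed
    then show "ip (\<Sum>i\<in>I. scale (c i) (e i)) (scale (c i) (e i)) = 0"
      by (simp add: ip_sum_left)
  qed
  from norm_add_ip_0[OF this] show ?case
    using insert orthonormal_norm[OF insert.prems, of i] orthonormal_subset[OF insert.prems, of I]
    by (auto simp: norm_scale)
qed simp

lemma proj_in_span: "proj I e x \<in> span (e ` I)"
  unfolding proj_def by (intro span_sum span_scale span_base) auto

lemma ip_proj: "\<lbrakk>orthonormal I e; finite I; j \<in> I\<rbrakk> \<Longrightarrow> ip (proj I e x) (e j) = ip x (e j)"
  unfolding proj_def by (rule ip_sum_orthonormal)

lemma norm_proj: "\<lbrakk>orthonormal I e; finite I\<rbrakk> \<Longrightarrow> (norm (proj I e x))\<^sup>2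
    = (\<Sum>i\<in>I. (norm (ip x (e i)))\<^sup>2)"
  unfolding proj_def by (rule norm_sum_orthonormal)

lemma proj_add: "proj I e (x + y) = proj I e x + proj I e y"
  by (simp add: proj_def ip_add_left scale_left_distrib sum.distrib)

lemma proj_diff: "proj I e (x - y) = proj I e x - proj I e y"
  by (simp add: proj_def ip_diff_left scale_left_diff_distrib sum_subtractf)

lemma proj_scale: "proj I e (scale c x) = scale c (proj I e x)"
  by (simp add: proj_def ip_scale_left scale_sum_right)

lemma proj_0 [simp]: "proj I e 0 = 0"
  by (simp add: proj_def)

lemma proj_perp: "(\<And>i. i \<in> I \<Longrightarrow> ip x (e i) = 0) \<Longrightarrow> proj I e x = 0"
  by (simp add: proj_def)

lemma ip_diff_proj:
  assumes "orthonormal I e" "finite I" "z \<in> span (e ` I)"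
  shows "ip (x - proj I e x) z = 0"
  by (subst ip_eq_0_commute, rule ip_span_0[OF assms(3)])
     (use assms in \<open>auto simp: ip_eq_0_commute[of "e _"] ip_diff_left ip_proj\<close>)

text \<open>The residual of \<open>z\<close> lies in the span and is orthogonal to it, hence to
  itself.\<close>

lemma proj_span:
  assumes "orthonormal I e" "finite I" "z \<in> span (e ` I)"
  shows "proj I e z = z"
proof -
  have "z - proj I e z \<in> span (e ` I)"
    using assms proj_in_span span_diff by blast
  from ip_diff_proj[OF assms(1,2) this, of z] show ?thesis by (simp add: ip_self)
qed

lemma norm_proj_le:
  assumes "orthonormal I e" "finite I"
  shows "norm (proj I e x) \<le> norm x"
proof -
  have "(norm (x - proj I e x + proj I e x))\<^sup>2 = (norm (x - proj I e x))\<^sup>2 + (norm (proj I e x))\<^sup>2"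
    by (rule norm_add_ip_0) (use ip_diff_proj[OF assms proj_in_span] in blast)
  then have "(norm (proj I e x))\<^sup>2 \<le> (norm x)\<^sup>2" by simp
  then show ?thesis by (simp add: abs_le_square_iff[symmetric])
qed

lemma bessel:
  assumes "orthonormal I e" "finite I"
  shows "(\<Sum>i\<in>I. (norm (ip x (e i)))\<^sup>2) \<le> (norm x)\<^sup>2"
  using norm_proj_le[OF assms, of x] by (simp flip: norm_proj[OF assms] add: power_mono)

section \<open>Gram-Schmidt extension and common kernels of functionals\<close>

lemma orthonormal_independent:
  assumes "orthonormal O' (\<lambda>x. x)"
  shows "independent O'"
  unfolding independent_explicit_finite_subsets
proof safe
  fix S u v
  assume S: "S \<subseteq> O'" "finite S" "(\<Sum>v\<in>S. scale (u v) v) = 0" "v \<in> S"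
  with ip_sum_orthonormal[OF orthonormal_subset[OF assms S(1)] S(2), of v u] show "u v = 0" by simp
qed

text \<open>One Gram-Schmidt step: \<open>u\<close> is the normalized residual of
  \<open>b\<close>.\<close>

lemma orthonormal_insert:
  assumes "orthonormal O' (\<lambda>x. x)" "finite O'" "b \<notin> span O'"
  obtains u where "norm u = 1" "u \<in> span (insert b O')" "\<And>x. x \<in> O' \<Longrightarrow> ip u x = 0"
    "orthonormal (insert u O') (\<lambda>x. x)" "span (insert u O') = span (insert b O')" "u \<notin> O'"
proof -
  define r where "r = b - proj O' (\<lambda>x. x) b"
  define u where "u = (1 / norm r) *\<^sub>R r"
  have pr: "proj O' (\<lambda>x. x) b \<in> span O'" using proj_in_span[of O' "\<lambda>x. x"] by simp
  have r0: "r \<noteq> 0" using assms(3) pr by (auto simp: r_def)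
  have nu: "norm u = 1" using r0 by (simp add: u_def)
  have perp: "ip u x = 0" if "x \<in> O'" for x
    using ip_diff_proj[OF assms(1,2), of x b] that span_base[of x O']
    by (auto simp: u_def r_def ip_scaleR_left)
  then have perp': "ip x u = 0" if "x \<in> O'" for x
    using that ip_eq_0_commute by blast
  have uscale: "u = scale (of_real (1 / norm r)) r" "r = scale (of_real (norm r)) u"
    using r0 by (auto simp: u_def scale_of_real simp del: of_real_divide)
  have us: "u \<in> span (insert b O')"
    unfolding uscale(1) r_def
    using pr span_mono[of O' "insert b O'"]
    by (intro span_scale span_diff) (auto simp: span_base)
  have "b = r + proj O' (\<lambda>x. x) b" by (simp add: r_def)
  also have "\<dots> \<in> span (insert u O')"
    using pr span_mono[of O' "insert u O'"]
    by (subst uscale(2), intro span_add span_scale) (auto simp: span_base)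
  finally have bs: "b \<in> span (insert u O')" .
  have "span (insert u O') = span (insert b O')"
    unfolding span_eq using us bs by (auto simp: span_base)
  moreover have "u \<notin> O'"
  proof
    assume "u \<in> O'"
    then have "ip u u = 0" by (rule perp)
    then show False using nu by (simp add: ip_self)
  qed
  moreover from this have "orthonormal (insert u O') (\<lambda>x. x)"
    using assms(1) perp perp' nu by (auto simp: orthonormal_def ip_self)
  ultimately show ?thesis using that nu us perp by blast
qed

text \<open>Gram-Schmidt, one vector of \<open>B\<close> at a time. Vectors already in the span are
  skipped, so the cardinalities satisfy only an inequality.\<close>

lemma orthonormal_extend:
  assumes "finite B" "orthonormal O' (\<lambda>x. x)" "finite O'"
  shows "\<exists>O''. O' \<subseteq> O'' \<and> finite O'' \<and> orthonormal O'' (\<lambda>x. x) \<and> span O'' = span (O' \<union> B) \<and>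
    card O'' \<le> card O' + card B"
  using assms(1)
proof (induction B rule: finite_induct)
  case empty
  show ?case using assms by (intro exI[of _ O']) auto
next
  case (insert b B)
  obtain O'' where O: "O' \<subseteq> O''" "finite O''" "orthonormal O'' (\<lambda>x. x)" "span O'' = span (O' \<union> B)"
    "card O'' \<le> card O' + card B"
    using insert.IH by blast
  have sp: "span (insert b O'') = span (O' \<union> insert b B)"
    using O(4) by (simp add: span_insert)
  show ?case
  proof (cases "b \<in> span O''")
    case True
    then have "span O'' = span (O' \<union> insert b B)" using sp span_redundant[of b O''] by simp
    then show ?thesis using O insert.hyps by (intro exI[of _ O'']) auto
  next
    case False
    then obtain u where "orthonormal (insert u O'') (\<lambda>x. x)"
      "span (insert u O'') = span (insert b O'')"
      "u \<notin> O''" using orthonormal_insert[OF O(3,2)] by blast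
    then show ?thesis
      using O insert.hyps sp by (intro exI[of _ "insert u O''"]) auto
  qed
qed

lemma orthonormal_card_le:
  assumes "orthonormal O' (\<lambda>x. x)" "finite T" "O' \<subseteq> span T"
  shows "finite O'" "card O' \<le> card T"
  using independent_span_bound[OF assms(2) orthonormal_independent[OF assms(1)] assms(3)] by auto

text \<open>Each functional lowers the dimension of the common kernel by at most one. The kernel is
  presented by an orthonormal set, so that dimension becomes cardinality.\<close>

lemma orthonormal_kernel:
  assumes "finite \<Phi>" "orthonormal O' (\<lambda>x. x)" "finite O'"
    and "\<And>f. f \<in> \<Phi> \<Longrightarrow> Vector_Spaces.linear scale (*) (f :: 'a \<Rightarrow> 'k)"
  obtains O'' where "finite O''" "orthonormal O'' (\<lambda>x. x)" "O'' \<subseteq> span O'"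
    "card O' \<le> card O'' + card \<Phi>"
    "\<And>f x. f \<in> \<Phi> \<Longrightarrow> x \<in> O'' \<Longrightarrow> f x = 0"
  using assms(1,4)
proof (induction \<Phi> arbitrary: thesis rule: finite_induct)
  case empty
  show ?case by (rule empty(1)[of O']) (use assms in \<open>auto intro: span_base\<close>)
next
  case (insert f \<Phi>)
  obtain P where P: "finite P" "orthonormal P (\<lambda>x. x)" "P \<subseteq> span O'" "card O' \<le> card P + card \<Phi>"
    "\<And>f x. f \<in> \<Phi> \<Longrightarrow> x \<in> P \<Longrightarrow> f x = 0"
    using insert.IH[OF _ insert.prems(2)] by blast
  interpret f: Vector_Spaces.linear scale "(*)" f using insert.prems(2) by blast
  show ?case
  proof (cases "\<forall>x\<in>P. f x = 0")
    case True
    then show ?thesis using P insert.hyps by (intro insert.prems(1)[of P]) auto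
  next
    case False
    then obtain p where p: "p \<in> P" "f p \<noteq> 0" by blast
    \<comment> \<open>Elimination with the pivot \<open>p\<close>: the multiple of \<open>p\<close>
      is chosen so that \<open>f\<close> vanishes on the new vectors, and the earlier functionals
      keep vanishing.\<close>
    define B where "B = (\<lambda>x. x - scale (f x / f p) p) ` (P - {p})"
    have "finite B" using P by (simp add: B_def)
    moreover have "orthonormal {} (\<lambda>x. x)" by (simp add: orthonormal_def)
    ultimately obtain Q where Q: "finite Q" "orthonormal Q (\<lambda>x. x)" "span Q = span B"
      using orthonormal_extend[of B "{}"] by auto
    have BP: "B \<subseteq> span P"
      using p unfolding B_def by (blast intro: span_diff span_scale span_base)
    have zB: "g x = 0" if "g \<in> insert f \<Phi>" "x \<in> B" for g x
    proof -
      interpret g: Vector_Spaces.linear scale "(*)" g using insert.prems(2) that by blast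
      show ?thesis
      proof (cases "g = f")
        case True
        then show ?thesis using that p by (auto simp: B_def f.diff f.scale)
      next
        case False
        then show ?thesis using that P(5)[of g] p(1) by (auto simp: B_def g.diff g.scale)
      qed
    qed
    have zQ: "g x = 0" if "g \<in> insert f \<Phi>" "x \<in> Q" for g x
    proof -
      interpret g: Vector_Spaces.linear scale "(*)" g using insert.prems(2) that by blast
      have "x \<in> span B" using Q(3) that span_base by blast
      then show ?thesis
        by (induction rule: span_induct_alt) (use zB that in \<open>auto simp: g.add g.scale\<close>)
    qed
    \<comment> \<open>Adding the pivot back recovers \<open>P\<close>, so passing to
      \<open>Q\<close> costs at most one dimension.\<close>
    have "P \<subseteq> span (insert p Q)"
    proof
      fix x assume x: "x \<in> P"
      show "x \<in> span (insert p Q)"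
      proof (cases "x = p")
        case False
        then have "x - scale (f x / f p) p \<in> span Q"
          using x Q(3) by (auto simp: B_def span_base)
        then have "x - scale (f x / f p) p + scale (f x / f p) p \<in> span (insert p Q)"
          using span_mono[of Q "insert p Q"]
          by (intro span_add[of "x - scale (f x / f p) p"] span_scale) (auto simp: span_base)
        then show ?thesis by simp
      qed (simp add: span_base)
    qed
    then have "card P \<le> card (insert p Q)"
      using orthonormal_card_le(2)[OF P(2)] Q(1) by simp
    also have "\<dots> \<le> Suc (card Q)" using Q(1) by (simp add: card_insert_if)
    finally have "card O' \<le> card Q + card (insert f \<Phi>)"
      using P(4) insert.hyps by simp
    moreover have "Q \<subseteq> span O'"
      using Q(3) BP P(3) by (metis order_trans span_minimal span_superset subspace_span)
    ultimately show ?thesis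
      using Q(1,2) zQ by (intro insert.prems(1)[of Q]) auto
  qed
qed

lemma norm_diff_proj_le:
  assumes "orthonormal I e" "finite I"
  shows "norm (x - proj I e x) \<le> norm x"
proof -
  have "(norm (x - proj I e x + proj I e x))\<^sup>2 = (norm (x - proj I e x))\<^sup>2 + (norm (proj I e x))\<^sup>2"
    by (rule norm_add_ip_0) (use ip_diff_proj[OF assms proj_in_span] in blast)
  then have "(norm (x - proj I e x))\<^sup>2 \<le> (norm x)\<^sup>2" by simp
  then show ?thesis by (simp add: abs_le_square_iff[symmetric])
qed

section \<open>Orthonormal sequences and the projection onto their closed span\<close>

lemma orthonormal_summable:
  fixes e :: "nat \<Rightarrow> 'a"
  assumes e: "orthonormal UNIV e" and c: "summable (\<lambda>j. (norm (c j))\<^sup>2)"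
  shows "\<exists>x. (\<lambda>j. scale (c j) (e j)) sums x"
proof -
  define X where "X n = (\<Sum>j<n. scale (c j) (e j))" for n
  \<comment> \<open>Pythagoras turns distances of partial sums into sections of the convergent
    series of squares, so completeness supplies the limit.\<close>
  have "Cauchy X"
  proof (rule CauchyI')
    fix r :: real assume r: "r > 0"
    then obtain N where N: "\<And>m n. m \<ge> N \<Longrightarrow> norm (\<Sum>j=m..<n. (norm (c j))\<^sup>2) < r\<^sup>2"
      using c unfolding summable_Cauchy by (meson zero_less_power)
    show "\<exists>M. \<forall>m\<ge>M. \<forall>n>m. dist (X m) (X n) < r"
    proof (intro exI allI impI)
      fix m n assume mn: "m \<ge> N" "n > m"
      have "X n - X m = (\<Sum>j=m..<n. scale (c j) (e j))"
        using mn sum_diff_nat_ivl[of 0 m n "\<lambda>j. scale (c j) (e j)"]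
        by (simp add: X_def atLeast0LessThan)
      then have "(norm (X n - X m))\<^sup>2 = (\<Sum>j=m..<n. (norm (c j))\<^sup>2)"
        using norm_sum_orthonormal[OF orthonormal_subset[OF e], of "{m..<n}" c] by simp
      also have "\<dots> < r\<^sup>2" using N[OF mn(1), of n] by (simp add: sum_nonneg)
      finally show "dist (X m) (X n) < r"
        using r by (simp add: dist_norm norm_minus_commute power2_less_imp_less)
    qed
  qed
  then show ?thesis
    unfolding sums_def X_def[abs_def] convergent_def[symmetric] by (rule Cauchy_convergent)
qed

lemma orthonormal_sums_norm:
  fixes e :: "nat \<Rightarrow> 'a"
  assumes e: "orthonormal UNIV e" and x: "(\<lambda>j. scale (c j) (e j)) sums x"
  shows "(\<lambda>j. (norm (c j))\<^sup>2) sums (norm x)\<^sup>2"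
proof -
  have "(\<lambda>n. (norm (\<Sum>j<n. scale (c j) (e j)))\<^sup>2) \<longlonglongrightarrow> (norm x)\<^sup>2"
    using x unfolding sums_def by (intro tendsto_intros)
  then show ?thesis
    unfolding sums_def by (simp add: norm_sum_orthonormal[OF orthonormal_subset[OF e]])
qed

lemma orthonormal_sums_ip:
  fixes e :: "nat \<Rightarrow> 'a"
  assumes e: "orthonormal UNIV e" and x: "(\<lambda>j. scale (c j) (e j)) sums x"
  shows "ip x (e j) = c j"
proof -
  have "(\<lambda>n. ip (\<Sum>j<n. scale (c j) (e j)) (e j)) \<longlonglongrightarrow> ip x (e j)"
    using x unfolding sums_def by (intro tendsto_intros)
  moreover have "\<forall>\<^sub>F n in sequentially. ip (\<Sum>j<n. scale (c j) (e j)) (e j) = c j"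
    using eventually_gt_at_top[of j]
    by eventually_elim (use ip_sum_orthonormal[OF orthonormal_subset[OF e]] in auto)
  then have "(\<lambda>n. ip (\<Sum>j<n. scale (c j) (e j)) (e j)) \<longlonglongrightarrow> c j"
    by (rule tendsto_eventually)
  ultimately show ?thesis by (rule LIMSEQ_unique)
qed

lemma bessel_inf:
  fixes e :: "nat \<Rightarrow> 'a"
  assumes e: "orthonormal UNIV e"
  shows "summable (\<lambda>j. (norm (ip x (e j)))\<^sup>2)" "(\<Sum>j. (norm (ip x (e j)))\<^sup>2) \<le> (norm x)\<^sup>2"
proof -
  have le: "(\<Sum>j<n. (norm (ip x (e j)))\<^sup>2) \<le> (norm x)\<^sup>2" for n
    using bessel[OF orthonormal_subset[OF e]] by blast
  then show s: "summable (\<lambda>j. (norm (ip x (e j)))\<^sup>2)"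
    by (intro summableI_nonneg_bounded) auto
  show "(\<Sum>j. (norm (ip x (e j)))\<^sup>2) \<le> (norm x)\<^sup>2"
    by (rule suminf_le_const[OF s le])
qed

text \<open>For orthonormal \<open>e\<close> this is the orthogonal projection onto the closed span
  of \<open>range e\<close>, the limit of the finite projections
  \<open>proj {..<n} e\<close>.\<close>

definition proj_seq :: "(nat \<Rightarrow> 'a) \<Rightarrow> 'a \<Rightarrow> 'a" where
  "proj_seq e x = (\<Sum>j. scale (ip x (e j)) (e j))"

lemma proj_seq_sums:
  assumes "orthonormal UNIV e"
  shows "(\<lambda>j. scale (ip x (e j)) (e j)) sums proj_seq e x"
proof -
  obtain y where "(\<lambda>j. scale (ip x (e j)) (e j)) sums y"
    using orthonormal_summable[OF assms bessel_inf(1)[OF assms]] by blast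
  then show ?thesis unfolding proj_seq_def by (metis sums_unique)
qed

lemma proj_tendsto_proj_seq: "orthonormal UNIV e \<Longrightarrow> (\<lambda>n. proj {..<n} e x) \<longlonglongrightarrow> proj_seq e x"
  using proj_seq_sums unfolding sums_def proj_def .

lemma proj_seq_in_closure:
  assumes "orthonormal UNIV e"
  shows "proj_seq e x \<in> closure (span (range e))"
proof -
  have "proj {..<n} e x \<in> span (range e)" for n
    using proj_in_span[of "{..<n}" e x] span_mono[of "e ` {..<n}" "range e"] by blast
  then show ?thesis
    unfolding closure_sequential
    by (intro exI[of _ "\<lambda>n. proj {..<n} e x"] conjI allI proj_tendsto_proj_seq[OF assms])
qed

lemma ip_proj_seq: "orthonormal UNIV e \<Longrightarrow> ip (proj_seq e x) (e j) = ip x (e j)"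
  by (rule orthonormal_sums_ip[OF _ proj_seq_sums])

lemma proj_seq_add: "orthonormal UNIV e \<Longrightarrow> proj_seq e (x + y) = proj_seq e x + proj_seq e y"
  using sums_add[OF proj_seq_sums[of e x] proj_seq_sums[of e y]] proj_seq_sums[of e "x + y"]
  by (simp add: ip_add_left scale_left_distrib sums_unique2)

lemma proj_seq_scale: "orthonormal UNIV e \<Longrightarrow> proj_seq e (scale c x) = scale c (proj_seq e x)"
  using bounded_linear.sums[OF bounded_linear_scale proj_seq_sums[of e x]] proj_seq_sums[of e "scale
      c x"]
  by (simp add: ip_scale_left sums_unique2)

lemma norm_proj_seq_le: "orthonormal UNIV e \<Longrightarrow> norm (proj_seq e x) \<le> norm x"
  by (rule LIMSEQ_le_const2[OF tendsto_norm[OF proj_tendsto_proj_seq]])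
     (auto intro!: norm_proj_le intro: orthonormal_subset)

lemma bounded_linear_proj_seq: "orthonormal UNIV e \<Longrightarrow> bounded_linear (proj_seq e)"
  by (rule bounded_linear_intro[where K = 1])
     (auto simp: proj_seq_add norm_proj_seq_le simp flip: scale_of_real proj_seq_scale)

text \<open>The fixed points of \<open>proj_seq e\<close> form a closed subspace that contains every
  \<open>e i\<close>.\<close>

lemma proj_seq_closure:
  assumes e: "orthonormal UNIV e" and z: "z \<in> closure (span (range e))"
  shows "proj_seq e z = z"
proof -
  have "proj_seq e (e i) = e i" for i
  proof -
    have "(\<lambda>j. scale (ip (e i) (e j)) (e j)) sums e i"
      using sums_single[of i "\<lambda>j. e j"] e
      by (simp add: orthonormal_ip if_distrib[of "\<lambda>x. scale x _"] eq_commute[of i] cong: if_cong)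
    then show ?thesis using proj_seq_sums[OF e] sums_unique2 by blast
  qed
  then have "span (range e) \<subseteq> {z. proj_seq e z = z}"
    by (intro span_minimal)
       (auto simp: subspace_def proj_seq_add[OF e] proj_seq_scale[OF e]
          linear_simps(3)[OF bounded_linear_proj_seq[OF e]])
  moreover have "closed {z. proj_seq e z = z}"
    by (intro closed_Collect_eq linear_continuous_on bounded_linear_proj_seq e continuous_on_id)
  ultimately show ?thesis using z closure_minimal by blast
qed

lemma subspace_closure:
  assumes V: "subspace V"
  shows "subspace (closure V)"
proof (rule subspaceI)
  show "0 \<in> closure V" using subspace_0[OF V] closure_subset by blast
next
  fix x y assume "x \<in> closure V" "y \<in> closure V"
  then obtain X Y where "\<forall>n. X n \<in> V" "X \<longlonglongrightarrow> x" "\<forall>n. Y n \<in> V" "Y \<longlonglongrightarrow> y"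
    unfolding closure_sequential by blast
  then have "(\<forall>n. X n + Y n \<in> V) \<and> (\<lambda>n. X n + Y n) \<longlonglongrightarrow> x + y"
    using subspace_add[OF V] tendsto_add by blast
  then show "x + y \<in> closure V"
    unfolding closure_sequential by (rule exI[of _ "\<lambda>n. X n + Y n"])
next
  fix c x assume "x \<in> closure V"
  then obtain X where "\<forall>n. X n \<in> V" "X \<longlonglongrightarrow> x"
    unfolding closure_sequential by blast
  then have "(\<forall>n. scale c (X n) \<in> V) \<and> (\<lambda>n. scale c (X n)) \<longlonglongrightarrow> scale c x"
    using subspace_scale[OF V] bounded_linear.tendsto[OF bounded_linear_scale] by blast
  then show "scale c x \<in> closure V"
    unfolding closure_sequential by (rule exI[of _ "\<lambda>n. scale c (X n)"])
qed

text \<open>The image of the unit ball of square-summable sequences under the diagonal operator with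
  entries \<open>a j\<close>. The coefficients are quantified existentially, so no division by
  \<open>a j\<close> occurs.\<close>

definition diag_ellipsoid :: "(nat \<Rightarrow> 'a) \<Rightarrow> (nat \<Rightarrow> real) \<Rightarrow> 'a set" where
  "diag_ellipsoid e a = {x. \<exists>c. summable (\<lambda>j. (norm (c j))\<^sup>2) \<and> (\<Sum>j. (norm (c j))\<^sup>2) \<le> 1 \<and>
     (\<lambda>j. scale (of_real (a j) * c j) (e j)) sums x}"

end

section \<open>Bounded operators between two Hilbert spaces over the same field\<close>

locale hilbert_pair = H1: hilbert_space s1 + H2: hilbert_space s2
  for s1 :: "'k::{real_normed_field,euclidean_space} \<Rightarrow> 'a::{real_inner,complete_space} \<Rightarrow> 'a"
  and s2 :: "'k \<Rightarrow> 'b::{real_inner,complete_space} \<Rightarrow> 'b"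
begin

lemma bounded_opsI:
  assumes "\<And>x y. T (x + y) = T x + T y" "\<And>c x. T (s1 c x) = s2 c (T x)"
    "\<And>x. norm (T x) \<le> M * norm x"
  shows "T \<in> bounded_ops s1 s2"
  using assms H1.vector_space_axioms H2.vector_space_axioms
  unfolding bounded_ops_def Vector_Spaces.linear_iff by blast

lemma bounded_opsD:
  assumes "T \<in> bounded_ops s1 s2"
  shows "Vector_Spaces.linear s1 s2 T" "T (x + y) = T x + T y" "T (s1 c x) = s2 c (T x)"
    "T (x - y) = T x - T y" "T 0 = 0" "bounded_linear T"
proof -
  show lin: "Vector_Spaces.linear s1 s2 T" using assms by (simp add: bounded_ops_def)
  interpret T: Vector_Spaces.linear s1 s2 T by (rule lin)
  show "T (x + y) = T x + T y" "T (s1 c x) = s2 c (T x)" "T (x - y) = T x - T y" "T 0 = 0"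
    by (simp_all add: T.add T.scale T.diff)
  obtain M where "\<And>x. norm (T x) \<le> M * norm x" using assms by (auto simp: bounded_ops_def)
  then show "bounded_linear T"
    by (intro bounded_linear_intro[where K = M])
       (auto simp: T.add T.scale mult.commute simp flip: H1.scale_of_real H2.scale_of_real)
qed

lemma bounded_ops_pos_bound:
  assumes "T \<in> bounded_ops s1 s2"
  obtains M where "M > 0" "\<And>x. norm (T x) \<le> M * norm x"
  using bounded_linear.pos_bounded[OF bounded_opsD(6)[OF assms]] by (metis mult.commute)

lemma bounded_ops_sum:
  assumes "T \<in> bounded_ops s1 s2"
  shows "T (\<Sum>i\<in>I. s1 (c i) (f i)) = (\<Sum>i\<in>I. s2 (c i) (T (f i)))"
proof -
  interpret T: Vector_Spaces.linear s1 s2 T using bounded_opsD(1)[OF assms] .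
  show ?thesis by (simp add: T.sum T.scale)
qed

subsection \<open>Singular value decomposition\<close>

text \<open>
  Along a maximizing sequence \<open>u\<close> a subsequence of \<open>A \<circ> u\<close> converges, so the midpoints of its members
  are almost maximizing as well, and the parallelogram law makes the subsequence of \<open>u\<close> Cauchy.
\<close>

lemma attains_norm:
  assumes A: "A \<in> bounded_ops s1 s2" and co: "compact (closure (A ` cball 0 1))"
    and D: "D = {x. \<forall>y\<in>O'. H1.ip x y = 0}" and x0: "x0 \<in> D" "A x0 \<noteq> 0"
  obtains v where "v \<in> D" "norm v = 1" "\<And>x. x \<in> D \<Longrightarrow> norm (A x) \<le> norm (A v) * norm x"
proof -
  note Ad = bounded_opsD(2-5)[OF A]
  have Ascale: "A (r *\<^sub>R x) = r *\<^sub>R A x" for r x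
    by (simp add: linear_simps[OF bounded_opsD(6)[OF A]])
  have DR: "r *\<^sub>R x \<in> D" if "x \<in> D" for r x using that by (auto simp: D H1.ip_scaleR_left)
  have Dadd: "x + y \<in> D" if "x \<in> D" "y \<in> D" for x y using that by (auto simp: D H1.ip_add_left)
  have "closed {x. H1.ip x y = 0}" for y
    by (intro closed_Collect_eq continuous_intros)
  moreover have "D = (\<Inter>y\<in>O'. {x. H1.ip x y = 0})" by (auto simp: D)
  ultimately have Dclosed: "closed D" by auto
  obtain M where M: "M > 0" "\<And>x. norm (A x) \<le> M * norm x"
    using bounded_ops_pos_bound[OF A] by blast
  define N where "N = (\<lambda>x. norm (A x)) ` {x \<in> D. norm x = 1}"
  define s where "s = Sup N"
  have "norm (A x) \<le> M" if "norm x = 1" for x using M(2)[of x] that by simp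
  then have bdd: "bdd_above N" by (intro bdd_aboveI[of _ M]) (auto simp: N_def)
  have le: "norm (A x) \<le> s * norm x" if "x \<in> D" for x
  proof (cases "x = 0")
    case False
    then have "(1 / norm x) *\<^sub>R x \<in> {x \<in> D. norm x = 1}" using DR[OF that] by simp
    then have "norm (A ((1 / norm x) *\<^sub>R x)) \<le> s"
      unfolding s_def using bdd by (intro cSup_upper) (auto simp: N_def)
    then show ?thesis using False by (simp add: Ascale field_simps)
  qed (simp add: Ad)
  have s0: "s > 0"
  proof -
    have "0 < norm (A x0)" using x0 by simp
    also have "\<dots> \<le> s * norm x0" by (rule le[OF x0(1)])
    finally show ?thesis by (metis norm_ge_zero mult_nonpos_nonneg not_less)
  qed
  have Nne: "N \<noteq> {}"
  proof -
    have "x0 \<noteq> 0" using x0 Ad by metis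
    then have "(1 / norm x0) *\<^sub>R x0 \<in> {x \<in> D. norm x = 1}" using DR[OF x0(1)] by simp
    then show ?thesis unfolding N_def by blast
  qed
  have "\<exists>x. x \<in> D \<and> norm x = 1 \<and> s - 1 / real (Suc n) < norm (A x)" for n
  proof -
    have "s - 1 / real (Suc n) < Sup N" unfolding s_def[symmetric] by simp
    then obtain y where "y \<in> N" "s - 1 / real (Suc n) < y"
      using less_cSup_iff[OF Nne bdd] by blast
    then show ?thesis by (auto simp: N_def)
  qed
  then obtain u where u: "\<And>n. u n \<in> D" "\<And>n. norm (u n) = 1"
    "\<And>n. s - 1 / real (Suc n) < norm (A (u n))"
    by metis
  have "\<forall>n. A (u n) \<in> closure (A ` cball 0 1)"
    using closure_subset[of "A ` cball 0 1"] u(2) by (auto simp: image_subset_iff)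
  then obtain r l where r: "strict_mono (r :: nat \<Rightarrow> nat)" "((\<lambda>n. A (u n)) \<circ> r) \<longlonglongrightarrow> l"
    using co[unfolded compact_def, THEN spec, of "\<lambda>n. A (u n)"] by blast
  define w where "w n = u (r n)" for n
  have w: "\<And>n. w n \<in> D" "\<And>n. norm (w n) = 1" by (auto simp: w_def u)
  have wA: "s - 1 / real (Suc n) < norm (A (w n))" for n
  proof -
    have "1 / real (Suc (r n)) \<le> 1 / real (Suc n)"
      using seq_suble[OF r(1), of n] by (simp add: divide_simps)
    then show ?thesis using u(3)[of "r n"] by (simp add: w_def)
  qed
  have cA: "Cauchy (\<lambda>n. A (w n))"
    using LIMSEQ_imp_Cauchy[OF r(2)] by (simp add: o_def w_def)
  have "Cauchy w"
  proof (rule metric_CauchyI)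
    fix \<epsilon> :: real assume \<epsilon>: "\<epsilon> > 0"
    \<comment> \<open>The estimate below gives \<open>s * (2 - p) < 3 * \<delta>\<close>, that is
      \<open>2 - p < \<epsilon>\<^sup>2 / 4\<close>; the parallelogram law then multiplies by
      \<open>2 + p \<le> 4\<close>.\<close>
    define \<delta> where "\<delta> = s * \<epsilon>\<^sup>2 / 12"
    have \<delta>: "\<delta> > 0" using \<epsilon> s0 by (simp add: \<delta>_def)
    obtain N1 where N1: "\<And>m n. m \<ge> N1 \<Longrightarrow> n \<ge> N1 \<Longrightarrow> dist (A (w m)) (A (w n)) < \<delta>"
      using cA \<delta> unfolding Cauchy_def by meson
    obtain N2 where N2: "1 / real (Suc N2) < \<delta>" using \<delta> nat_approx_posE by blast
    show "\<exists>M. \<forall>m\<ge>M. \<forall>n\<ge>M. dist (w m) (w n) < \<epsilon>"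
    proof (intro exI[of _ "max N1 N2"] allI impI)
      fix m n assume mn: "max N1 N2 \<le> m" "max N1 N2 \<le> n"
      define p where "p = norm (w m + w n)"
      have p2: "p \<le> 2" using norm_triangle_ineq[of "w m" "w n"] w(2) by (simp add: p_def)
      have p0: "p \<ge> 0" by (simp add: p_def)
      have "1 / real (Suc n) \<le> 1 / real (Suc N2)" using mn by (simp add: divide_simps)
      then have 1: "norm (A (w n)) > s - \<delta>" using wA[of n] N2 by linarith
      have 2: "norm (A (w m) - A (w n)) < \<delta>" using N1[of m n] mn by (simp add: dist_norm)
      have "2 * norm (A (w n)) = norm ((A (w m) + A (w n)) - (A (w m) - A (w n)))"
        by (simp flip: scaleR_2)
      also have "\<dots> \<le> norm (A (w m) + A (w n)) + norm (A (w m) - A (w n))"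
        by (rule norm_triangle_ineq4)
      finally have "2 * (s - \<delta>) - \<delta> < norm (A (w m + w n))" using 1 2 by (simp add: Ad)
      also have "\<dots> \<le> s * p" unfolding p_def by (intro le Dadd w)
      finally have "s * (2 - p) < 3 * \<delta>" by (simp add: algebra_simps)
      then have "s * (2 - p) < s * (\<epsilon>\<^sup>2 / 4)" by (simp add: \<delta>_def)
      then have 3: "2 - p < \<epsilon>\<^sup>2 / 4" using s0 by simp
      have "(norm (w m - w n))\<^sup>2 + p\<^sup>2 = 4"
        unfolding p_def power2_norm_eq_inner
        using w(2)[of m] w(2)[of n]
        by (simp add: inner_add_left inner_add_right inner_diff_left inner_diff_right
          inner_commute norm_eq_1)
      then have "(norm (w m - w n))\<^sup>2 = (2 - p) * (2 + p)"
        by (simp add: algebra_simps power2_eq_square)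
      also have "\<dots> \<le> (2 - p) * 4" using p2 p0 by (intro mult_left_mono) auto
      also have "\<dots> < \<epsilon>\<^sup>2" using 3 by simp
      finally show "dist (w m) (w n) < \<epsilon>"
        using \<epsilon> by (simp add: dist_norm power2_less_imp_less)
    qed
  qed
  then obtain v where v: "w \<longlonglongrightarrow> v" using Cauchy_convergent convergent_def by blast
  have vD: "v \<in> D" using closed_sequentially[OF Dclosed _ v] w by blast
  have nv: "norm v = 1"
    using tendsto_norm[OF v] by (simp add: w(2) LIMSEQ_const_iff)
  have "(\<lambda>n. norm (A (w n))) \<longlonglongrightarrow> norm (A v)"
    by (intro tendsto_norm bounded_linear.tendsto[OF bounded_opsD(6)[OF A]] v)
  moreover have "(\<lambda>n. s - 1 / real (Suc n)) \<longlonglongrightarrow> s - 0"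
    by (intro tendsto_diff tendsto_const LIMSEQ_Suc[OF lim_1_over_n])
  ultimately have "s - 0 \<le> norm (A v)"
    using wA by (intro LIMSEQ_le[of _ "s - 0" _ "norm (A v)"]) (auto intro: less_imp_le)
  then have "norm (A x) \<le> norm (A v) * norm x" if "x \<in> D" for x
    using le[OF that] mult_right_mono[of s "norm (A v)" "norm x"] by simp
  then show ?thesis using that vD nv by blast
qed

text \<open>First variation at the maximizer: for \<open>z\<close> in \<open>D\<close> with
  vanishing real inner product with \<open>v\<close>, the bound at \<open>v + t *\<^sub>R z\<close>
  gives \<open>2 * t * p \<le> q * t\<^sup>2\<close> for all real \<open>t\<close>, which forces
  \<open>p = 0\<close>. Applying this to all multiples \<open>s1 c x\<close> yields orthogonality
  over \<open>'k\<close>.\<close>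

lemma orthogonal_maximizer:
  assumes A: "A \<in> bounded_ops s1 s2"
    and D: "D = {x. \<forall>y\<in>O'. H1.ip x y = 0}"
    and v: "v \<in> D" "norm v = 1" "\<And>x. x \<in> D \<Longrightarrow> norm (A x) \<le> norm (A v) * norm x"
    and x: "x \<in> D" "H1.ip x v = 0"
  shows "H2.ip (A x) (A v) = 0"
proof -
  note Ad = bounded_opsD(2-5)[OF A]
  have Ascale: "A (r *\<^sub>R x) = r *\<^sub>R A x" for r x
    by (simp add: linear_simps[OF bounded_opsD(6)[OF A]])
  have real: "inner (A v) (A z) = 0" if z: "z \<in> D" "inner z v = 0" for z
  proof -
    define p where "p = inner (A v) (A z)"
    define q where "q = (norm (A v))\<^sup>2 * (norm z)\<^sup>2"
    have key: "2 * t * p \<le> q * t\<^sup>2" for t :: real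
    proof -
      have "v + t *\<^sub>R z \<in> D" using v(1) z(1) by (auto simp: D H1.ip_add_left H1.ip_scaleR_left)
      from power_mono[OF v(3)[OF this], of 2]
      have "(norm (A v + t *\<^sub>R A z))\<^sup>2 \<le> (norm (A v))\<^sup>2 * (norm (v + t *\<^sub>R z))\<^sup>2"
        by (simp add: power_mult_distrib Ad Ascale)
      moreover have "(norm (A v + t *\<^sub>R A z))\<^sup>2 = (norm (A v))\<^sup>2 + 2 * t * p + t\<^sup>2 * (norm (A z))\<^sup>2"
        unfolding power2_norm_eq_inner p_def
        by (simp add: inner_add_left inner_add_right inner_commute power2_eq_square)
      moreover have "(norm (v + t *\<^sub>R z))\<^sup>2 = 1 + t\<^sup>2 * (norm z)\<^sup>2"
        using z(2) v(2) unfolding power2_norm_eq_inner norm_eq_1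
        by (simp add: inner_add_left inner_add_right inner_commute power2_eq_square)
      moreover have "(norm (A v))\<^sup>2 * (1 + t\<^sup>2 * (norm z)\<^sup>2) = (norm (A v))\<^sup>2 + q * t\<^sup>2"
        by (simp add: q_def algebra_simps)
      ultimately have "2 * t * p + t\<^sup>2 * (norm (A z))\<^sup>2 \<le> q * t\<^sup>2"
        by simp
      then show ?thesis by (rule order_trans[rotated]) simp
    qed
    have "p = 0"
    proof (rule ccontr)
      assume p: "p \<noteq> 0"
      have q: "q \<ge> 0" by (simp add: q_def)
      \<comment> \<open>The test value is \<open>t = p / (q + 1)\<close>; the \<open>+ 1\<close>
        keeps the denominator positive when \<open>q = 0\<close>.\<close>
      have "2 * (p / (q + 1)) * p \<le> q * (p / (q + 1))\<^sup>2" by (rule key)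
      moreover have "q * (p / (q + 1))\<^sup>2 \<le> (q + 1) * (p / (q + 1))\<^sup>2"
        by (intro mult_right_mono) auto
      moreover have "(q + 1) * (p / (q + 1))\<^sup>2 = (p / (q + 1)) * p"
        using q by (simp add: power2_eq_square)
      ultimately have "(p / (q + 1)) * p \<le> 0" by simp
      then have "p\<^sup>2 / (q + 1) \<le> 0" by (simp add: power2_eq_square)
      moreover have "p\<^sup>2 / (q + 1) > 0" using p q by simp
      ultimately show False by linarith
    qed
    then show ?thesis by (simp add: p_def)
  qed
  show ?thesis
    unfolding H2.ip_eq_0_commute[of "A x"]
  proof (rule H2.ip_eqI)
    fix c
    have "s1 c x \<in> D" using x(1) by (auto simp: D H1.ip_scale_left)
    moreover have "inner (s1 c x) v = 0"
      using x(2) by (simp add: H1.inner_eq_ip H1.ip_scale_left)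
    ultimately show "inner (A v) (s2 c (A x)) = inner 0 c"
      using real[of "s1 c x"] by (simp add: Ad)
  qed
qed

text \<open>Each \<open>v n\<close> maximizes \<open>norm (A x)\<close> over the unit vectors
  orthogonal to its predecessors. \<open>A\<close> does not vanish on that complement: otherwise its
  range would be spanned by the finitely many images of the predecessors.\<close>

lemma svd_sequence:
  assumes A: "A \<in> bounded_ops s1 s2" and co: "compact (closure (A ` cball 0 1))"
    and inf: "infinite_dimensional s2 (range A)"
  shows "\<exists>v::nat \<Rightarrow> 'a. H1.orthonormal UNIV v \<and> (\<forall>n. A (v n) \<noteq> 0) \<and>
    (\<forall>n x. (\<forall>j<n. H1.ip x (v j) = 0) \<longrightarrow> norm (A x) \<le> norm (A (v n)) * norm x)"
proof -
  define D where "D f n = {x. \<forall>y\<in>f ` {..<n}. H1.ip x y = 0}" for f :: "nat \<Rightarrow> 'a" and n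
  define P where "P f n v \<longleftrightarrow> v \<in> D f n \<and> norm v = 1 \<and> A v \<noteq> 0 \<and>
    (\<forall>x\<in>D f n. norm (A x) \<le> norm (A v) * norm x)" for f n v
  have "\<exists>f. \<forall>n. P f n (f n)"
  \<comment> \<open>\<open>P f n v\<close> refers to \<open>f\<close> only below \<open>n\<close>,
    so the sequence can be chosen by recursion on all earlier values.\<close>
  proof (rule dependent_wellorder_choice)
    fix v :: 'a and f g :: "nat \<Rightarrow> 'a" and n
    assume "\<And>j. j < n \<Longrightarrow> f j = g j"
    then have "D f n = D g n" by (auto simp: D_def)
    then show "P f n v = P g n v" by (simp add: P_def)
  next
    fix n and f :: "nat \<Rightarrow> 'a" assume IH: "\<And>j. j < n \<Longrightarrow> P f j (f j)"
    have orthonormal: "H1.orthonormal {..<n} f"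
      unfolding H1.orthonormal_def
    proof safe
      fix i j assume ij: "i < n" "j < n"
      have 1: "H1.ip (f i) (f j) = 0" if "j < i" "i < n" for i j
        using IH[OF that(2)] that(1) by (auto simp: P_def D_def)
      show "H1.ip (f i) (f j) = (if i = j then 1 else 0)"
        using 1[of i j] 1[of j i] ij IH[OF ij(1)] H1.ip_eq_0_commute[of "f i" "f j"]
        by (cases i j rule: linorder_cases) (auto simp: P_def H1.ip_self)
    qed
    have "\<exists>x\<in>D f n. A x \<noteq> 0"
    proof (rule ccontr)
      assume "\<not> ?thesis"
      then have z: "A x = 0" if "x \<in> D f n" for x using that by blast
      have "A x \<in> H2.span ((\<lambda>j. A (f j)) ` {..<n})" for x
      proof -
        have "x - H1.proj {..<n} f x \<in> D f n"
          by (auto simp: D_def H1.ip_diff_left H1.ip_proj[OF orthonormal])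
        then have "A (x - H1.proj {..<n} f x) = 0" by (rule z)
        then have "A x = A (H1.proj {..<n} f x)" by (simp add: bounded_opsD[OF A])
        also have "\<dots> = (\<Sum>j<n. s2 (H1.ip x (f j)) (A (f j)))"
          unfolding H1.proj_def bounded_ops_sum[OF A] ..
        also have "\<dots> \<in> H2.span ((\<lambda>j. A (f j)) ` {..<n})"
          by (intro H2.span_sum H2.span_scale H2.span_base) auto
        finally show ?thesis .
      qed
      then show False using inf unfolding infinite_dimensional_def
        by (metis finite_imageI finite_lessThan image_subsetI)
    qed
    then obtain x0 where x0: "x0 \<in> D f n" "A x0 \<noteq> 0" by blast
    obtain v where v: "v \<in> D f n" "norm v = 1" "\<And>x. x \<in> D f n \<Longrightarrow> norm (A x) \<le> norm (A v) * norm x"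
      using attains_norm[OF A co D_def x0] by blast
    moreover have "A v \<noteq> 0" using v(3)[OF x0(1)] x0(2) by auto
    ultimately show "\<exists>v. P f n v" by (auto simp: P_def)
  qed
  then obtain v where v: "\<And>n. P v n (v n)" by blast
  have 1: "H1.ip (v i) (v j) = 0" if "j < i" for i j
    using v[of i] that by (auto simp: P_def D_def)
  have "H1.orthonormal UNIV v"
    unfolding H1.orthonormal_def
  proof safe
    fix i j
    show "H1.ip (v i) (v j) = (if i = j then 1 else 0)"
      using 1[of i j] 1[of j i] v[of i] H1.ip_eq_0_commute[of "v i" "v j"]
      by (cases i j rule: linorder_cases) (auto simp: P_def H1.ip_self)
  qed
  moreover have "A (v n) \<noteq> 0" for n using v[of n] by (simp add: P_def)
  moreover have "norm (A x) \<le> norm (A (v n)) * norm x"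
    if "\<forall>j<n. H1.ip x (v j) = 0" for n x
    using v[of n] that by (auto simp: P_def D_def)
  ultimately show ?thesis by blast
qed

text \<open>By maximality the images \<open>A (v n)\<close> are pairwise orthogonal. Their norms are
  the singular values, and their normalizations are the axes \<open>e n\<close>.\<close>

lemma svd:
  assumes A: "A \<in> bounded_ops s1 s2" and co: "compact (closure (A ` cball 0 1))"
    and inf: "infinite_dimensional s2 (range A)"
  obtains e and \<sigma> :: "nat \<Rightarrow> real" where "H2.orthonormal UNIV e" "\<And>n. \<sigma> n > 0" "decseq \<sigma>"
    "\<sigma> \<longlonglongrightarrow> 0" "A ` cball 0 1 = H2.diag_ellipsoid e \<sigma>"
proof -
  note Ad = bounded_opsD(2-5)[OF A] and Abl = bounded_opsD(6)[OF A]
  have Ascale: "A (r *\<^sub>R x) = r *\<^sub>R A x" for r x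
    by (simp add: linear_simps[OF Abl])
  obtain v :: "nat \<Rightarrow> 'a" where v: "H1.orthonormal UNIV v" "\<And>n. A (v n) \<noteq> 0"
    "\<And>n x. \<forall>j<n. H1.ip x (v j) = 0 \<Longrightarrow> norm (A x) \<le> norm (A (v n)) * norm x"
    using svd_sequence[OF A co inf] by auto
  define \<sigma> where "\<sigma> n = norm (A (v n))" for n
  define e where "e n = (1 / \<sigma> n) *\<^sub>R A (v n)" for n
  have pos: "\<sigma> n > 0" for n using v(2) by (simp add: \<sigma>_def)
  have nv: "norm (v n) = 1" for n using H1.orthonormal_norm[OF v(1)] by blast
  have ne: "norm (e n) = 1" for n using pos[of n] by (simp add: e_def) (simp add: \<sigma>_def)
  have Av: "A (v n) = s2 (of_real (\<sigma> n)) (e n)" for n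
    using pos[of n] by (simp add: e_def H2.scale_of_real)
  have dec: "decseq \<sigma>"
    unfolding decseq_Suc_iff
  proof
    fix n
    have "norm (A (v (Suc n))) \<le> norm (A (v n)) * norm (v (Suc n))"
      by (rule v(3)) (use H1.orthonormal_ip[OF v(1)] in auto)
    then show "\<sigma> (Suc n) \<le> \<sigma> n" by (simp add: nv \<sigma>_def)
  qed
  have orth: "H2.ip (A (v i)) (A (v j)) = 0" if "j < i" for i j
  proof (rule orthogonal_maximizer[OF A refl, of _ "v ` {..<j}"])
    show "norm (A x) \<le> norm (A (v j)) * norm x"
      if "x \<in> {x. \<forall>y\<in>v ` {..<j}. H1.ip x y = 0}" for x
      by (rule v(3)) (use that in auto)
  qed (use that H1.orthonormal_ip[OF v(1)] nv in auto)
  have orth': "H2.ip (e i) (e j) = 0" if "j < i" for i j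
  proof -
    have "H2.ip (e i) (A (v j)) = 0" using orth[OF that] by (simp add: e_def H2.ip_scaleR_left)
    then have "H2.ip (e j) (e i) = 0"
      unfolding H2.ip_eq_0_commute[of "e i"] by (simp add: e_def H2.ip_scaleR_left)
    then show ?thesis using H2.ip_eq_0_commute by blast
  qed
  have e: "H2.orthonormal UNIV e"
    unfolding H2.orthonormal_def
  proof safe
    fix i j
    show "H2.ip (e i) (e j) = (if i = j then 1 else 0)"
      using orth'[of i j] orth'[of j i] H2.ip_eq_0_commute[of "e i" "e j"]
      by (cases i j rule: linorder_cases) (auto simp: ne H2.ip_self)
  qed
  obtain L where L: "\<sigma> \<longlonglongrightarrow> L" "\<And>n. L \<le> \<sigma> n"
    using decseq_convergent[OF dec, of 0] pos by (auto intro: less_imp_le)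
  \<comment> \<open>Otherwise the orthogonal vectors \<open>A (v n)\<close> all have norm at least
    \<open>L\<close>, so their mutual distances stay at least \<open>L\<close> and no subsequence
    converges, against compactness.\<close>
  have "L = 0"
  proof (rule ccontr)
    assume "L \<noteq> 0"
    moreover have "L \<ge> 0" using L(1) pos by (intro LIMSEQ_le_const[of \<sigma>]) (auto intro: less_imp_le)
    ultimately have L0: "L > 0" by simp
    have "\<forall>n. A (v n) \<in> closure (A ` cball 0 1)"
      using closure_subset[of "A ` cball 0 1"] nv by (auto simp: image_subset_iff)
    then obtain r l where r: "strict_mono (r :: nat \<Rightarrow> nat)" "((\<lambda>n. A (v n)) \<circ> r) \<longlonglongrightarrow> l"
      using co[unfolded compact_def, THEN spec, of "\<lambda>n. A (v n)"] by blast
    from LIMSEQ_imp_Cauchy[OF r(2)] L0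
    obtain M where M: "\<And>m n. m \<ge> M \<Longrightarrow> n \<ge> M \<Longrightarrow> dist (A (v (r m))) (A (v (r n))) < L"
      unfolding Cauchy_def o_def by meson
    define i j where "i = r (Suc M)" and "j = r M"
    have ij: "j < i" using r(1) by (simp add: i_def j_def strict_mono_def)
    have "(dist (A (v i)) (A (v j)))\<^sup>2 = (norm (- A (v j) + A (v i)))\<^sup>2"
      by (simp add: dist_norm)
    also have "\<dots> = (norm (- A (v j)))\<^sup>2 + (norm (A (v i)))\<^sup>2"
      by (rule H2.norm_add_ip_0)
         (use orth[OF ij] H2.ip_eq_0_commute[of "A (v i)"
           "A (v j)"] in \<open>simp add: H2.ip_minus_left\<close>)
    also have "\<dots> \<ge> L\<^sup>2 + 0"
      using L(2)[of j] L0 by (intro add_mono power_mono) (auto simp: \<sigma>_def)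
    finally have "L\<^sup>2 \<le> (dist (A (v i)) (A (v j)))\<^sup>2" by simp
    then have "L \<le> dist (A (v i)) (A (v j))" by (rule power2_le_imp_le) simp
    then show False using M[of "Suc M" M] by (simp add: i_def j_def)
  qed
  with L have lim: "\<sigma> \<longlonglongrightarrow> 0" by simp
  have "A ` cball 0 1 = H2.diag_ellipsoid e \<sigma>"
  proof safe
    fix x :: 'a assume "x \<in> cball 0 1"
    then have x: "norm x \<le> 1" by simp
    have "(\<lambda>n. \<Sum>j<n. s2 (of_real (\<sigma> j) * H1.ip x (v j)) (e j)) \<longlonglongrightarrow> A x"
    proof (rule metric_LIMSEQ_I)
      fix \<epsilon> :: real assume "\<epsilon> > 0"
      then obtain N where N: "\<And>n. n \<ge> N \<Longrightarrow> \<sigma> n < \<epsilon>"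
        using order_tendstoD(2)[OF lim, of \<epsilon>] by (auto simp: eventually_sequentially)
      show "\<exists>no. \<forall>n\<ge>no. dist (\<Sum>j<n. s2 (of_real (\<sigma> j) * H1.ip x (v j)) (e j)) (A x) < \<epsilon>"
      proof (intro exI allI impI)
        fix n assume "n \<ge> N"
        define y where "y = x - H1.proj {..<n} v x"
        have orthonormal: "H1.orthonormal {..<n} v" using H1.orthonormal_subset[OF v(1)] by blast
        have "(\<Sum>j<n. s2 (of_real (\<sigma> j) * H1.ip x (v j)) (e j)) = A (H1.proj {..<n} v x)"
          unfolding H1.proj_def bounded_ops_sum[OF A] by (simp add: Av mult.commute)
        then have "dist (\<Sum>j<n. s2 (of_real (\<sigma> j) * H1.ip x (v j)) (e j)) (A x) = norm (A y)"
          by (simp add: dist_norm norm_minus_commute y_def Ad)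
        \<comment> \<open>\<open>y\<close> is orthogonal to \<open>v 0, ..., v (n - 1)\<close>, so
          the maximality of \<open>v n\<close> bounds the remainder of the expansion.\<close>
        also have "\<dots> \<le> \<sigma> n * norm y"
          unfolding \<sigma>_def
            by (rule v(3)) (auto simp: y_def H1.ip_diff_left H1.ip_proj[OF orthonormal])
        also have "\<dots> \<le> \<sigma> n * norm x"
          unfolding y_def using pos[of n]
          by (intro mult_left_mono H1.norm_diff_proj_le orthonormal) auto
        also have "\<dots> \<le> \<sigma> n" using x pos[of n] by (simp add: mult_left_le)
        also have "\<dots> < \<epsilon>" by (rule N) fact
        finally show "dist (\<Sum>j<n. s2 (of_real (\<sigma> j) * H1.ip x (v j)) (e j)) (A x) < \<epsilon>" .
      qed
    qed
    moreover have "(norm x)\<^sup>2 \<le> 1" using x by (simp add: power_le_one)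
    ultimately show "A x \<in> H2.diag_ellipsoid e \<sigma>"
      using H1.bessel_inf[OF v(1), of x] unfolding H2.diag_ellipsoid_def sums_def
      by (intro CollectI exI[of _ "\<lambda>j. H1.ip x (v j)"]) auto
  next
    fix y assume "y \<in> H2.diag_ellipsoid e \<sigma>"
    then obtain c where c: "summable (\<lambda>j. (norm (c j))\<^sup>2)" "(\<Sum>j. (norm (c j))\<^sup>2) \<le> 1"
      "(\<lambda>j. s2 (of_real (\<sigma> j) * c j) (e j)) sums y"
      by (auto simp: H2.diag_ellipsoid_def)
    obtain x where x: "(\<lambda>j. s1 (c j) (v j)) sums x" using H1.orthonormal_summable[OF v(1) c(1)]
      by blast
    have "(norm x)\<^sup>2 = (\<Sum>j. (norm (c j))\<^sup>2)"
      using sums_unique[OF H1.orthonormal_sums_norm[OF v(1) x]] .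
    then have "norm x \<le> 1" using c(2) power2_le_imp_le[of "norm x" 1] by simp
    moreover have "(\<lambda>j. s2 (of_real (\<sigma> j) * c j) (e j)) sums A x"
      using bounded_linear.sums[OF Abl x] by (simp add: Ad Av mult.commute)
    then have "A x = y" using c(3) sums_unique2 by blast
    ultimately show "y \<in> A ` cball 0 1" by (auto simp: image_iff)
  qed
  then show ?thesis using that e pos dec lim by blast
qed

end

context hilbert_space
begin

subsection \<open>Kolmogorov widths of ellipsoids\<close>

text \<open>From index \<open>n\<close> on the coefficients are multiplied by at most
  \<open>a n\<close>, and they still have square sum at most 1.\<close>

lemma diag_ellipsoid_tail:
  assumes e: "orthonormal UNIV e" and a: "decseq a" "\<And>n. a n \<ge> 0" and x: "x \<in> diag_ellipsoid e a"
  shows "norm (x - proj {..<n} e x) \<le> a n"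
proof -
  obtain c where c: "summable (\<lambda>j. (norm (c j))\<^sup>2)" "(\<Sum>j. (norm (c j))\<^sup>2) \<le> 1"
    "(\<lambda>j. scale (of_real (a j) * c j) (e j)) sums x"
    using x by (auto simp: diag_ellipsoid_def)
  have ipx: "ip x (e j) = of_real (a j) * c j" for j by (rule orthonormal_sums_ip[OF e c(3)])
  define y where "y = x - proj {..<n} e x"
  have "(\<lambda>j. scale (of_real (a (j + n)) * c (j + n)) (e (j + n))) sums y"
    unfolding y_def proj_def ipx by (rule sums_split_initial_segment[OF c(3)])
  moreover have "orthonormal UNIV (\<lambda>j. e (j + n))" using e by (auto simp: orthonormal_def)
  ultimately have y: "(\<lambda>j. (norm (of_real (a (j + n)) * c (j + n)))\<^sup>2) sums (norm y)\<^sup>2"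
    using orthonormal_sums_norm[of "\<lambda>j. e (j + n)" "\<lambda>j. of_real (a (j + n)) * c (j + n)"] by simp
  have s: "summable (\<lambda>j. (norm (c (j + n)))\<^sup>2)"
    by (rule summable_ignore_initial_segment[OF c(1)])
  have "(norm y)\<^sup>2 = (\<Sum>j. (norm (of_real (a (j + n)) * c (j + n)))\<^sup>2)"
    by (rule sums_unique[OF y])
  also have "\<dots> \<le> (\<Sum>j. (a n)\<^sup>2 * (norm (c (j + n)))\<^sup>2)"
  proof (rule suminf_le[OF _ sums_summable[OF y] summable_mult[OF s]])
    fix j
    have "(a (j + n))\<^sup>2 \<le> (a n)\<^sup>2" using a decseqD[OF a(1), of n "j + n"] by (intro power_mono) auto
    then show "(norm (of_real (a (j + n)) * c (j + n)))\<^sup>2 \<le> (a n)\<^sup>2 * (norm (c (j + n)))\<^sup>2"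
      by (simp add: norm_mult power_mult_distrib mult_right_mono)
  qed
  also have "\<dots> = (a n)\<^sup>2 * (\<Sum>j. (norm (c (j + n)))\<^sup>2)" by (rule suminf_mult[OF s])
  also have "\<dots> \<le> (a n)\<^sup>2 * 1"
  proof (intro mult_left_mono)
    have "(\<Sum>j. (norm (c j))\<^sup>2) = (\<Sum>j. (norm (c (j + n)))\<^sup>2) + (\<Sum>j<n. (norm (c j))\<^sup>2)"
      by (rule suminf_split_initial_segment[OF c(1)])
    moreover have "(\<Sum>j<n. (norm (c j))\<^sup>2) \<ge> 0" by (intro sum_nonneg) auto
    ultimately show "(\<Sum>j. (norm (c (j + n)))\<^sup>2) \<le> 1" using c(2) by linarith
  qed simp
  finally have "(norm y)\<^sup>2 \<le> (a n)\<^sup>2" by simp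
  then have "norm y \<le> a n" by (rule power2_le_imp_le) (rule a(2))
  then show ?thesis by (simp add: y_def)
qed

lemma diag_ellipsoid_norm:
  assumes "orthonormal UNIV e" and "decseq a" "\<And>n. a n \<ge> 0" and "x \<in> diag_ellipsoid e a"
  shows "norm x \<le> a 0"
  using diag_ellipsoid_tail[OF assms, of 0] by (simp add: proj_def)

text \<open>For \<open>j \<le> n\<close> the coordinates are divided by
  \<open>a j \<ge> a n\<close>, so Bessel bounds the square sum by
  \<open>(norm z / a n)\<^sup>2\<close>. The span contains \<open>n + 1\<close> axes, one more than
  the index of the width that it serves to bound from below.\<close>

lemma diag_ellipsoid_finite:
  assumes e: "orthonormal UNIV e" and a: "decseq a" "\<And>n. a n > 0"
    and z: "z \<in> span (e ` {..n})" "norm z \<le> a n"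
  shows "z \<in> diag_ellipsoid e a"
proof -
  have orthonormal: "orthonormal {..n} e" using orthonormal_subset[OF e] by blast
  define c where "c j = (if j \<in> {..n} then ip z (e j) / of_real (a j) else 0)" for j
  have "(\<lambda>j. scale (of_real (a j) * c j) (e j)) sums (\<Sum>j\<in>{..n}. scale (of_real (a j) * c j) (e j))"
    by (rule sums_finite) (auto simp: c_def)
  moreover have "(\<Sum>j\<in>{..n}. scale (of_real (a j) * c j) (e j)) = proj {..n} e z"
    unfolding proj_def using a(2) by (intro sum.cong) (auto simp: c_def less_imp_neq[symmetric])
  ultimately have 1: "(\<lambda>j. scale (of_real (a j) * c j) (e j)) sums z"
    using proj_span[OF orthonormal _ z(1)] by simp
  have 2: "(\<lambda>j. (norm (c j))\<^sup>2) sums (\<Sum>j\<in>{..n}. (norm (c j))\<^sup>2)"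
    by (rule sums_finite) (auto simp: c_def)
  have "(\<Sum>j\<in>{..n}. (norm (c j))\<^sup>2) \<le> (\<Sum>j\<in>{..n}. (norm (ip z (e j)))\<^sup>2 / (a n)\<^sup>2)"
  proof (rule sum_mono)
    fix j assume j: "j \<in> {..n}"
    have "(a n)\<^sup>2 \<le> (a j)\<^sup>2"
      using decseqD[OF a(1), of j n] a(2)[of n] j by (intro power_mono) auto
    then show "(norm (c j))\<^sup>2 \<le> (norm (ip z (e j)))\<^sup>2 / (a n)\<^sup>2"
      using j a(2)[of n] a(2)[of j]
      by (auto simp: c_def norm_divide power_divide intro!: divide_left_mono mult_pos_pos)
  qed
  also have "\<dots> \<le> (norm z)\<^sup>2 / (a n)\<^sup>2"
    unfolding sum_divide_distrib[symmetric]
    by (intro divide_right_mono bessel[OF orthonormal]) auto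
  also have "\<dots> \<le> 1"
    using z(2) a(2)[of n] power_mono[OF z(2), of 2] by (simp add: divide_le_eq_1)
  finally have "(\<Sum>j. (norm (c j))\<^sup>2) \<le> 1" using sums_unique[OF 2] by simp
  then show ?thesis using 1 sums_summable[OF 2] by (auto simp: diag_ellipsoid_def)
qed

lemma closed_span_diag_ellipsoid:
  assumes e: "orthonormal UNIV e" and a: "decseq a" "\<And>n. a n > 0"
  shows "closed_span scale (diag_ellipsoid e a) = closure (span (range e))"
  unfolding closed_span_def
proof (rule antisym)
  have "diag_ellipsoid e a \<subseteq> closure (span (range e))"
  proof
    fix x assume "x \<in> diag_ellipsoid e a"
    then obtain c where c: "(\<lambda>j. scale (of_real (a j) * c j) (e j)) sums x"
      by (auto simp: diag_ellipsoid_def)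
    have "(\<Sum>j<n. scale (of_real (a j) * c j) (e j)) \<in> span (range e)" for n
      by (intro span_sum span_scale span_base) auto
    then show "x \<in> closure (span (range e))"
      using c unfolding sums_def closure_sequential
      by (intro exI[of _ "\<lambda>n. \<Sum>j<n. scale (of_real (a j) * c j) (e j)"]) auto
  qed
  then have "span (diag_ellipsoid e a) \<subseteq> closure (span (range e))"
    by (intro span_minimal subspace_closure subspace_span)
  then show "closure (span (diag_ellipsoid e a)) \<subseteq> closure (span (range e))"
    by (intro closure_minimal) auto
  have "e i \<in> span (diag_ellipsoid e a)" for i
  proof -
    have "scale (of_real (a i)) (e i) \<in> diag_ellipsoid e a"
      using a(2)[of i] orthonormal_norm[OF e, of i]
      by (intro diag_ellipsoid_finite[OF e a, of _ i] span_scale span_base) (auto simp: norm_scale)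
    then have "scale (1 / of_real (a i)) (scale (of_real (a i)) (e i)) \<in> span (diag_ellipsoid e a)"
      by (intro span_scale span_base)
    then show ?thesis using a(2)[of i] by simp
  qed
  then show "closure (span (range e)) \<subseteq> closure (span (diag_ellipsoid e a))"
    by (intro closure_mono span_minimal subspace_span) auto
qed

text \<open>Widths are infima over spaces of dimension exactly \<open>n\<close>; in infinite
  dimension a smaller independent set can be enlarged to that size.\<close>

lemma independent_card_extend:
  assumes inf: "infinite_dimensional scale (UNIV :: 'a set)"
    and "finite C" "independent C" "card C \<le> n"
  shows "\<exists>C'. C \<subseteq> C' \<and> finite C' \<and> independent C' \<and> card C' = n"
  using assms(4)
proof (induction n rule: dec_induct)
  case base
  then show ?case using assms by blast
next
  case (step n)
  then obtain C' where C': "C \<subseteq> C'" "finite C'" "independent C'" "card C' = n" by blast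
  obtain x where x: "x \<notin> span C'"
    using inf C'(2) unfolding infinite_dimensional_def by blast
  then have "x \<notin> C'" using span_base by blast
  then show ?case using C' x independent_insertI[OF x C'(3)]
    by (intro exI[of _ "insert x C'"]) auto
qed

text \<open>Boundedness conditions under which the infima and suprema of reals in
  \<open>kolmogorov_width\<close> can be compared.\<close>

lemma width_INF_bounds:
  assumes K: "K \<noteq> {}" "\<And>x. x \<in> K \<Longrightarrow> norm x \<le> M"
  shows "bdd_below ((\<lambda>z. norm (x - z)) ` span B)"
    "bdd_above ((\<lambda>x. INF z\<in>span B. norm (x - z)) ` K)"
    "(SUP x\<in>K. INF z\<in>span B. norm (x - z)) \<ge> 0"
proof -
  show 1: "bdd_below ((\<lambda>z. norm (x - z)) ` span B)" for x
    by (rule bdd_belowI[of _ 0]) auto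
  have ne: "span B \<noteq> {}" using span_zero by blast
  have "(INF z\<in>span B. norm (x - z)) \<le> M" if "x \<in> K" for x
    using cINF_lower[OF 1 span_zero, of x] K(2)[OF that] by simp
  then show 2: "bdd_above ((\<lambda>x. INF z\<in>span B. norm (x - z)) ` K)"
    by (intro bdd_aboveI[of _ M]) auto
  obtain x where x: "x \<in> K" using K by blast
  have "0 \<le> (INF z\<in>span B. norm (x - z))" by (intro cINF_greatest ne) auto
  also have "\<dots> \<le> (SUP x\<in>K. INF z\<in>span B. norm (x - z))" by (intro cSUP_upper x 2)
  finally show "(SUP x\<in>K. INF z\<in>span B. norm (x - z)) \<ge> 0" .
qed

text \<open>\<open>B\<close> may be dependent or too small. A maximal independent subset is enlarged
  to \<open>n\<close> vectors, which can only improve the approximation.\<close>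

lemma kolmogorov_width_le:
  assumes inf: "infinite_dimensional scale (UNIV :: 'a set)"
    and K: "K \<noteq> {}" "\<And>x. x \<in> K \<Longrightarrow> norm x \<le> M"
    and B: "finite B" "card B \<le> n" and t: "\<And>x. x \<in> K \<Longrightarrow> \<exists>z\<in>span B. norm (x - z) \<le> t"
  shows "kolmogorov_width scale n K \<le> t"
proof -
  obtain C where C: "C \<subseteq> B" "independent C" "B \<subseteq> span C"
    using maximal_independent_subset[of B] by blast
  have "finite C" "card C \<le> n" using C(1) B finite_subset card_mono[OF B(1) C(1)] by auto
  then obtain C' where C': "C \<subseteq> C'" "finite C'" "independent C'" "card C' = n"
    using independent_card_extend[OF inf _ C(2)] by blast
  have sp: "span B \<subseteq> span C'"
    using C(3) C'(1) by (metis order_trans span_minimal span_mono subspace_span)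
  note bd = width_INF_bounds[OF K]
  have "kolmogorov_width scale n K \<le> (SUP x\<in>K. INF z\<in>span C'. norm (x - z))"
    unfolding kolmogorov_width_def
  proof (rule cINF_lower)
    show "bdd_below ((\<lambda>X. SUP x\<in>K. INF z\<in>X. norm (x - z)) ` {X. n_dim_subspace scale n X})"
      by (rule bdd_belowI[of _ 0]) (use bd(3) in \<open>auto simp: n_dim_subspace_def\<close>)
    show "span C' \<in> {X. n_dim_subspace scale n X}" using C' by (auto simp: n_dim_subspace_def)
  qed
  also have "\<dots> \<le> t"
  proof (rule cSUP_least[OF K(1)])
    fix x assume "x \<in> K"
    then obtain z where z: "z \<in> span B" "norm (x - z) \<le> t" using t by blast
    have "(INF z\<in>span C'. norm (x - z)) \<le> norm (x - z)"
      by (rule cINF_lower[OF bd(1)]) (use z sp in auto)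
    then show "(INF z\<in>span C'. norm (x - z)) \<le> t" using z by simp
  qed
  finally show ?thesis .
qed

text \<open>The first \<open>n\<close> axes give the upper bound by
  \<open>diag_ellipsoid_tail\<close>. For the lower bound, the span of \<open>e 0, ..., e n\<close>
  contains a unit vector \<open>w\<close> orthogonal to the given \<open>n\<close>-dimensional
  \<open>X\<close>. Then \<open>a n *\<^sub>R w\<close> lies in the ellipsoid and is no closer to
  \<open>X\<close> than to \<open>0\<close>.\<close>

lemma kolmogorov_width_diag_ellipsoid:
  assumes inf: "infinite_dimensional scale (UNIV :: 'a set)"
    and e: "orthonormal UNIV e" and a: "decseq a" "\<And>n. a n > 0"
  shows "kolmogorov_width scale n (diag_ellipsoid e a) = a n"
proof (rule antisym)
  have a0: "\<And>n. a n \<ge> 0" using a(2) by (simp add: less_imp_le)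
  have "0 \<in> diag_ellipsoid e a"
    by (rule diag_ellipsoid_finite[OF e a, of _ 0]) (auto simp: span_zero a0)
  then have K: "diag_ellipsoid e a \<noteq> {}" "\<And>x. x \<in> diag_ellipsoid e a \<Longrightarrow> norm x \<le> a 0"
    using diag_ellipsoid_norm[OF e a(1) a0] by auto
  show "kolmogorov_width scale n (diag_ellipsoid e a) \<le> a n"
  proof (rule kolmogorov_width_le[OF inf K])
    show "finite (e ` {..<n})" "card (e ` {..<n}) \<le> n"
      using card_image_le[of "{..<n}" e] by auto
    show "\<exists>z\<in>span (e ` {..<n}). norm (x - z) \<le> a n" if "x \<in> diag_ellipsoid e a" for x
      using diag_ellipsoid_tail[OF e a(1) a0 that, of n] proj_in_span by blast
  qed
  note bd = width_INF_bounds[OF K]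
  show "a n \<le> kolmogorov_width scale n (diag_ellipsoid e a)"
    unfolding kolmogorov_width_def
  proof (rule cINF_greatest)
    show "{X. n_dim_subspace scale n X} \<noteq> {}"
      using independent_card_extend[OF inf, of "{}" n]
      by (auto simp: n_dim_subspace_def independent_empty)
    fix X assume "X \<in> {X. n_dim_subspace scale n X}"
    then obtain B where B: "finite B" "card B = n" "X = span B" by (auto simp: n_dim_subspace_def)
    define \<Phi> where "\<Phi> = (\<lambda>b x. ip x b) ` B"
    have \<Phi>: "finite \<Phi>" "card \<Phi> \<le> n" using B card_image_le[of B] by (auto simp: \<Phi>_def)
    have lin: "Vector_Spaces.linear scale (*) f" if "f \<in> \<Phi>" for f
      using that vector_space_axioms unfolding \<Phi>_def Vector_Spaces.linear_iff
      by (auto simp: ip_add_left ip_scale_left vector_space_def algebra_simps)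
    have orthonormal: "orthonormal (e ` {..n}) (\<lambda>x. x)"
      using orthonormal_image[OF orthonormal_subset[OF e]] by blast
    have "card (e ` {..n}) = Suc n"
      using card_image[OF inj_on_subset[OF orthonormal_inj[OF e]], of "{..n}"] by simp
    moreover obtain P where P: "finite P" "orthonormal P (\<lambda>x. x)" "P \<subseteq> span (e ` {..n})"
      "card (e ` {..n}) \<le> card P + card \<Phi>" "\<And>f x. f \<in> \<Phi> \<Longrightarrow> x \<in> P \<Longrightarrow> f x = 0"
      by (rule orthonormal_kernel[OF \<Phi>(1) orthonormal]) (use lin in auto)
    ultimately have "card P > 0" using \<Phi>(2) by linarith
    then obtain w where w: "w \<in> P" by fastforce
    have nw: "norm w = 1" using orthonormal_norm[OF P(2) w] .
    define x where "x = a n *\<^sub>R w"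
    have x: "x \<in> diag_ellipsoid e a"
    proof (rule diag_ellipsoid_finite[OF e a])
      show "norm x \<le> a n" using a0 nw by (simp add: x_def)
      have "scale (of_real (a n)) w \<in> span (e ` {..n})" using w P(3) by (intro span_scale) auto
      then show "x \<in> span (e ` {..n})" by (simp add: x_def scale_of_real)
    qed
    have "a n \<le> (INF z\<in>X. norm (x - z))"
    proof (rule cINF_greatest)
      show "X \<noteq> {}" unfolding B(3) using span_zero by blast
      fix z assume z: "z \<in> X"
      have "ip x b = 0" if "b \<in> B" for b
        using P(5)[of "\<lambda>x. ip x b" w] that w by (auto simp: \<Phi>_def x_def ip_scaleR_left)
      then have "ip b x = 0" if "b \<in> B" for b using that ip_eq_0_commute by blast
      then have "ip z x = 0" using z ip_span_0 unfolding B(3) by blast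
      then have "(norm (- z + x))\<^sup>2 = (norm (- z))\<^sup>2 + (norm x)\<^sup>2"
        by (intro norm_add_ip_0) (simp add: ip_minus_left)
      then have "(norm x)\<^sup>2 \<le> (norm (x - z))\<^sup>2" by simp
      then have "norm x \<le> norm (x - z)" by (rule power2_le_imp_le) simp
      then show "a n \<le> norm (x - z)" using a0[of n] nw by (simp add: x_def)
    qed
    also have "\<dots> \<le> (SUP x\<in>diag_ellipsoid e a. INF z\<in>X. norm (x - z))"
      unfolding B(3) by (rule cSUP_upper[OF x bd(2)])
    finally show "a n \<le> (SUP x\<in>diag_ellipsoid e a. INF z\<in>X. norm (x - z))" .
  qed
qed

end

subsection \<open>Weak approximation by covering operators\<close>

text \<open>Used to match two orthonormal bases so that a prescribed part of the first lands in a
  prescribed part of the second.\<close>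

lemma bij_betw_extend:
  assumes "finite A" "finite B" "card A = card B" "X \<subseteq> A" "Z \<subseteq> B" "card X \<le> card Z"
  obtains \<beta> where "bij_betw \<beta> A B" "\<beta> ` X \<subseteq> Z"
proof -
  obtain Z' where Z': "Z' \<subseteq> Z" "card Z' = card X" using obtain_subset_with_card_n[OF assms(6)]
    by metis
  have fin: "finite X" "finite Z'" using assms Z' by (meson finite_subset)+
  obtain h where h: "bij_betw h X Z'" using finite_same_card_bij[OF fin] Z'(2) by auto
  have "card (A - X) = card (B - Z')"
    using assms Z' fin by (subst (1 2) card_Diff_subset) auto
  then obtain h' where h': "bij_betw h' (A - X) (B - Z')"
    using finite_same_card_bij assms(1,2) by (metis finite_Diff)
  have "bij_betw (\<lambda>x. if x \<in> X then h x else h' x) (X \<union> (A - X)) (Z' \<union> (B - Z'))"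
    by (rule bij_betw_disjoint_Un[OF h h']) auto
  moreover have "X \<union> (A - X) = A" "Z' \<union> (B - Z') = B" using assms Z' by auto
  moreover have "(\<lambda>x. if x \<in> X then h x else h' x) ` X \<subseteq> Z"
    using h Z'(1) by (auto simp: bij_betw_def)
  ultimately show ?thesis using that by metis
qed

text \<open>The map sending \<open>u\<close> to \<open>y - R u\<close> contracts by the factor
  \<open>1 / 2\<close>; its fixed point is the solution.\<close>

lemma perturbed_identity_surj:
  fixes R :: "'a::{real_normed_vector,complete_space} \<Rightarrow> 'a"
  assumes R: "\<And>x y. R (x - y) = R x - R y" "\<And>x. norm (R x) \<le> norm x / 2"
  obtains u where "u + R u = y" "norm u \<le> 2 * norm y"
proof -
  have "\<exists>!u. y - R u = u"
  proof (rule banach_fix_type[of "1/2"])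
    have "(y - R x) - (y - R x') = R (x' - x)" for x x' by (simp add: R(1))
    then show "\<forall>x x'. dist (y - R x) (y - R x') \<le> 1 / 2 * dist x x'"
      using R(2) by (simp add: dist_norm norm_minus_commute) (metis norm_minus_commute)
  qed auto
  then obtain u where u: "y - R u = u" by blast
  then have u: "u + R u = y" by (simp add: algebra_simps)
  have "norm u = norm (y - R u)" by (simp flip: u)
  also have "\<dots> \<le> norm y + norm (R u)" by (rule norm_triangle_ineq4)
  finally have "norm u \<le> 2 * norm y" using R(2)[of u] by simp
  then show ?thesis using that u by blast
qed

text \<open>Makes the scalar field itself a target space, so that bounded functionals are bounded
  operators of a \<open>hilbert_pair\<close>.\<close>

lemma hilbert_space_scalars: "hilbert_space ((*) :: 'k \<Rightarrow> 'k \<Rightarrow>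
    'k::{real_normed_field,euclidean_space})"
  by unfold_locales (auto simp: algebra_simps norm_mult scaleR_conv_of_real)

context hilbert_space
begin

lemma proj_Un: "finite I \<Longrightarrow> finite J \<Longrightarrow> I \<inter> J = {} \<Longrightarrow> proj (I \<union> J) e x = proj I e x + proj J e x"
  by (simp add: proj_def sum.union_disjoint)

lemma proj_image: "inj_on e I \<Longrightarrow> proj (e ` I) (\<lambda>x. x) x = proj I e x"
  by (simp add: proj_def sum.reindex)

lemma ip_closure_0:
  assumes "z \<in> closure (span B)" "\<And>b. b \<in> B \<Longrightarrow> ip b y = 0"
  shows "ip z y = 0"
proof -
  have "closed {z. ip z y = 0}" by (intro closed_Collect_eq continuous_intros)
  moreover have "span B \<subseteq> {z. ip z y = 0}" using ip_span_0 assms(2) by blast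
  ultimately show ?thesis using assms(1) closure_minimal by blast
qed

text \<open>The averaged coefficients serve, because the square of an average is at most the average
  of the squares. The covering operator needs this to join two partial preimages.\<close>

lemma diag_ellipsoid_midpoint:
  assumes e: "orthonormal UNIV e" and x: "x \<in> diag_ellipsoid e a" and y: "y \<in> diag_ellipsoid e a"
  shows "(1 / 2) *\<^sub>R (x + y) \<in> diag_ellipsoid e a"
proof -
  obtain c where c: "summable (\<lambda>j. (norm (c j))\<^sup>2)" "(\<Sum>j. (norm (c j))\<^sup>2) \<le> 1"
    "(\<lambda>j. scale (of_real (a j) * c j) (e j)) sums x"
    using x by (auto simp: diag_ellipsoid_def)
  obtain d where d: "summable (\<lambda>j. (norm (d j))\<^sup>2)" "(\<Sum>j. (norm (d j))\<^sup>2) \<le> 1"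
    "(\<lambda>j. scale (of_real (a j) * d j) (e j)) sums y"
    using y by (auto simp: diag_ellipsoid_def)
  define g where "g j = (1 / 2) *\<^sub>R (c j + d j)" for j
  have 1: "(norm (g j))\<^sup>2 \<le> (1 / 2) * ((norm (c j))\<^sup>2 + (norm (d j))\<^sup>2)" for j
  proof -
    have "(norm (c j + d j))\<^sup>2 \<le> (norm (c j) + norm (d j))\<^sup>2"
      by (intro power_mono norm_triangle_ineq) auto
    also have "\<dots> \<le> 2 * ((norm (c j))\<^sup>2 + (norm (d j))\<^sup>2)"
      using sum_squares_bound[of "norm (c j)" "norm (d j)"] by (simp add: power2_sum)
    finally show ?thesis by (simp add: g_def power_mult_distrib power_divide)
  qed
  have s: "summable (\<lambda>j. (1 / 2) * ((norm (c j))\<^sup>2 + (norm (d j))\<^sup>2))"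
    by (intro summable_mult summable_add c d)
  have sg: "summable (\<lambda>j. (norm (g j))\<^sup>2)"
    by (rule summable_comparison_test'[OF s, of 0]) (use 1 in auto)
  have "(\<Sum>j. (norm (g j))\<^sup>2) \<le> (\<Sum>j. (1 / 2) * ((norm (c j))\<^sup>2 + (norm (d j))\<^sup>2))"
    by (rule suminf_le[OF 1 sg s])
  also have "\<dots> = (1 / 2) * ((\<Sum>j. (norm (c j))\<^sup>2) + (\<Sum>j. (norm (d j))\<^sup>2))"
    by (simp only: suminf_mult[OF summable_add[OF c(1) d(1)]] suminf_add[OF c(1) d(1)])
  also have "\<dots> \<le> 1" using c(2) d(2) by simp
  finally have "(\<Sum>j. (norm (g j))\<^sup>2) \<le> 1" .
  moreover have "(\<lambda>j. (1 / 2) *\<^sub>R (scale (of_real (a j) * c j) (e j) + scale (of_real (a j) * d j)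
      (e j)))
      sums ((1 / 2) *\<^sub>R (x + y))"
    by (intro sums_scaleR_right sums_add c d)
  then have "(\<lambda>j. scale (of_real (a j) * g j) (e j)) sums ((1 / 2) *\<^sub>R (x + y))"
    by (simp add: g_def distrib_left flip: scale_left_distrib scale_scaleR)
  ultimately show ?thesis using sg by (auto simp: diag_ellipsoid_def)
qed

end

context hilbert_pair
begin

text \<open>Bessel makes the weighted coefficients square-summable, and Parseval turns the bound on
  \<open>d\<close> into the norm bound.\<close>

lemma diagonal_operator:
  assumes e: "H1.orthonormal UNIV e" and f: "H2.orthonormal UNIV f" and d: "\<And>j::nat. \<bar>d j\<bar> \<le> M"
  shows "\<exists>D. D \<in> bounded_ops s1 s2 \<and> (\<forall>x. norm (D x) \<le> M * norm x) \<and>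
    (\<forall>x. (\<lambda>j. s2 (of_real (d j) * H1.ip x (e j)) (f j)) sums D x)"
proof -
  define D where "D x = (\<Sum>j. s2 (of_real (d j) * H1.ip x (e j)) (f j))" for x
  have M: "M \<ge> 0" using d[of 0] by linarith
  have le: "(norm (of_real (d j) * H1.ip x (e j)))\<^sup>2 \<le> M\<^sup>2 * (norm (H1.ip x (e j)))\<^sup>2" for x j
    using d[of j] M by (simp add: norm_mult power_mult_distrib mult_right_mono
        abs_le_square_iff[symmetric])
  have s: "summable (\<lambda>j. (norm (of_real (d j) * H1.ip x (e j)))\<^sup>2)" for x
    by (rule summable_comparison_test'[OF summable_mult[OF H1.bessel_inf(1)[OF e]], of 0])
       (use le in auto)
  have D: "(\<lambda>j. s2 (of_real (d j) * H1.ip x (e j)) (f j)) sums D x" for x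
  proof -
    obtain y where "(\<lambda>j. s2 (of_real (d j) * H1.ip x (e j)) (f j)) sums y"
      using H2.orthonormal_summable[OF f s] by blast
    then show ?thesis unfolding D_def by (metis sums_unique)
  qed
  have nD: "norm (D x) \<le> M * norm x" for x
  proof -
    have "(norm (D x))\<^sup>2 = (\<Sum>j. (norm (of_real (d j) * H1.ip x (e j)))\<^sup>2)"
      by (rule sums_unique[OF H2.orthonormal_sums_norm[OF f D]])
    also have "\<dots> \<le> (\<Sum>j. M\<^sup>2 * (norm (H1.ip x (e j)))\<^sup>2)"
      by (rule suminf_le[OF le s summable_mult[OF H1.bessel_inf(1)[OF e]]])
    also have "\<dots> = M\<^sup>2 * (\<Sum>j. (norm (H1.ip x (e j)))\<^sup>2)"
      by (rule suminf_mult[OF H1.bessel_inf(1)[OF e]])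
    also have "\<dots> \<le> M\<^sup>2 * (norm x)\<^sup>2" by (intro mult_left_mono H1.bessel_inf(2)[OF e]) auto
    finally have "(norm (D x))\<^sup>2 \<le> (M * norm x)\<^sup>2" by (simp add: power_mult_distrib)
    then show ?thesis by (rule power2_le_imp_le) (use M in auto)
  qed
  have "D (x + y) = D x + D y" for x y
    using sums_add[OF D[of x] D[of y]] D[of "x + y"]
    by (simp add: H1.ip_add_left distrib_left H2.scale_left_distrib sums_unique2)
  moreover have "D (s1 c x) = s2 c (D x)" for c x
    using bounded_linear.sums[OF H2.bounded_linear_scale D[of x], of c] D[of "s1 c x"]
    by (simp add: H1.ip_scale_left mult.left_commute sums_unique2)
  ultimately show ?thesis using bounded_opsI nD D by (intro exI[of _ D]) blast
qed

text \<open>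
  \<open>J\<close> is a partial isometry from \<open>span F\<close> onto \<open>span E\<close> with adjoint \<open>J'\<close>. It sends the span of the test
  vectors \<open>X\<close> into the common kernel of the test functionals \<open>\<Phi>\<close>.
\<close>

lemma isometry_avoiding:
  assumes F: "H1.orthonormal F (\<lambda>x. x)" "finite F" and E: "H2.orthonormal E (\<lambda>x. x)" "finite E"
    and card: "card E = card F" "card X + card \<Phi> \<le> card F"
    and X: "finite X" "X \<subseteq> H1.span F"
    and \<Phi>: "finite \<Phi>" "\<And>g. g \<in> \<Phi> \<Longrightarrow> Vector_Spaces.linear s2 (*) g"
  shows "\<exists>J J'. J \<in> bounded_ops s1 s2 \<and> J' \<in> bounded_ops s2 s1 \<and>
    (\<forall>x. norm (J x) \<le> norm x) \<and> (\<forall>y. norm (J' y) \<le> norm y) \<and> (\<forall>y. J' y \<in> H1.span F) \<and>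
    (\<forall>y\<in>H2.span E. J (J' y) = y) \<and> (\<forall>x. (\<forall>u\<in>F. H1.ip x u = 0) \<longrightarrow> J x = 0) \<and>
    (\<forall>g\<in>\<Phi>. \<forall>x. H1.proj F (\<lambda>x. x) x \<in> X \<longrightarrow> g (J x) = 0)"
proof -
  interpret sw: hilbert_pair s2 s1
    by (rule hilbert_pair.intro H1.hilbert_space_axioms H2.hilbert_space_axioms)+
  have onf0: "H1.orthonormal {} (\<lambda>x. x)" by (simp add: H1.orthonormal_def)
  obtain OX where OX: "finite OX" "H1.orthonormal OX (\<lambda>x. x)" "H1.span OX = H1.span X"
    "card OX \<le> card X"
    using H1.orthonormal_extend[OF X(1) onf0] unfolding Un_empty_left card.empty add_0 by blast
  obtain OG where OG: "OX \<subseteq> OG" "finite OG" "H1.orthonormal OG (\<lambda>x. x)"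
    "H1.span OG = H1.span (OX \<union> F)"
    using H1.orthonormal_extend[OF F(2) OX(2,1)] by blast
  have "OX \<subseteq> H1.span F"
    using OX(3) X(2) by (metis H1.span_minimal H1.span_superset H1.subspace_span order_trans)
  then have sF: "H1.span OG = H1.span F"
    unfolding OG(4) by (simp add: H1.span_eq H1.span_superset H1.span_base subset_iff)
  have cF: "card OG = card F"
    using H1.orthonormal_card_le(2)[OF F(1) OG(2)] H1.orthonormal_card_le(2)[OF OG(3) F(2)] sF
        H1.span_superset
    by (metis le_antisym)
  \<comment> \<open>An orthonormal set in \<open>span E\<close> on which all test functionals
    vanish; each functional costs at most one dimension.\<close>
  obtain OZ where OZ: "finite OZ" "H2.orthonormal OZ (\<lambda>x. x)" "OZ \<subseteq> H2.span E"
    "card E \<le> card OZ + card \<Phi>"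
    "\<And>g x. g \<in> \<Phi> \<Longrightarrow> x \<in> OZ \<Longrightarrow> g x = 0"
    by (rule H2.orthonormal_kernel[OF \<Phi>(1) E \<Phi>(2)]) auto
  obtain OE where OE: "OZ \<subseteq> OE" "finite OE" "H2.orthonormal OE (\<lambda>x. x)"
    "H2.span OE = H2.span (OZ \<union> E)"
    using H2.orthonormal_extend[OF E(2) OZ(2,1)] by blast
  have sE: "H2.span OE = H2.span E"
    unfolding OE(4) using OZ(3) by (simp add: H2.span_eq H2.span_superset H2.span_base subset_iff)
  have cE: "card OE = card E"
    using H2.orthonormal_card_le(2)[OF E(1) OE(2)] H2.orthonormal_card_le(2)[OF OE(3) E(2)] sE
        H2.span_superset
    by (metis le_antisym)
  \<comment> \<open>Here \<open>card X + card \<Phi> \<le> card F\<close> enters: the common kernel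
    has room for an isometric copy of \<open>span X\<close>.\<close>
  have "card OX \<le> card OZ" using OX(4) OZ(4) card by linarith
  then obtain \<beta> where \<beta>: "bij_betw \<beta> OG OE" "\<beta> ` OX \<subseteq> OZ"
    using bij_betw_extend[OF OG(2) OE(2) _ OG(1) OE(1)] cF cE card(1) by metis
  have on\<beta>: "H2.orthonormal OG \<beta>"
    using OE(3) \<beta>(1) unfolding H2.orthonormal_def bij_betw_def by (auto simp: inj_on_def)
  have img: "\<beta> ` OG = OE" using \<beta>(1) by (simp add: bij_betw_def)
  define J where "J x = (\<Sum>u\<in>OG. s2 (H1.ip x u) (\<beta> u))" for x
  define J' where "J' y = (\<Sum>u\<in>OG. s1 (H2.ip y (\<beta> u)) u)" for y
  have nJ: "norm (J x) \<le> norm x" for x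
  proof (rule power2_le_imp_le)
    show "(norm (J x))\<^sup>2 \<le> (norm x)\<^sup>2"
      unfolding J_def H2.norm_sum_orthonormal[OF on\<beta> OG(2)] using H1.bessel[OF OG(3,2)] .
  qed simp
  have nJ': "norm (J' y) \<le> norm y" for y
  proof (rule power2_le_imp_le)
    show "(norm (J' y))\<^sup>2 \<le> (norm y)\<^sup>2"
      unfolding J'_def H1.norm_sum_orthonormal[OF OG(3,2)] using H2.bessel[OF on\<beta> OG(2)] .
  qed simp
  have "J \<in> bounded_ops s1 s2"
    by (rule bounded_opsI[where M = 1])
       (auto simp: J_def H1.ip_add_left H1.ip_scale_left H2.scale_left_distrib sum.distrib
         H2.scale_sum_right nJ[unfolded J_def])
  moreover have "J' \<in> bounded_ops s2 s1"
    by (rule sw.bounded_opsI[where M = 1])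
       (auto simp: J'_def H2.ip_add_left H2.ip_scale_left H1.scale_left_distrib sum.distrib
         H1.scale_sum_right nJ'[unfolded J'_def])
  moreover have "J' y \<in> H1.span F" for y
    unfolding J'_def sF[symmetric] by (intro H1.span_sum H1.span_scale H1.span_base)
  moreover have "J (J' y) = y" if "y \<in> H2.span E" for y
  proof -
    have "J (J' y) = H2.proj OG \<beta> y"
      unfolding J_def J'_def H2.proj_def
      by (intro sum.cong refl) (simp add: H1.ip_sum_orthonormal[OF OG(3,2)])
    then show ?thesis using H2.proj_span[OF on\<beta> OG(2)] that img sE by simp
  qed
  moreover have perpF: "H1.ip x u = 0" if "\<forall>u\<in>F. H1.ip x u = 0" "u \<in> OG" for x u
  proof -
    have "u \<in> H1.span F" using that(2) sF H1.span_base by blast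
    then show ?thesis
      using that(1) H1.ip_span_0[of u F x] H1.ip_eq_0_commute by blast
  qed
  then have "J x = 0" if "\<forall>u\<in>F. H1.ip x u = 0" for x using that by (simp add: J_def)
  moreover have "g (J x) = 0" if g: "g \<in> \<Phi>" "H1.proj F (\<lambda>x. x) x \<in> X" for g x
  proof -
    interpret g: Vector_Spaces.linear s2 "(*)" g by (rule \<Phi>(2)[OF g(1)])
    define x' where "x' = H1.proj F (\<lambda>x. x) x"
    have "H1.ip x u * g (\<beta> u) = 0" if u: "u \<in> OG" for u
    \<comment> \<open>Vectors of \<open>OX\<close> are sent into the kernel of \<open>g\<close>.
      Along the other basis vectors \<open>x\<close> has no component, because its projection lies
      in the span of \<open>OX\<close>.\<close>
    proof (cases "u \<in> OX")
      case True
      then show ?thesis using OZ(5)[OF g(1)] \<beta>(2) by auto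
    next
      case False
      have "x' \<in> H1.span OX" using g(2) OX(3) H1.span_base unfolding x'_def by blast
      moreover have "H1.ip b u = 0" if "b \<in> OX" for b
        using OG(3) False that OG(1) u by (auto simp: H1.orthonormal_def)
      ultimately have "H1.ip x' u = 0" using H1.ip_span_0 by blast
      moreover have "H1.ip (x - x') u = 0"
        by (rule perpF[OF _ u]) (simp add: x'_def H1.ip_diff_left H1.ip_proj[OF F])
      ultimately show ?thesis by (simp add: H1.ip_diff_left)
    qed
    then show ?thesis unfolding J_def g.sum g.scale by (intro sum.neutral ballI)
  qed
  ultimately show ?thesis using nJ nJ' by (intro exI[of _ J] exI[of _ J']) blast
qed

text \<open>On the span of the first \<open>m\<close> axes a large multiple of an isometry onto
  \<open>span E\<close> dominates the compression of \<open>T\<close>. On the remaining axes the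
  operator is diagonal and sends \<open>e (j + m)\<close> to a multiple of
  \<open>f (j + (m - k))\<close>; on the complement of the closed span of \<open>e\<close> it is
  \<open>T\<close>. The \<open>J\<close> of the conclusion already contains the large
  factor.\<close>

lemma covering_operator:
  fixes e :: "nat \<Rightarrow> 'a" and f :: "nat \<Rightarrow> 'b" and a b :: "nat \<Rightarrow> real"
  assumes e: "H1.orthonormal UNIV e" and f: "H2.orthonormal UNIV f"
    and a: "decseq a" "\<And>n. a n > 0" and b: "decseq b" "\<And>n. b n > 0"
    and ba: "C > 0" "\<And>n. b n \<le> C * a (n + k)" and km: "k \<le> m"
    and E: "H2.orthonormal E (\<lambda>x. x)" "finite E" "card E = m" "f ` {..<m - k} \<subseteq> H2.span E"
    and T: "T \<in> bounded_ops s1 s2"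
    and X: "finite X" and \<Phi>: "finite \<Phi>" "\<And>g. g \<in> \<Phi> \<Longrightarrow> Vector_Spaces.linear s2 (*) g"
    and card: "card X + card \<Phi> \<le> m"
  shows "\<exists>J D. (\<lambda>x. H2.proj E (\<lambda>x. x) (T (H1.proj {..<m} e x)) + J x + D x + T (x - H1.proj_seq e
      x))
      \<in> G_ops s1 s2 (H1.diag_ellipsoid e a) (H2.diag_ellipsoid f b) \<and>
    (\<forall>g\<in>\<Phi>. \<forall>x\<in>X. g (J x) = 0) \<and>
    (\<forall>x. norm (D x) \<le> 2 * C * norm (H1.proj_seq e x - H1.proj {..<m} e x))"
proof -
  interpret sw: hilbert_pair s2 s1
    by (rule hilbert_pair.intro H1.hilbert_space_axioms H2.hilbert_space_axioms)+
  define q where "q = m - k"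
  define PF where "PF = H1.proj {..<m} e"
  define PE where "PE = H2.proj E (\<lambda>x. x)"
  define p where "p = H1.proj_seq e"
  define F where "F = e ` {..<m}"
  have inje: "inj_on e {..<m}" using inj_on_subset[OF H1.orthonormal_inj[OF e]] by blast
  have onfm: "H1.orthonormal {..<m} e" using H1.orthonormal_subset[OF e] by blast
  have F: "H1.orthonormal F (\<lambda>x. x)" "finite F" "card F = m"
    using H1.orthonormal_image[OF onfm] card_image[OF inje] by (auto simp: F_def)
  have PF': "PF x = H1.proj F (\<lambda>x. x) x" for x
    unfolding PF_def F_def H1.proj_image[OF inje] ..
  have X': "finite (PF ` X)" "PF ` X \<subseteq> H1.span F" "card (PF ` X) + card \<Phi> \<le> card F"
    using X card card_image_le[OF X, of PF] H1.proj_in_span F(3) by (auto simp: PF_def F_def)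
  have "card E = card F" using E(3) F(3) by simp
  from isometry_avoiding[OF F(1,2) E(1,2) this X'(3,1,2) \<Phi>]
  obtain J J' where J: "J \<in> bounded_ops s1 s2" "J' \<in> bounded_ops s2 s1"
    "\<And>x. norm (J x) \<le> norm x" "\<And>y. norm (J' y) \<le> norm y" "\<And>y. J' y \<in> H1.span F"
    "\<And>y. y \<in> H2.span E \<Longrightarrow> J (J' y) = y" "\<And>x. \<forall>u\<in>F. H1.ip x u = 0 \<Longrightarrow> J x = 0"
    "\<And>g x. g \<in> \<Phi> \<Longrightarrow> H1.proj F (\<lambda>x. x) x \<in> PF ` X \<Longrightarrow> g (J x) = 0"
    by blast
  have perp: "H1.ip z (e (j + m)) = 0" if "z \<in> H1.span F" for z j
  proof (rule H1.ip_span_0[OF that])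
    fix u assume "u \<in> F"
    then obtain i where "i < m" "u = e i" by (auto simp: F_def)
    then show "H1.ip u (e (j + m)) = 0" using H1.orthonormal_ip[OF e, of i "j + m"] by simp
  qed
  note Jd = bounded_opsD(2-5)[OF J(1)] and J'd = sw.bounded_opsD(2-5)[OF J(2)]
  note Td = bounded_opsD(2-5)[OF T]
  have JR: "J (r *\<^sub>R x) = r *\<^sub>R J x" "J' (r *\<^sub>R y) = r *\<^sub>R J' y" for r x y
    by (simp_all add: linear_simps[OF bounded_opsD(6)[OF J(1)]] linear_simps[OF
        sw.bounded_opsD(6)[OF J(2)]])
  have eshift: "H1.orthonormal UNIV (\<lambda>j. e (j + m))" using e by (auto simp: H1.orthonormal_def)
  have fshift: "H2.orthonormal UNIV (\<lambda>j. f (j + q))" using f by (auto simp: H2.orthonormal_def)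
  \<comment> \<open>Since \<open>q + k = m\<close>, the hypothesis reads
    \<open>b (j + q) \<le> C * a (j + m)\<close>. The factor 2 compensates for halving the preimage
    \<open>x\<close> of the tail below.\<close>
  have "\<bar>2 * b (j + q) / a (j + m)\<bar> \<le> 2 * C" for j
    using ba(2)[of "j + q"] a(2)[of "j + m"] b(2)[of "j + q"] km
    by (simp add: q_def divide_le_eq)
  then obtain D where D: "D \<in> bounded_ops s1 s2" "\<And>x. norm (D x) \<le> 2 * C * norm x"
    "\<And>x. (\<lambda>j. s2 (of_real (2 * b (j + q) / a (j + m)) * H1.ip x (e (j + m))) (f (j + q))) sums D x"
    using diagonal_operator[OF eshift fshift, of "\<lambda>j. 2 * b (j + q) / a (j + m)" "2 * C"] by blast
  note Dd = bounded_opsD(2-5)[OF D(1)]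
  have Dcong: "D x = D y" if "\<And>j. H1.ip x (e (j + m)) = H1.ip y (e (j + m))" for x y
    using D(3)[of x] D(3)[of y] by (simp add: that sums_unique2)
  have Dp: "D x = D (p x - PF x)" for x
  proof (rule Dcong)
    fix j
    have "H1.ip (PF x) (e (j + m)) = 0"
      unfolding PF_def by (rule perp) (simp add: F_def H1.proj_in_span)
    then show "H1.ip x (e (j + m)) = H1.ip (p x - PF x) (e (j + m))"
      by (simp add: p_def H1.ip_diff_left H1.ip_proj_seq[OF e])
  qed
  obtain M where M: "M > 0" "\<And>x. norm (T x) \<le> M * norm x" using bounded_ops_pos_bound[OF T] by blast
  \<comment> \<open>\<open>t \<ge> 2 * M\<close> gives the map \<open>R\<close> below norm at most
    \<open>1 / 2\<close>; \<open>t \<ge> 4 * b 0 / a m\<close> makes the norm of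
    \<open>2 *\<^sub>R u\<close> at most \<open>a m\<close>, which puts that vector into the first
    ellipsoid.\<close>
  define t where "t = 2 * M + 4 * b 0 / a m"
  have t: "t > 0" "t \<ge> 2 * M" "t \<ge> 4 * b 0 / a m"
    using M(1) b(2)[of 0] a(2)[of m] by (auto simp: t_def add_pos_pos)
  have nPE: "norm (PE y) \<le> norm y" for y unfolding PE_def by (rule H2.norm_proj_le[OF E(1,2)])
  have nPF: "norm (PF y) \<le> norm y" for y unfolding PF_def using H1.norm_proj_le[OF onfm] by simp
  have np: "norm (p x) \<le> norm x" for x unfolding p_def by (rule H1.norm_proj_seq_le[OF e])
  have PT: "norm (PE (T (PF x))) \<le> M * norm x" for x
    by (rule order_trans[OF nPE order_trans[OF M(2)]]) (use nPF M(1) in auto)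
  define S where "S x = PE (T (PF x)) + t *\<^sub>R J x + D x + T (x - p x)" for x
  have p_sub: "p x = x" if "x \<in> closure (H1.span (range e))" for x
    unfolding p_def by (rule H1.proj_seq_closure[OF e that])
  have Sbd: "S \<in> bounded_ops s1 s2"
  proof (rule bounded_opsI)
    show "S (x + y) = S x + S y" for x y
      by (simp add: S_def PE_def PF_def p_def H1.proj_add H2.proj_add Td Jd Dd H1.proj_seq_add[OF e]
        scaleR_add_right)
    show "S (s1 c x) = s2 c (S x)" for c x
      by (simp add: S_def PE_def PF_def p_def H1.proj_scale H2.proj_scale Td Jd Dd
          H1.proj_seq_scale[OF e]
        H2.scale_right_distrib H2.scale_right_diff_distrib H2.scale_scaleR_right)
    show "norm (S x) \<le> (M + t + 2 * C + M * 2) * norm x" for x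
    proof -
      have "norm (T (x - p x)) \<le> M * (2 * norm x)"
        using norm_triangle_ineq4[of x "p x"] np[of x] M(1)
        by (intro order_trans[OF M(2)] mult_left_mono) auto
      moreover have "norm (t *\<^sub>R J x) \<le> t * norm x" using J(3)[of x] t(1) by simp
      moreover have "norm (S x) \<le> norm (PE (T (PF x))) + norm (t *\<^sub>R J x) + norm (D x) + norm (T (x
          - p x))"
        unfolding S_def by (intro order_trans[OF norm_triangle_ineq] add_right_mono) auto
      ultimately show ?thesis using PT[of x] D(2)[of x] by (simp add: algebra_simps)
    qed
  qed
  have "H2.diag_ellipsoid f b \<subseteq> S ` H1.diag_ellipsoid e a"
  proof
    fix y assume y: "y \<in> H2.diag_ellipsoid f b"
    then obtain \<eta> where \<eta>: "summable (\<lambda>j. (norm (\<eta> j))\<^sup>2)" "(\<Sum>j. (norm (\<eta> j))\<^sup>2) \<le> 1"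
      "(\<lambda>j. s2 (of_real (b j) * \<eta> j) (f j)) sums y"
      by (auto simp: H2.diag_ellipsoid_def)
    have ipy: "H2.ip y (f j) = of_real (b j) * \<eta> j" for j
      by (rule H2.orthonormal_sums_ip[OF f \<eta>(3)])
    \<comment> \<open>The head \<open>y'\<close> lies in \<open>span E\<close> and will be covered
      by \<open>u\<close>; the tail \<open>y - y'\<close> will be covered by \<open>v\<close>
      through the diagonal part.\<close>
    define y' where "y' = H2.proj {..<q} f y"
    have tail: "(\<lambda>j. s2 (of_real (b (j + q)) * \<eta> (j + q)) (f (j + q))) sums (y - y')"
      unfolding y'_def H2.proj_def ipy by (rule sums_split_initial_segment[OF \<eta>(3)])
    have "norm y' \<le> norm y" unfolding y'_def using H2.norm_proj_le[OF H2.orthonormal_subset[OF f]]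
      by simp
    also have "norm y \<le> b 0" using H2.diag_ellipsoid_norm[OF f b(1) _ y] b(2)
      by (simp add: less_imp_le)
    finally have ny': "norm y' \<le> b 0" .
    have y'E: "y' \<in> H2.span E"
      using H2.proj_in_span[of "{..<q}" f y] E(4) unfolding y'_def q_def
      by (metis H2.span_minimal H2.subspace_span subsetD)
    \<comment> \<open>The equation \<open>PE (T (PF u)) + t J u = y'\<close>, multiplied by \<open>J' / t\<close>, becomes \<open>u + R u = J' y' / t\<close>.\<close>
    define R where "R u = (1 / t) *\<^sub>R J' (PE (T (PF u)))" for u
    have "R (u - v) = R u - R v" for u v
      by (simp add: R_def PF_def PE_def H1.proj_diff H2.proj_diff Td J'd scaleR_diff_right)
    moreover have "norm (R u) \<le> norm u / 2" for u
    proof -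
      have "norm (R u) \<le> (1 / t) * (M * norm u)"
        using order_trans[OF J(4) PT] t(1) by (auto simp: R_def divide_right_mono)
      also have "\<dots> \<le> norm u / 2"
        using t(1,2) mult_right_mono[OF t(2) norm_ge_zero[of u]] by (simp add: field_simps)
      finally show ?thesis .
    qed
    ultimately obtain u where u: "u + R u = (1 / t) *\<^sub>R J' y'"
      "norm u \<le> 2 * norm ((1 / t) *\<^sub>R J' y')"
      using perturbed_identity_surj[of R] by metis
    have nu: "norm (2 *\<^sub>R u) \<le> a m"
    proof -
      have "norm (2 *\<^sub>R u) \<le> 4 * (b 0 / t)"
        using u(2) order_trans[OF J(4) ny'] t(1) divide_right_mono[of "norm (J' y')" "b 0" t]
          by simp
      also have "\<dots> \<le> a m" using t(1,3) a(2)[of m] by (simp add: field_simps)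
      finally show ?thesis .
    qed
    have "u = (1 / t) *\<^sub>R J' (y' - PE (T (PF u)))"
      using u(1) by (simp add: R_def J'd scaleR_diff_right eq_diff_eq)
    moreover have "y' - PE (T (PF u)) \<in> H2.span E"
      using y'E H2.proj_in_span[of E "\<lambda>x. x"] by (intro H2.span_diff) (auto simp: PE_def)
    ultimately have Ju: "t *\<^sub>R J u = y' - PE (T (PF u))" and uF: "u \<in> H1.span F"
    proof -
      assume 1: "u = (1 / t) *\<^sub>R J' (y' - PE (T (PF u)))" and 2: "y' - PE (T (PF u)) \<in> H2.span E"
      have "J u = (1 / t) *\<^sub>R (y' - PE (T (PF u)))"
        by (subst 1) (simp add: JR J(6)[OF 2])
      then show "t *\<^sub>R J u = y' - PE (T (PF u))" using t(1) by simp
      have "s1 (of_real (1 / t)) (J' (y' - PE (T (PF u)))) \<in> H1.span F"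
        by (intro H1.span_scale J(5))
      then show "u \<in> H1.span F" unfolding H1.scale_of_real 1[symmetric] .
    qed
    have Fsp: "H1.span F \<subseteq> closure (H1.span (range e))"
      using H1.span_mono[of F "range e"] closure_subset by (auto simp: F_def)
    have u_ip: "H1.ip u (e (j + m)) = 0" for j
      by (rule perp[OF uF])
    have Du: "D u = 0" using Dcong[of u 0] u_ip Dd by simp
    have Su: "S u = y'" using Ju Du p_sub uF Fsp Td by (auto simp: S_def)
    have u_ell: "2 *\<^sub>R u \<in> H1.diag_ellipsoid e a"
    proof (rule H1.diag_ellipsoid_finite[OF e a _ nu])
      have "s1 (of_real 2) u \<in> H1.span F" by (intro H1.span_scale uF)
      moreover have "F \<subseteq> e ` {..m}" by (auto simp: F_def)
      ultimately show "2 *\<^sub>R u \<in> H1.span (e ` {..m})"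
        using H1.span_mono[of F "e ` {..m}"] unfolding H1.scale_of_real by blast
    qed
    \<comment> \<open>The tail coefficients move from index \<open>j + q\<close> to index
      \<open>j + m\<close>. The zeros below \<open>m\<close> make \<open>x\<close> invisible to the
      compression and to \<open>J\<close>.\<close>
    define \<kappa> where "\<kappa> j = (if j < m then 0 else \<eta> (j - m + q))" for j
    have \<kappa>shift: "\<kappa> (j + m) = \<eta> (j + q)" for j by (simp add: \<kappa>_def)
    have \<eta>s: "summable (\<lambda>j. (norm (\<eta> (j + q)))\<^sup>2)"
      by (rule summable_ignore_initial_segment[OF \<eta>(1)])
    have "(\<Sum>j. (norm (\<eta> j))\<^sup>2) = (\<Sum>j. (norm (\<eta> (j + q)))\<^sup>2) + (\<Sum>j<q. (norm (\<eta> j))\<^sup>2)"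
      by (rule suminf_split_initial_segment[OF \<eta>(1)])
    moreover have "(\<Sum>j<q. (norm (\<eta> j))\<^sup>2) \<ge> 0" by (intro sum_nonneg) auto
    ultimately have \<eta>le: "(\<Sum>j. (norm (\<eta> (j + q)))\<^sup>2) \<le> 1" using \<eta>(2) by linarith
    have \<kappa>sums: "(\<lambda>j. (norm (\<kappa> j))\<^sup>2) sums (\<Sum>j. (norm (\<eta> (j + q)))\<^sup>2)"
    proof -
      have z: "(norm (\<kappa> j))\<^sup>2 = 0" if "j < m" for j using that by (simp add: \<kappa>_def)
      have "(\<lambda>j. (norm (\<kappa> (j + m)))\<^sup>2) sums (\<Sum>j. (norm (\<eta> (j + q)))\<^sup>2)"
        unfolding \<kappa>shift by (rule summable_sums[OF \<eta>s])
      then show ?thesis using sums_zero_iff_shift[of m "\<lambda>j. (norm (\<kappa> j))\<^sup>2", OF z] by blast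
    qed
    have a0: "0 \<le> a n" for n using a(2)[of n] by simp
    have \<kappa>le: "(norm (of_real (a j) * \<kappa> j))\<^sup>2 \<le> (a 0)\<^sup>2 * (norm (\<kappa> j))\<^sup>2" for j
    proof -
      have "(a j)\<^sup>2 \<le> (a 0)\<^sup>2" using decseqD[OF a(1), of 0 j] a0 by (intro power_mono) auto
      then show ?thesis by (simp add: norm_mult power_mult_distrib mult_right_mono)
    qed
    have "summable (\<lambda>j. (norm (of_real (a j) * \<kappa> j))\<^sup>2)"
      by (rule summable_comparison_test'[OF summable_mult[OF sums_summable[OF \<kappa>sums], of "(a 0)\<^sup>2"],
          of 0])
         (simp add: \<kappa>le)
    then obtain x where x: "(\<lambda>j. s1 (of_real (a j) * \<kappa> j) (e j)) sums x"
      using H1.orthonormal_summable[OF e, of "\<lambda>j. of_real (a j) * \<kappa> j"] by blast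
    have ipx: "H1.ip x (e j) = of_real (a j) * \<kappa> j" for j by (rule H1.orthonormal_sums_ip[OF e x])
    have x_ell: "x \<in> H1.diag_ellipsoid e a"
      using x sums_summable[OF \<kappa>sums] sums_unique[OF \<kappa>sums] \<eta>le
        by (auto simp: H1.diag_ellipsoid_def)
    define v where "v = (1 / 2) *\<^sub>R x"
    have ipv: "H1.ip v (e j) = (1 / 2) *\<^sub>R (of_real (a j) * \<kappa> j)" for j
      by (simp add: v_def H1.ip_scaleR_left ipx)
    have v0: "H1.ip v (e j) = 0" if "j < m" for j using that by (simp add: ipv \<kappa>_def)
    have "PF v = 0" unfolding PF_def by (rule H1.proj_perp) (use v0 in auto)
    moreover have "J v = 0" by (rule J(7)) (use v0 in \<open>auto simp: F_def\<close>)
    moreover have "p v = v"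
    proof -
      have "x \<in> closed_span s1 (H1.diag_ellipsoid e a)"
        using x_ell H1.span_superset closure_subset unfolding closed_span_def by blast
      then have "p x = x" using p_sub by (simp add: H1.closed_span_diag_ellipsoid[OF e a])
      then show ?thesis
        by (simp add: v_def p_def linear_simps[OF H1.bounded_linear_proj_seq[OF e]])
    qed
    moreover have "D v = y - y'"
    proof -
      have "of_real (2 * b (j + q) / a (j + m)) * H1.ip v (e (j + m))
          = of_real (b (j + q)) * \<eta> (j + q)" for j
        using a(2)[of "j + m"] by (simp add: ipv \<kappa>shift scaleR_conv_of_real)
      then show ?thesis using D(3)[of v] tail by (simp add: sums_unique2)
    qed
    ultimately have Sv: "S v = y - y'" by (simp add: S_def PE_def Td)
    \<comment> \<open>\<open>u + v\<close> is the midpoint of \<open>2 *\<^sub>R u\<close> and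
      \<open>x = 2 *\<^sub>R v\<close>, both of which lie in the first ellipsoid.\<close>
    have "(1 / 2) *\<^sub>R (2 *\<^sub>R u + x) \<in> H1.diag_ellipsoid e a"
      by (rule H1.diag_ellipsoid_midpoint[OF e u_ell x_ell])
    moreover have "(1 / 2) *\<^sub>R (2 *\<^sub>R u + x) = u + v" by (simp add: v_def scaleR_add_right)
    moreover have "S (u + v) = y" using Su Sv bounded_opsD(2)[OF Sbd, of u v] by simp
    ultimately show "y \<in> S ` H1.diag_ellipsoid e a" by (metis image_eqI)
  qed
  then have "S \<in> G_ops s1 s2 (H1.diag_ellipsoid e a) (H2.diag_ellipsoid f b)" using Sbd
    by (simp add: G_ops_def)
  moreover have "\<forall>g\<in>\<Phi>. \<forall>x\<in>X. g (t *\<^sub>R J x) = 0"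
  proof safe
    fix g x assume gx: "g \<in> \<Phi>" "x \<in> X"
    interpret g: Vector_Spaces.linear s2 "(*)" g by (rule \<Phi>(2)[OF gx(1)])
    have "g (J x) = 0" using J(8)[OF gx(1)] gx(2) by (simp flip: PF')
    then show "g (t *\<^sub>R J x) = 0" by (simp add: g.scale flip: H2.scale_of_real)
  qed
  moreover have "\<forall>x. norm (D x) \<le> 2 * C * norm (p x - PF x)"
    using D(2) Dp by metis
  ultimately show ?thesis
    unfolding S_def[abs_def] PE_def PF_def p_def
    by (intro exI[of _ "\<lambda>x. t *\<^sub>R J x"] exI[of _ D]) auto
qed

text \<open>\<open>covering_operator\<close> is applied with a large \<open>m\<close>. Under the
  test functionals its first and last summand together are then close to \<open>T x\<close>, the
  diagonal summand is small because \<open>PF m x\<close> tends to \<open>p x\<close>, and the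
  isometric summand vanishes on the test pairs.\<close>

lemma weak_approximation:
  fixes e :: "nat \<Rightarrow> 'a" and f :: "nat \<Rightarrow> 'b" and a b :: "nat \<Rightarrow> real"
    and \<Phi> :: "(('b \<Rightarrow> 'k) \<times> 'a) set"
  assumes e: "H1.orthonormal UNIV e" and f: "H2.orthonormal UNIV f"
    and a: "decseq a" "\<And>n. a n > 0" and b: "decseq b" "\<And>n. b n > 0"
    and W: "finite W" "H2.orthonormal W (\<lambda>x. x)" "\<And>w j. w \<in> W \<Longrightarrow> H2.ip w (f j) = 0"
    and ba: "C > 0" "\<And>n. b n \<le> C * a (n + card W)"
    and T: "T \<in> bounded_ops s1 s2"
      "\<And>x. T (H1.proj_seq e x) - H2.proj_seq f (T (H1.proj_seq e x)) \<in> H2.span W"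
    and \<Phi>: "finite \<Phi>" "\<And>g x. (g, x) \<in> \<Phi> \<Longrightarrow> g \<in> bounded_ops s2 (*)" and \<epsilon>: "\<epsilon> > 0"
  shows "\<exists>S\<in>G_ops s1 s2 (H1.diag_ellipsoid e a) (H2.diag_ellipsoid f b). \<forall>(g, x)\<in>\<Phi>. norm (g (S x) -
      g (T x)) < \<epsilon>"
proof -
  interpret K: hilbert_space "(*) :: 'k \<Rightarrow> 'k \<Rightarrow> 'k" by (rule hilbert_space_scalars)
  interpret F: hilbert_pair s2 "(*) :: 'k \<Rightarrow> 'k \<Rightarrow> 'k"
    by (rule hilbert_pair.intro H2.hilbert_space_axioms K.hilbert_space_axioms)+
  define k where "k = card W"
  \<comment> \<open>\<open>W\<close> is orthogonal to all \<open>f j\<close>, so for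
    \<open>k \<le> m\<close> this is an orthonormal set of exactly \<open>m\<close> vectors, as many
    as there are axes in the head of the first ellipsoid.\<close>
  define E where "E m = f ` {..<m - k} \<union> W" for m
  define PF where "PF m = H1.proj {..<m} e" for m
  define PE where "PE m = H2.proj (E m) (\<lambda>x. x)" for m
  define p where "p = H1.proj_seq e"
  have injf: "inj_on f {..<n}" for n using inj_on_subset[OF H2.orthonormal_inj[OF f]] by blast
  have onff: "H2.orthonormal {..<n} f" for n using H2.orthonormal_subset[OF f] by blast
  have Wf: "H2.ip (f j) w = 0" if "w \<in> W" for w j using W(3)[OF that] H2.ip_eq_0_commute by blast
  have disj: "f ` I \<inter> W = {}" for I
  proof -
    have "f j \<notin> W" for j using W(3)[of "f j" j] H2.orthonormal_ip[OF f, of j j] by auto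
    then show ?thesis by auto
  qed
  have E: "H2.orthonormal (E m) (\<lambda>x. x)" "finite (E m)" for m
  proof -
    show "finite (E m)" using W(1) by (simp add: E_def)
    show "H2.orthonormal (E m) (\<lambda>x. x)"
      unfolding H2.orthonormal_def
    proof (intro ballI)
      fix x y assume xy: "x \<in> E m" "y \<in> E m"
      have 1: "H2.ip x y = (if x = y then 1 else 0)" if "x \<in> f ` {..<m - k}" "y \<in> f ` {..<m - k}"
        using H2.orthonormal_ip[OF H2.orthonormal_image[OF onff] that] .
      have 2: "H2.ip x y = (if x = y then 1 else 0)" if "x \<in> W" "y \<in> W"
        using H2.orthonormal_ip[OF W(2) that] .
      have 3: "H2.ip x y = 0" "x \<noteq> y" if "x \<in> W" "y \<in> f ` {..<m - k}"
        using that W(3) disj[of "{..<m - k}"] by auto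
      have 4: "H2.ip x y = 0" "x \<noteq> y" if "x \<in> f ` {..<m - k}" "y \<in> W"
        using that Wf disj[of "{..<m - k}"] by auto
      show "H2.ip x y = (if x = y then 1 else 0)"
        using xy 1 2 3 4 unfolding E_def Un_iff by metis
    qed
  qed
  have Ecard: "card (E m) = m" if "k \<le> m" for m
    unfolding E_def using that W(1) disj card_image[OF injf[of "m - k"]]
    by (subst card_Un_disjoint) (auto simp: k_def)
  have PE: "PE m y = H2.proj {..<m - k} f y + H2.proj W (\<lambda>x. x) y" for m y
    unfolding PE_def E_def using W(1) disj H2.proj_image[OF injf[of "m - k"]]
    by (simp add: H2.proj_Un)
  note Td = bounded_opsD(2-5)[OF T(1)]
    and Tlim = bounded_linear.tendsto[OF bounded_opsD(6)[OF T(1)]]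
  have lim_PF: "(\<lambda>m. PF m x) \<longlonglongrightarrow> p x" for x
    unfolding PF_def p_def by (rule H1.proj_tendsto_proj_seq[OF e])
  have lim_T: "(\<lambda>m. PE m (T (PF m x))) \<longlonglongrightarrow> T (p x)" for x
  proof -
    define y where "y = T (p x)"
    have z: "(\<lambda>m. T (PF m x) - y) \<longlonglongrightarrow> 0"
      unfolding y_def using Tlim[OF lim_PF] by (simp add: LIM_zero_iff)
    have "(\<lambda>m. PE m (T (PF m x) - y)) \<longlonglongrightarrow> 0"
      by (rule Lim_null_comparison[OF _ tendsto_norm_zero[OF z]])
         (intro always_eventually allI, unfold PE_def, intro H2.norm_proj_le E)
    moreover have "(\<lambda>m. PE m y) \<longlonglongrightarrow> y"
    proof -
      have "(\<lambda>n. H2.proj {..<n} f y) \<longlonglongrightarrow> H2.proj_seq f y" by (rule H2.proj_tendsto_proj_seq[OF f])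
      then have 1: "(\<lambda>m. H2.proj {..<m - k} f y) \<longlonglongrightarrow> H2.proj_seq f y"
        by (rule filterlim_compose) (rule filterlim_minus_const_nat_at_top)
      \<comment> \<open>By the hypothesis on \<open>T\<close> the component of \<open>y\<close>
        orthogonal to the closed span of \<open>f\<close> lies in \<open>span W\<close>, so the
        projections onto \<open>E m\<close> lose nothing of \<open>y\<close> in the limit.\<close>
      have 2: "H2.proj W (\<lambda>x. x) y = y - H2.proj_seq f y"
      proof -
        have "H2.proj W (\<lambda>x. x) (H2.proj_seq f y) = 0"
          by (rule H2.proj_perp, rule H2.ip_closure_0[OF H2.proj_seq_in_closure[OF f]]) (use Wf in
              auto)
        moreover have "H2.proj W (\<lambda>x. x) (y - H2.proj_seq f y) = y - H2.proj_seq f y"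
          using T(2)[of x] by (intro H2.proj_span[OF W(2,1)]) (simp add: y_def p_def)
        ultimately show ?thesis by (simp add: H2.proj_diff)
      qed
      show ?thesis unfolding PE 2 using tendsto_add[OF 1 tendsto_const[of "y - H2.proj_seq f y"]]
        by simp
    qed
    ultimately have "(\<lambda>m. PE m (T (PF m x) - y) + PE m y) \<longlonglongrightarrow> 0 + y" by (rule tendsto_add)
    then show ?thesis by (simp add: PE_def H2.proj_diff y_def)
  qed
  \<comment> \<open>At most \<open>card \<Phi>\<close> test vectors and \<open>card \<Phi>\<close>
    test functionals have to fit into dimension \<open>m\<close>, and \<open>m \<ge> k\<close> is
    needed as well.\<close>
  define r where "r = 2 * card \<Phi> + k"
  have "\<forall>\<^sub>F m in sequentially. r \<le> m \<and> (\<forall>(g, x)\<in>\<Phi>.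
      norm (g (PE m (T (PF m x))) - g (T (p x))) < \<epsilon> / 2 \<and>
      (\<forall>d. norm d \<le> 2 * C * norm (p x - PF m x) \<longrightarrow> norm (g d) < \<epsilon> / 2))"
  proof (intro eventually_conj eventually_ge_at_top)
    have "\<forall>\<^sub>F m in sequentially. norm (g (PE m (T (PF m x))) - g (T (p x))) < \<epsilon> / 2 \<and>
      (\<forall>d. norm d \<le> 2 * C * norm (p x - PF m x) \<longrightarrow> norm (g d) < \<epsilon> / 2)" if gx: "(g, x) \<in> \<Phi>" for g x
    proof (rule eventually_conj)
      have g: "g \<in> bounded_ops s2 (*)" using \<Phi>(2) gx by blast
      have "(\<lambda>m. g (PE m (T (PF m x)))) \<longlonglongrightarrow> g (T (p x))"
        by (rule bounded_linear.tendsto[OF F.bounded_opsD(6)[OF g] lim_T])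
      then show "\<forall>\<^sub>F m in sequentially. norm (g (PE m (T (PF m x))) - g (T (p x))) < \<epsilon> / 2"
        using tendstoD[of _ _ _ "\<epsilon> / 2"] \<epsilon> by (force simp: dist_norm)
      obtain M where M: "M > 0" "\<And>y. norm (g y) \<le> M * norm y" using F.bounded_ops_pos_bound[OF g]
        by blast
      have "(\<lambda>m. M * (2 * C * norm (p x - PF m x))) \<longlonglongrightarrow> M * (2 * C * norm (p x - p x))"
        by (intro tendsto_intros lim_PF)
      then have "\<forall>\<^sub>F m in sequentially. M * (2 * C * norm (p x - PF m x)) < \<epsilon> / 2"
        using \<epsilon> by (intro order_tendstoD(2)) auto
      then show "\<forall>\<^sub>F m in sequentially. \<forall>d. norm d \<le> 2 * C * norm (p x - PF m x) \<longrightarrow> norm (g d)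
          < \<epsilon> / 2"
      proof eventually_elim
        case (elim m)
        show ?case
        proof (intro allI impI)
          fix d :: 'b assume "norm d \<le> 2 * C * norm (p x - PF m x)"
          then have "M * norm d \<le> M * (2 * C * norm (p x - PF m x))"
            using M(1) by (intro mult_left_mono) auto
          then show "norm (g d) < \<epsilon> / 2" using M(2)[of d] elim by linarith
        qed
      qed
    qed
    then have "\<forall>\<^sub>F m in sequentially. \<forall>z\<in>\<Phi>. case z of (g, x) \<Rightarrow>
      norm (g (PE m (T (PF m x))) - g (T (p x))) < \<epsilon> / 2 \<and>
      (\<forall>d. norm d \<le> 2 * C * norm (p x - PF m x) \<longrightarrow> norm (g d) < \<epsilon> / 2)"
      by (intro eventually_ball_finite \<Phi>(1)) auto
    then show "\<forall>\<^sub>F m in sequentially. \<forall>(g, x)\<in>\<Phi>.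
      norm (g (PE m (T (PF m x))) - g (T (p x))) < \<epsilon> / 2 \<and>
      (\<forall>d. norm d \<le> 2 * C * norm (p x - PF m x) \<longrightarrow> norm (g d) < \<epsilon> / 2)" .
  qed
  then obtain m where m: "r \<le> m"
    "\<And>g x. (g, x) \<in> \<Phi> \<Longrightarrow> norm (g (PE m (T (PF m x))) - g (T (p x))) < \<epsilon> / 2"
    "\<And>g x d. (g, x) \<in> \<Phi> \<Longrightarrow> norm d \<le> 2 * C * norm (p x - PF m x) \<Longrightarrow> norm (g d) < \<epsilon> / 2"
    unfolding eventually_sequentially by fast
  have km: "k \<le> m" using m(1) by (simp add: r_def)
  have fE: "f ` {..<m - k} \<subseteq> H2.span (E m)" unfolding E_def by (auto intro: H2.span_base)
  have lin: "Vector_Spaces.linear s2 (*) g" if "g \<in> fst ` \<Phi>" for g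
    using that \<Phi>(2) F.bounded_opsD(1) by force
  have cards: "card (snd ` \<Phi>) + card (fst ` \<Phi>) \<le> m"
    using card_image_le[OF \<Phi>(1), of fst] card_image_le[OF \<Phi>(1), of snd] m(1) by (simp add: r_def)
  obtain J D where JD: "(\<lambda>x. PE m (T (PF m x)) + J x + D x + T (x - p x))
      \<in> G_ops s1 s2 (H1.diag_ellipsoid e a) (H2.diag_ellipsoid f b)"
    "\<forall>g\<in>fst ` \<Phi>. \<forall>x\<in>snd ` \<Phi>. g (J x) = 0"
    "\<forall>x. norm (D x) \<le> 2 * C * norm (p x - PF m x)"
    using covering_operator[OF e f a b ba(1) ba(2)[folded k_def] km E Ecard[OF km] fE T(1)
      finite_imageI[OF \<Phi>(1)] finite_imageI[OF \<Phi>(1)] lin cards]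
    unfolding PE_def PF_def p_def by blast
  have "norm (g (PE m (T (PF m x)) + J x + D x + T (x - p x)) - g (T x)) < \<epsilon>" if gx: "(g, x) \<in> \<Phi>"
    for g x
  proof -
    have g: "g \<in> bounded_ops s2 (*)" using \<Phi>(2) gx by blast
    note gd = F.bounded_opsD(2-5)[OF g]
    have "g (J x) = 0" using JD(2) gx by force
    then have "g (PE m (T (PF m x)) + J x + D x + T (x - p x)) - g (T x)
      = (g (PE m (T (PF m x))) - g (T (p x))) + g (D x)"
      by (simp add: gd Td)
    also have "norm \<dots> \<le> norm (g (PE m (T (PF m x))) - g (T (p x))) + norm (g (D x))"
      by (rule norm_triangle_ineq)
    also have "\<dots> < \<epsilon> / 2 + \<epsilon> / 2"
      using JD(3) by (intro add_strict_mono m(2,3)[OF gx]) auto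
    finally show ?thesis by simp
  qed
  then show ?thesis by (intro bexI[OF _ JD(1)]) auto
qed

subsection \<open>Widths of covered ellipsoids\<close>

text \<open>
  The approximating space for \<open>K\<^sub>2\<close> is \<open>S Z\<close>, where \<open>Z\<close> is the kernel of \<open>h = proj P \<circ> S\<close> in the span of the
  first \<open>n + card P\<close> vectors \<open>e j\<close>; the map \<open>\<theta>\<close> is almost a right inverse of \<open>h\<close> and moves a
  given vector of that span into \<open>Z\<close>.
\<close>

lemma covering_width_step:
  fixes e :: "nat \<Rightarrow> 'a" and f :: "nat \<Rightarrow> 'b" and a b :: "nat \<Rightarrow> real"
  assumes inf: "infinite_dimensional s2 (UNIV :: 'b set)"
    and e: "H1.orthonormal UNIV e" and f: "H2.orthonormal UNIV f"
    and a: "decseq a" "\<And>n. a n > 0" and b: "decseq b" "\<And>n. b n > 0"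
    and S: "S \<in> bounded_ops s1 s2" "\<And>x. norm (S x) \<le> M * norm x"
      "H2.diag_ellipsoid f b \<subseteq> S ` H1.diag_ellipsoid e a"
    and P: "finite P" "H2.orthonormal P (\<lambda>x. x)" "\<And>g j. g \<in> P \<Longrightarrow> H2.ip (f j) g = 0"
    and x: "\<And>g. g \<in> P \<Longrightarrow>
      norm (H2.proj P (\<lambda>x. x) (S (H1.proj {..<n + card P} e (x g))) - g) \<le> 1 / (2 * (real (card P) +
          1))"
  shows "b n \<le> M * (1 + 2 * M * (\<Sum>g\<in>P. norm (x g))) * a (n + card P)"
proof -
  interpret sw: hilbert_pair s2 s1
    by (rule hilbert_pair.intro H1.hilbert_space_axioms H2.hilbert_space_axioms)+
  interpret p11: hilbert_pair s1 s1
    by (rule hilbert_pair.intro H1.hilbert_space_axioms)+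
  define N where "N = n + card P"
  \<comment> \<open>In \<open>R\<close> at most \<open>card P\<close> errors of relative size
    \<open>c\<close> add up, and \<open>card P * c \<le> 1 / 2\<close>.\<close>
  define c where "c = 1 / (2 * (real (card P) + 1))"
  define pr where "pr = H2.proj P (\<lambda>x. x)"
  define h where "h u = pr (S u)" for u
  define w where "w g = H1.proj {..<N} e (x g)" for g
  define \<theta> where "\<theta> y = (\<Sum>g\<in>P. s1 (H2.ip y g) (w g))" for y
  define R where "R y = h (\<theta> y) - pr y" for y
  have onfN: "H1.orthonormal {..<N} e" using H1.orthonormal_subset[OF e] by blast
  have hw: "norm (h (w g) - g) \<le> c" if "g \<in> P" for g
    using x[OF that] by (simp add: h_def w_def c_def pr_def N_def)
  note Sd = bounded_opsD(2-5)[OF S(1)]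
  have M0: "M \<ge> 0"
  proof -
    have "0 \<le> norm (S (e 0))" by simp
    also have "\<dots> \<le> M" using S(2)[of "e 0"] H1.orthonormal_norm[OF e, of 0] by simp
    finally show ?thesis .
  qed
  have pr_le: "norm (pr y) \<le> norm y" for y unfolding pr_def by (rule H2.norm_proj_le[OF P(2,1)])
  have h_le: "norm (h u) \<le> M * norm u" for u
    unfolding h_def by (rule order_trans[OF pr_le S(2)])
  have hb: "h \<in> bounded_ops s1 s2"
    by (rule bounded_opsI[OF _ _ h_le]) (simp_all add: h_def pr_def Sd H2.proj_add H2.proj_scale)
  note hd = bounded_opsD(2-5)[OF hb]
  have w_le: "norm (w g) \<le> norm (x g)" for g
    unfolding w_def by (rule H1.norm_proj_le[OF onfN]) simp
  have ip_le: "norm (H2.ip y g) \<le> norm y" if "g \<in> P" for y g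
    using H2.norm_ip_le[of y g] H2.orthonormal_norm[OF P(2) that] by simp
  have \<theta>_le: "norm (\<theta> y) \<le> (\<Sum>g\<in>P. norm (x g)) * norm y" for y
    unfolding \<theta>_def sum_distrib_right
    by (rule sum_norm_le, subst H1.norm_scale, subst mult.commute, intro mult_mono w_le ip_le) auto
  have \<theta>b: "\<theta> \<in> bounded_ops s2 s1"
    by (rule sw.bounded_opsI[OF _ _ \<theta>_le])
       (simp_all add: \<theta>_def H2.ip_add_left H2.ip_scale_left H1.scale_left_distrib sum.distrib
         H1.scale_sum_right)
  note \<theta>d = sw.bounded_opsD(2-5)[OF \<theta>b]
  have R: "R y = (\<Sum>g\<in>P. s2 (H2.ip y g) (h (w g) - g))" for y
    unfolding R_def \<theta>_def bounded_ops_sum[OF hb] pr_def H2.proj_def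
    by (simp add: H2.scale_right_diff_distrib sum_subtractf)
  have R_le: "norm (R y) \<le> norm y / 2" for y
  proof -
    have "norm (R y) \<le> (\<Sum>g\<in>P. norm y * c)"
      unfolding R by (rule sum_norm_le) (auto simp: H2.norm_scale intro!: mult_mono ip_le hw)
    also have "\<dots> = (real (card P) * c) * norm y" by simp
    also have "\<dots> \<le> (1 / 2) * norm y"
      by (intro mult_right_mono) (auto simp: c_def divide_simps)
    finally show ?thesis by simp
  qed
  have Rdiff: "R (y - z) = R y - R z" for y z
    by (simp add: R_def \<theta>d hd pr_def H2.proj_diff)
  have pr_span: "pr y \<in> H2.span P" for y
    using H2.proj_in_span[of P "\<lambda>x. x"] by (simp add: pr_def)
  have pr_id: "pr y = y" if "y \<in> H2.span P" for y
    using H2.proj_span[OF P(2,1), of y] that by (simp add: pr_def)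
  \<comment> \<open>On \<open>span P\<close> the composition of \<open>\<theta>\<close> with
    \<open>h\<close> is the identity plus \<open>R\<close>, hence onto, with solutions bounded by
    twice the right-hand side.\<close>
  have solve: "\<exists>y\<in>H2.span P. h (\<theta> y) = z \<and> norm y \<le> 2 * norm z" if z: "z \<in> H2.span P" for z
  proof -
    obtain y where y: "y + R y = z" "norm y \<le> 2 * norm z"
      using perturbed_identity_surj[OF Rdiff R_le] by blast
    have "y = z - R y" using y(1) by (simp add: algebra_simps)
    also have "\<dots> \<in> H2.span P" unfolding R_def h_def by (intro H2.span_diff z pr_span)
    finally have "y \<in> H2.span P" .
    moreover from this have "h (\<theta> y) = z" using y(1) pr_id by (simp add: R_def)
    ultimately show ?thesis using y(2) by blast
  qed
  define X where "X = w ` P"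
  have X: "finite X" "X \<subseteq> H1.span (e ` {..<N})"
    using P(1) H1.proj_in_span by (auto simp: X_def w_def)
  have \<theta>im: "\<theta> ` H2.span P = H1.span X"
  proof -
    interpret t: Vector_Spaces.linear s2 s1 \<theta> by (rule sw.bounded_opsD(1)[OF \<theta>b])
    have "\<theta> g = w g" if "g \<in> P" for g
    proof -
      have "\<theta> g = (\<Sum>h\<in>P. if h = g then w h else 0)"
        unfolding \<theta>_def using H2.orthonormal_ip[OF P(2) that] by (intro sum.cong) auto
      then show ?thesis using that P(1) by simp
    qed
    then have "\<theta> ` P = X" by (auto simp: X_def)
    then show ?thesis using t.span_image[of P] by simp
  qed
  have onf0: "H1.orthonormal {} (\<lambda>x. x)" by (simp add: H1.orthonormal_def)
  obtain Q1 where Q1: "finite Q1" "H1.orthonormal Q1 (\<lambda>x. x)" "H1.span Q1 = H1.span X"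
    using H1.orthonormal_extend[OF X(1) onf0] by auto
  define F where "F = e ` {..<N}"
  have F: "H1.orthonormal F (\<lambda>x. x)" "finite F" "card F = N"
    using H1.orthonormal_image[OF onfN] card_image[OF inj_on_subset[OF H1.orthonormal_inj[OF e]], of
        "{..<N}"]
    by (auto simp: F_def)
  obtain Q2 where Q2: "Q1 \<subseteq> Q2" "finite Q2" "H1.orthonormal Q2 (\<lambda>x. x)"
    "H1.span Q2 = H1.span (Q1 \<union> F)"
    using H1.orthonormal_extend[OF F(2) Q1(2,1)] by blast
  have "Q1 \<subseteq> H1.span F"
    using Q1(3) X(2) unfolding F_def
    by (metis H1.span_minimal H1.span_superset H1.subspace_span order_trans)
  then have sF: "H1.span Q2 = H1.span F"
    unfolding Q2(4) by (simp add: H1.span_eq H1.span_superset H1.span_base subset_iff)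
  have cQ2: "card Q2 \<le> N"
    using H1.orthonormal_card_le(2)[OF Q2(3) F(2)] sF F(3) H1.span_superset by blast
  \<comment> \<open>By \<open>solve\<close>, \<open>h\<close> maps \<open>span Q1\<close> onto a
    space that contains \<open>P\<close>, so \<open>Q1\<close> has at least \<open>card P\<close>
    elements. As \<open>card Q2 \<le> N\<close>, at most \<open>n\<close> elements remain in
    \<open>Q2 - Q1\<close>.\<close>
  have "P \<subseteq> H2.span (h ` Q1)"
  proof
    interpret hl: Vector_Spaces.linear s1 s2 h by (rule bounded_opsD(1)[OF hb])
    fix g assume "g \<in> P"
    then obtain y where "y \<in> H2.span P" "h (\<theta> y) = g" using solve[of g] H2.span_base by blast
    moreover from this have "\<theta> y \<in> H1.span Q1" using \<theta>im Q1(3) by blast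
    ultimately show "g \<in> H2.span (h ` Q1)" unfolding hl.span_image by blast
  qed
  then have "card P \<le> card (h ` Q1)" using H2.orthonormal_card_le(2)[OF P(2)] Q1(1) by blast
  also have "\<dots> \<le> card Q1" by (rule card_image_le[OF Q1(1)])
  finally have cQ1: "card P \<le> card Q1" .
  define Z where "Z = {z \<in> H1.span F. h z = 0}"
  have subZ: "H1.subspace Z"
    by (rule H1.subspaceI) (auto simp: Z_def hd intro: H1.span_zero H1.span_add H1.span_scale)
  obtain Q where Q: "Q \<subseteq> Z" "H1.independent Q" "Z \<subseteq> H1.span Q"
    using H1.maximal_independent_subset[of Z] by blast
  have spQ: "H1.span Q \<subseteq> Z" by (rule H1.span_minimal[OF Q(1) subZ])
  \<comment> \<open>This projection forgets \<open>span Q1\<close>. It is injective on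
    \<open>Z\<close>, since a vector of \<open>Z\<close> in \<open>span X\<close> is
    \<open>\<theta> y\<close> with \<open>y + R y = 0\<close>, which forces \<open>y = 0\<close>.
    Hence \<open>Z\<close> has dimension at most \<open>n\<close>.\<close>
  define k where "k = H1.proj (Q2 - Q1) (\<lambda>x. x)"
  have klin: "Vector_Spaces.linear s1 s1 k"
    unfolding Vector_Spaces.linear_iff k_def
    using H1.vector_space_axioms H1.proj_add H1.proj_scale by blast
  interpret k: Vector_Spaces.linear s1 s1 k by (rule klin)
  have kz: "z = 0" if z: "z \<in> Z" "k z = 0" for z
  proof -
    have "z = H1.proj (Q1 \<union> (Q2 - Q1)) (\<lambda>x. x) z"
      using H1.proj_span[OF Q2(3,2), of z] z(1) sF Q2(1) by (simp add: Z_def Un_absorb1)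
    also have "\<dots> = H1.proj Q1 (\<lambda>x. x) z"
      using z(2) Q1(1) Q2(2) by (subst H1.proj_Un) (auto simp: k_def)
    also have "\<dots> \<in> H1.span X" using H1.proj_in_span[of Q1 "\<lambda>x. x"] Q1(3) by simp
    finally have "z \<in> \<theta> ` H2.span P" using \<theta>im by simp
    then obtain y where y: "y \<in> H2.span P" "z = \<theta> y" by blast
    have "h z = 0" using z(1) by (simp add: Z_def)
    then have "y + R y = 0" using y pr_id by (simp add: R_def)
    then have "norm y = norm (R y)" by (metis add_eq_0_iff norm_minus_cancel)
    then have "y = 0" using R_le[of y] by simp
    then show "z = 0" using y(2) \<theta>d by simp
  qed
  have injk: "inj_on k (H1.span Q)"
  proof (rule inj_onI)
    fix u v assume uv: "u \<in> H1.span Q" "v \<in> H1.span Q" "k u = k v"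
    then have "u - v \<in> Z" using spQ H1.span_diff by blast
    then show "u = v" using kz[of "u - v"] uv(3) by (simp add: k.diff)
  qed
  have "H1.independent (k ` Q)" by (rule k.independent_injective_image[OF Q(2) injk])
  moreover have "k ` Q \<subseteq> H1.span (Q2 - Q1)"
    using H1.proj_in_span[of "Q2 - Q1" "\<lambda>x. x"] by (auto simp: k_def)
  ultimately have kQ: "finite (k ` Q)" "card (k ` Q) \<le> card (Q2 - Q1)"
    using H1.independent_span_bound[of "Q2 - Q1" "k ` Q"] Q2(2) by auto
  have injQ: "inj_on k Q" using inj_on_subset[OF injk H1.span_superset] .
  have finQ: "finite Q" using kQ(1) injQ finite_imageD by blast
  have "card Q \<le> n"
    using kQ(2) card_image[OF injQ] card_Diff_subset[OF Q1(1) Q2(1)] cQ1 cQ2 by (simp add: N_def)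
  then have SQ: "finite (S ` Q)" "card (S ` Q) \<le> n" using finQ card_image_le[OF finQ, of S] by auto
  have b0: "\<And>n. 0 \<le> b n" and a0: "\<And>n. 0 \<le> a n" using a(2) b(2) by (auto intro: less_imp_le)
  have "0 \<in> H2.diag_ellipsoid f b"
    by (rule H2.diag_ellipsoid_finite[OF f b, of _ 0]) (auto simp: H2.span_zero b0)
  then have K: "H2.diag_ellipsoid f b \<noteq> {}" "\<And>x. x \<in> H2.diag_ellipsoid f b \<Longrightarrow> norm x \<le> b 0"
    using H2.diag_ellipsoid_norm[OF f b(1) b0] by auto
  have "H2.diag_ellipsoid f b \<subseteq> closure (H2.span (range f))"
    using H2.closed_span_diag_ellipsoid[OF f b] H2.span_superset closure_subset
      unfolding closed_span_def by blast
  \<comment> \<open>\<open>P\<close> is orthogonal to the closed span of \<open>f\<close>, which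
    contains the second ellipsoid.\<close>
  then have pr0: "pr y = 0" if "y \<in> H2.diag_ellipsoid f b" for y
    unfolding pr_def using P(3) that by (intro H2.proj_perp H2.ip_closure_0[of y "range f"]) auto
  define A where "A = (\<Sum>g\<in>P. norm (x g))"
  have A0: "A \<ge> 0" by (simp add: A_def sum_nonneg)
  have "kolmogorov_width s2 n (H2.diag_ellipsoid f b) \<le> M * (1 + 2 * M * A) * a N"
  proof (rule H2.kolmogorov_width_le[OF inf K SQ])
    fix y assume y: "y \<in> H2.diag_ellipsoid f b"
    then obtain u where u: "u \<in> H1.diag_ellipsoid e a" "S u = y" using S(3) by blast
    define v where "v = H1.proj {..<N} e u"
    have uv: "norm (u - v) \<le> a N" unfolding v_def
      by (rule H1.diag_ellipsoid_tail[OF e a(1) a0 u(1)])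
    \<comment> \<open>\<open>h u = pr y = 0\<close>, so \<open>h v\<close> is controlled by the
      truncation error \<open>u - v\<close>. This is why moving \<open>v\<close> into
      \<open>Z\<close> costs only a constant factor.\<close>
    have "h v = - h (u - v)" using pr0[OF y] u(2) by (simp add: hd) (simp add: h_def)
    then have hv: "norm (h v) \<le> M * a N"
      using order_trans[OF h_le mult_left_mono[OF uv M0]] by simp
    obtain t where t: "t \<in> H2.span P" "h (\<theta> t) = h v" "norm t \<le> 2 * norm (h v)"
      using solve[of "h v"] pr_span by (auto simp: h_def)
    define z where "z = v - \<theta> t"
    have "\<theta> t \<in> H1.span F"
      using \<theta>im t(1) X(2) unfolding F_def by (metis H1.span_minimal H1.subspace_span imageI subsetD)
    then have "z \<in> Z"
      using H1.proj_in_span[of "{..<N}" e u] t(2)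
      by (auto simp: Z_def z_def hd v_def F_def intro: H1.span_diff)
    then have zQ: "z \<in> H1.span Q" using Q(3) by blast
    have "norm (\<theta> t) \<le> A * (2 * (M * a N))"
      using order_trans[OF \<theta>_le mult_left_mono[OF order_trans[OF t(3) mult_left_mono[OF hv]]]] A0
      by (simp add: A_def)
    then have "norm (u - z) \<le> a N + A * (2 * (M * a N))"
      using norm_triangle_ineq[of "u - v" "\<theta> t"] uv by (simp add: z_def algebra_simps)
    then have "M * norm (u - z) \<le> M * (a N + A * (2 * (M * a N)))"
      using M0 by (intro mult_left_mono)
    then have "norm (y - S z) \<le> M * (1 + 2 * M * A) * a N"
      using S(2)[of "u - z"] u(2) by (simp add: Sd algebra_simps)
    moreover have "S z \<in> H2.span (S ` Q)"
    proof -
      interpret Sl: Vector_Spaces.linear s1 s2 S by (rule bounded_opsD(1)[OF S(1)])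
      show ?thesis unfolding Sl.span_image using zQ by blast
    qed
    ultimately show "\<exists>z\<in>H2.span (S ` Q). norm (y - z) \<le> M * (1 + 2 * M * A) * a N" by blast
  qed
  then show ?thesis using H2.kolmogorov_width_diag_ellipsoid[OF inf f b] by (simp add: A_def N_def)
qed

text \<open>Truncating each \<open>x g\<close> to its first \<open>N\<close> coordinates keeps the
  strict inequality for all large \<open>N\<close>, so \<open>covering_width_step\<close> applies
  with a constant that does not depend on \<open>n\<close>.\<close>

lemma covering_width_bound:
  fixes e :: "nat \<Rightarrow> 'a" and f :: "nat \<Rightarrow> 'b" and a b :: "nat \<Rightarrow> real"
  assumes inf: "infinite_dimensional s2 (UNIV :: 'b set)"
    and e: "H1.orthonormal UNIV e" and f: "H2.orthonormal UNIV f"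
    and a: "decseq a" "\<And>n. a n > 0" and b: "decseq b" "\<And>n. b n > 0"
    and S: "S \<in> G_ops s1 s2 (H1.diag_ellipsoid e a) (H2.diag_ellipsoid f b)"
    and P: "finite P" "H2.orthonormal P (\<lambda>x. x)" "\<And>g j. g \<in> P \<Longrightarrow> H2.ip (f j) g = 0"
    and x: "\<And>g. g \<in> P \<Longrightarrow> x g \<in> closure (H1.span (range e))"
      "\<And>g. g \<in> P \<Longrightarrow> norm (H2.proj P (\<lambda>x. x) (S (x g)) - g) < 1 / (2 * (real (card P) + 1))"
  shows "\<exists>C>0. \<forall>n. b n \<le> C * a (n + card P)"
proof -
  have Sb: "S \<in> bounded_ops s1 s2" and SK: "H2.diag_ellipsoid f b \<subseteq> S ` H1.diag_ellipsoid e a"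
    using S by (auto simp: G_ops_def)
  obtain M where M: "M > 0" "\<And>x. norm (S x) \<le> M * norm x" using bounded_ops_pos_bound[OF Sb]
    by blast
  have "\<forall>\<^sub>F N in sequentially. norm (H2.proj P (\<lambda>x. x) (S (H1.proj {..<N} e (x g))) - g)
      < 1 / (2 * (real (card P) + 1))" if "g \<in> P" for g
  proof (rule order_tendstoD(2)[OF _ x(2)[OF that]])
    have "(\<lambda>N. H1.proj {..<N} e (x g)) \<longlonglongrightarrow> x g"
      using H1.proj_tendsto_proj_seq[OF e, of "x g"] H1.proj_seq_closure[OF e x(1)[OF that]] by simp
    then have "(\<lambda>N. S (H1.proj {..<N} e (x g))) \<longlonglongrightarrow> S (x g)"
      by (rule bounded_linear.tendsto[OF bounded_opsD(6)[OF Sb]])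
    then show "(\<lambda>N. norm (H2.proj P (\<lambda>x. x) (S (H1.proj {..<N} e (x g))) - g))
        \<longlonglongrightarrow> norm (H2.proj P (\<lambda>x. x) (S (x g)) - g)"
      unfolding H2.proj_def
      by (intro tendsto_intros bounded_linear.tendsto[OF H2.bounded_linear_scale_left])
  qed
  then have "\<forall>\<^sub>F N in sequentially. \<forall>g\<in>P. norm (H2.proj P (\<lambda>x. x) (S (H1.proj {..<N} e (x g))) - g)
      < 1 / (2 * (real (card P) + 1))"
    by (intro eventually_ball_finite P(1)) blast
  then obtain N0 where N0: "\<And>N g. N \<ge> N0 \<Longrightarrow> g \<in> P \<Longrightarrow>
      norm (H2.proj P (\<lambda>x. x) (S (H1.proj {..<N} e (x g))) - g) < 1 / (2 * (real (card P) + 1))"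
    unfolding eventually_sequentially by blast
  define C where "C = M * (1 + 2 * M * (\<Sum>g\<in>P. norm (x g)))"
  \<comment> \<open>Takes care of \<open>n < N0\<close>, where \<open>b n \<le> b 0\<close> and
    \<open>a (n + card P) \<ge> a (N0 + card P)\<close>.\<close>
  define C' where "C' = b 0 / a (N0 + card P)"
  have C: "C > 0" "C' > 0"
    using M(1) a(2) b(2) by (auto simp: C_def C'_def intro!: mult_pos_pos add_pos_nonneg
        mult_nonneg_nonneg sum_nonneg)
  have "b n \<le> (C + C') * a (n + card P)" for n
  proof (cases "n \<ge> N0")
    case True
    have "b n \<le> C * a (n + card P)"
      unfolding C_def
      by (rule covering_width_step[OF inf e f a b Sb M(2) SK P])
         (use N0[of "n + card P"] True in \<open>auto intro: less_imp_le\<close>)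
    also have "\<dots> \<le> (C + C') * a (n + card P)"
      using C a(2)[of "n + card P"] by (intro mult_right_mono) auto
    finally show ?thesis .
  next
    case False
    have "b n \<le> b 0" using decseqD[OF b(1), of 0 n] by simp
    also have "\<dots> = C' * a (N0 + card P)" using a(2)[of "N0 + card P"] by (simp add: C'_def)
    also have "\<dots> \<le> C' * a (n + card P)"
      using C decseqD[OF a(1), of "n + card P" "N0 + card P"] False by (intro mult_left_mono) auto
    also have "\<dots> \<le> (C + C') * a (n + card P)"
      using C a(2)[of "n + card P"] by (intro mult_right_mono) auto
    finally show ?thesis .
  qed
  then show ?thesis using C by (intro exI[of _ "C + C'"]) auto
qed

end

section \<open>Cosets and the dimension of an image in a quotient space\<close>

context hilbert_space
begin

lemma coset_eq_iff:
  assumes "subspace V"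
  shows "x +o V = y +o V \<longleftrightarrow> x - y \<in> V"
proof
  assume "x +o V = y +o V"
  moreover have "x \<in> x +o V" using subspace_0[OF assms] by (force simp: elt_set_plus_def)
  ultimately show "x - y \<in> V" by (auto simp: elt_set_plus_def)
next
  assume xy: "x - y \<in> V"
  have "u +o V \<subseteq> v +o V" if "u - v \<in> V" for u v
  proof
    fix z assume "z \<in> u +o V"
    then obtain w where w: "w \<in> V" "z = u + w" by (auto simp: elt_set_plus_def)
    then have "z = v + ((u - v) + w)" by simp
    then show "z \<in> v +o V" using subspace_add[OF assms that w(1)] unfolding elt_set_plus_def
      by blast
  qed
  moreover have "y - x \<in> V" using subspace_neg[OF assms xy] by simp
  ultimately show "x +o V = y +o V" using xy by blast
qed

text \<open>Combinations of cosets can be computed on representatives: the summand \<open>V\<close>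
  absorbs the multiples of \<open>V\<close>, also when a coefficient is zero or the sum is
  empty.\<close>

lemma coset_sum:
  assumes V: "subspace V" and "finite F" "\<And>X. X \<in> F \<Longrightarrow> X = r X +o V"
  shows "V + (\<Sum>X\<in>F. scale (c X) ` X) = (\<Sum>X\<in>F. scale (c X) (r X)) +o V"
  using assms(2,3)
proof (induction F rule: finite_induct)
  case empty
  show ?case by (auto simp: elt_set_plus_def set_plus_def)
next
  case (insert X F)
  define s where "s = (\<Sum>X\<in>F. scale (c X) (r X))"
  have "V + (\<Sum>X\<in>insert X F. scale (c X) ` X) = scale (c X) ` X + (V + (\<Sum>X\<in>F. scale (c X) ` X))"
    using insert.hyps by (simp add: add.left_commute)
  also have "\<dots> = scale (c X) ` X + (s +o V)"
    using insert.IH insert.prems by (simp add: s_def)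
  also have "\<dots> = (scale (c X) (r X) + s) +o V"
  proof (intro equalityI subsetI)
    fix z assume "z \<in> scale (c X) ` X + (s +o V)"
    then obtain x v where xv: "x \<in> X" "v \<in> V" "z = scale (c X) x + (s + v)"
      by (auto simp: set_plus_def elt_set_plus_def)
    then obtain v' where v': "v' \<in> V" "x = r X + v'"
      using insert.prems[of X] by (auto simp: elt_set_plus_def)
    have "z = scale (c X) (r X) + s + (scale (c X) v' + v)"
      using xv(3) v'(2) by (simp add: scale_right_distrib algebra_simps)
    moreover have "scale (c X) v' + v \<in> V" by (intro subspace_add subspace_scale V v' xv)
    ultimately show "z \<in> (scale (c X) (r X) + s) +o V" unfolding elt_set_plus_def by blast
  next
    fix z assume "z \<in> (scale (c X) (r X) + s) +o V"
    then obtain v where v: "v \<in> V" "z = scale (c X) (r X) + (s + v)"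
      by (auto simp: elt_set_plus_def add.assoc)
    have "r X \<in> X" using insert.prems[of X] subspace_0[OF V] by (force simp: elt_set_plus_def)
    then show "z \<in> scale (c X) ` X + (s +o V)"
      unfolding v(2) using v(1) by (intro set_plus_intro) (auto simp: elt_set_plus_def)
  qed
  finally show ?case using insert.hyps by (simp add: s_def)
qed

text \<open>Representatives in \<open>W\<close> of the spanning cosets serve as
  \<open>B\<close>.\<close>

lemma quotient_dim_leD:
  assumes V: "subspace V" and Q: "quotient_dim_le scale V (quotient_image V W) k"
  shows "\<exists>B\<subseteq>W. finite B \<and> card B \<le> k \<and> (\<forall>x\<in>W. \<exists>y\<in>span B. x - y \<in> V)"
proof -
  obtain F where F: "F \<subseteq> quotient_image V W" "finite F" "card F \<le> k"
    "quotient_image V W = quotient_span scale V F"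
    using Q unfolding quotient_dim_le_def by blast
  have "\<forall>X\<in>F. \<exists>x. x \<in> W \<and> X = x +o V" using F(1) by (auto simp: quotient_image_def)
  then obtain r where r: "\<And>X. X \<in> F \<Longrightarrow> r X \<in> W \<and> X = r X +o V" by metis
  have "\<exists>y\<in>span (r ` F). x - y \<in> V" if "x \<in> W" for x
  proof -
    have "x +o V \<in> quotient_span scale V F" using that F(4) by (auto simp: quotient_image_def)
    then obtain c where "x +o V = V + (\<Sum>X\<in>F. scale (c X) ` X)" by (auto simp: quotient_span_def)
    also have "\<dots> = (\<Sum>X\<in>F. scale (c X) (r X)) +o V"
      by (rule coset_sum[OF V F(2)]) (use r in blast)
    finally have "x - (\<Sum>X\<in>F. scale (c X) (r X)) \<in> V" using coset_eq_iff[OF V] by blast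
    moreover have "(\<Sum>X\<in>F. scale (c X) (r X)) \<in> span (r ` F)"
      by (intro span_sum span_scale span_base) auto
    ultimately show ?thesis by blast
  qed
  moreover have "card (r ` F) \<le> k" using card_image_le[OF F(2), of r] F(3) by linarith
  ultimately show ?thesis using r F(2) by (intro exI[of _ "r ` F"]) auto
qed

text \<open>As the vectors of \<open>B\<close> lie in different cosets, coefficients indexed by
  cosets and coefficients indexed by vectors correspond to each other.\<close>

lemma quotient_dim_leI:
  assumes V: "subspace V" and W: "subspace W"
    and B: "B \<subseteq> W" "finite B" "card B \<le> k" "inj_on (\<lambda>x. x +o V) B"
    and cover: "\<And>x. x \<in> W \<Longrightarrow> \<exists>y\<in>span B. x - y \<in> V"
  shows "quotient_dim_le scale V (quotient_image V W) k"
proof -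
  define F where "F = (\<lambda>x. x +o V) ` B"
  define r where "r = inv_into B (\<lambda>x. x +o V)"
  have r: "r (x +o V) = x" if "x \<in> B" for x unfolding r_def by (rule inv_into_f_f[OF B(4) that])
  have F: "finite F" "card F \<le> k" using B(2,3) card_image_le[OF B(2), of "\<lambda>x. x +o V"]
    by (auto simp: F_def)
  have rF: "X = r X +o V" if "X \<in> F" for X using that r by (auto simp: F_def)
  have sum: "(\<Sum>X\<in>F. scale (c X) (r X)) = (\<Sum>x\<in>B. scale (c (x +o V)) x)" for c
    unfolding F_def by (subst sum.reindex[OF B(4)]) (auto simp: r intro!: sum.cong)
  have "quotient_image V W = quotient_span scale V F"
  proof (intro equalityI subsetI)
    fix X assume "X \<in> quotient_image V W"
    then obtain x where x: "x \<in> W" "X = x +o V" by (auto simp: quotient_image_def)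
    then obtain y where y: "y \<in> span B" "x - y \<in> V" using cover by blast
    obtain u where u: "y = (\<Sum>v\<in>B. scale (u v) v)" using y(1) unfolding span_finite[OF B(2)] by blast
    have "X = y +o V" using x(2) y(2) coset_eq_iff[OF V] by blast
    also have "y = (\<Sum>X\<in>F. scale (u (r X)) (r X))"
      unfolding u sum[of "\<lambda>X. u (r X)"] by (intro sum.cong) (auto simp: r)
    also have "\<dots> +o V = V + (\<Sum>X\<in>F. scale (u (r X)) ` X)"
      using coset_sum[OF V F(1) rF, of "\<lambda>X. u (r X)"] by simp
    finally show "X \<in> quotient_span scale V F"
      unfolding quotient_span_def by (intro CollectI exI[of _ "\<lambda>X. u (r X)"]) simp
  next
    fix X assume "X \<in> quotient_span scale V F"
    then obtain c where "X = V + (\<Sum>X\<in>F. scale (c X) ` X)" by (auto simp: quotient_span_def)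
    then have "X = (\<Sum>x\<in>B. scale (c (x +o V)) x) +o V"
      using coset_sum[OF V F(1) rF, of c] by (simp add: sum)
    moreover have "(\<Sum>x\<in>B. scale (c (x +o V)) x) \<in> W"
      using B(1) by (intro subspace_sum[OF W] subspace_scale[OF W]) auto
    ultimately show "X \<in> quotient_image V W" by (auto simp: quotient_image_def)
  qed
  moreover have "F \<subseteq> quotient_image V W" using B(1) by (auto simp: F_def quotient_image_def)
  ultimately show ?thesis unfolding quotient_dim_le_def using F by blast
qed

end

context hilbert_pair
begin

subsection \<open>The weak operator closure\<close>

text \<open>The zero functional with \<open>U = UNIV\<close> makes the set of all bounded operators
  one of the generating sets.\<close>

lemma topspace_weak_op: "topspace (weak_op_topology s1 s2) = bounded_ops s1 s2"
proof -
  interpret K: hilbert_space "(*) :: 'k \<Rightarrow> 'k \<Rightarrow> 'k" by (rule hilbert_space_scalars)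
  interpret F: hilbert_pair s2 "(*) :: 'k \<Rightarrow> 'k \<Rightarrow> 'k"
    by (rule hilbert_pair.intro H2.hilbert_space_axioms K.hilbert_space_axioms)+
  have "(\<lambda>_. 0) \<in> bounded_ops s2 ((*) :: 'k \<Rightarrow> 'k \<Rightarrow> 'k)"
    by (rule F.bounded_opsI[where M = 0]) auto
  then have "{T \<in> bounded_ops s1 s2. (0 :: 'k) \<in> UNIV} \<in>
      {{T \<in> bounded_ops s1 s2. f (T x) \<in> U} | f x U. f \<in> bounded_ops s2 (*) \<and> open U}"
    by (intro CollectI exI[of _ "\<lambda>_. 0 :: 'k"] exI[of _ UNIV]) auto
  then show ?thesis unfolding weak_op_topology_def topology_generated_by_topspace by auto
qed

lemma weak_op_open_basic:
  assumes "finite \<Phi>" "\<And>g x. (g, x) \<in> \<Phi> \<Longrightarrow> g \<in> bounded_ops s2 (*)"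
  shows "openin (weak_op_topology s1 s2)
    {S \<in> bounded_ops s1 s2. \<forall>(g, x)\<in>\<Phi>. norm (g (S x) - g (T x)) < \<epsilon>}"
  using assms
proof (induction \<Phi> rule: finite_induct)
  case empty
  show ?case using openin_topspace[of "weak_op_topology s1 s2"] by (simp add: topspace_weak_op)
next
  case (insert z \<Phi>)
  obtain g x where z: "z = (g, x)" by (cases z)
  have "{S \<in> bounded_ops s1 s2. g (S x) \<in> ball (g (T x)) \<epsilon>} \<in>
      {{T \<in> bounded_ops s1 s2. f (T x) \<in> U} | f x U. f \<in> bounded_ops s2 (*) \<and> open U}"
    using insert.prems[of g x] z open_ball by blast
  then have "openin (weak_op_topology s1 s2) {S \<in> bounded_ops s1 s2. g (S x) \<in> ball (g (T x)) \<epsilon>}"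
    unfolding weak_op_topology_def by (rule topology_generated_by_Basis)
  from openin_Int[OF this insert.IH] insert.prems
  have "openin (weak_op_topology s1 s2) ({S \<in> bounded_ops s1 s2. g (S x) \<in> ball (g (T x)) \<epsilon>} \<inter>
    {S \<in> bounded_ops s1 s2. \<forall>(g, x)\<in>\<Phi>. norm (g (S x) - g (T x)) < \<epsilon>})" by blast
  moreover have "{S \<in> bounded_ops s1 s2. g (S x) \<in> ball (g (T x)) \<epsilon>} \<inter>
    {S \<in> bounded_ops s1 s2. \<forall>(g, x)\<in>\<Phi>. norm (g (S x) - g (T x)) < \<epsilon>} =
    {S \<in> bounded_ops s1 s2. \<forall>(g, x)\<in>insert z \<Phi>. norm (g (S x) - g (T x)) < \<epsilon>}"
    by (auto simp: z dist_norm norm_minus_commute)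
  ultimately show ?case by simp
qed

text \<open>Induction on the generation of \<open>V\<close>: for an intersection the two finite sets
  of test pairs are united and the smaller radius is taken.\<close>

lemma weak_op_open_nhd:
  assumes "openin (weak_op_topology s1 s2) V" "T \<in> V"
  shows "\<exists>\<Phi> \<epsilon>. finite \<Phi> \<and> (\<forall>(g, x)\<in>\<Phi>. g \<in> bounded_ops s2 (*)) \<and> \<epsilon> > 0 \<and>
    {S \<in> bounded_ops s1 s2. \<forall>(g, x)\<in>\<Phi>. norm (g (S x) - g (T x)) < \<epsilon>} \<subseteq> V"
proof -
  have "generate_topology_on
      {{T \<in> bounded_ops s1 s2. f (T x) \<in> U} | f x U. f \<in> bounded_ops s2 (*) \<and> open U} V"
    using assms(1) unfolding weak_op_topology_def by (rule openin_topology_generated_by)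
  then show ?thesis
    using assms(2)
  proof (induction rule: generate_topology_on.induct)
    case (Int A B)
    from Int.prems have "T \<in> A" "T \<in> B" by auto
    from Int.IH(1)[OF this(1)] obtain \<Phi> \<epsilon> where
      A: "finite \<Phi>" "\<forall>(g, x)\<in>\<Phi>. g \<in> bounded_ops s2 (*)" "\<epsilon> > 0"
        "{S \<in> bounded_ops s1 s2. \<forall>(g, x)\<in>\<Phi>. norm (g (S x) - g (T x)) < \<epsilon>} \<subseteq> A" by blast
    from Int.IH(2)[OF \<open>T \<in> B\<close>] obtain \<Psi> \<delta> where
      B: "finite \<Psi>" "\<forall>(g, x)\<in>\<Psi>. g \<in> bounded_ops s2 (*)" "\<delta> > 0"
        "{S \<in> bounded_ops s1 s2. \<forall>(g, x)\<in>\<Psi>. norm (g (S x) - g (T x)) < \<delta>} \<subseteq> B" by blast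
    have "{S \<in> bounded_ops s1 s2. \<forall>(g, x)\<in>\<Phi> \<union> \<Psi>. norm (g (S x) - g (T x)) < min \<epsilon> \<delta>} \<subseteq> A \<inter> B"
    proof (intro subsetI IntI)
      fix S assume S: "S \<in> {S \<in> bounded_ops s1 s2. \<forall>(g, x)\<in>\<Phi> \<union> \<Psi>. norm (g (S x) - g (T x))
          < min \<epsilon> \<delta>}"
      have "S \<in> {S \<in> bounded_ops s1 s2. \<forall>(g, x)\<in>\<Phi>. norm (g (S x) - g (T x)) < \<epsilon>}" using S by auto
      then show "S \<in> A" using A(4) by blast
      have "S \<in> {S \<in> bounded_ops s1 s2. \<forall>(g, x)\<in>\<Psi>. norm (g (S x) - g (T x)) < \<delta>}" using S by auto
      then show "S \<in> B" using B(4) by blast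
    qed
    then show ?case using A B by (intro exI[of _ "\<Phi> \<union> \<Psi>"] exI[of _ "min \<epsilon> \<delta>"]) auto
  next
    case (UN K)
    then obtain k where k: "k \<in> K" "T \<in> k" by blast
    from UN.IH[OF k] obtain \<Phi> \<epsilon> where "finite \<Phi>" "\<forall>(g, x)\<in>\<Phi>. g \<in> bounded_ops s2 (*)" "\<epsilon> > 0"
      "{S \<in> bounded_ops s1 s2. \<forall>(g, x)\<in>\<Phi>. norm (g (S x) - g (T x)) < \<epsilon>} \<subseteq> k" by blast
    then show ?case using Union_upper[OF k(1)]
      by (intro exI[of _ \<Phi>] exI[of _ \<epsilon>] conjI) auto
  next
    case (Basis V)
    then obtain f x U where fxU: "V = {T \<in> bounded_ops s1 s2. f (T x) \<in> U}"
      "f \<in> bounded_ops s2 (*)" "open U" by blast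
    then obtain \<epsilon> where "\<epsilon> > 0" "ball (f (T x)) \<epsilon> \<subseteq> U"
      using Basis.prems open_contains_ball by blast
    then show ?case
      using fxU by (intro exI[of _ "{(f, x)}"] exI[of _ \<epsilon>]) (auto simp: dist_norm norm_minus_commute
          subset_iff)
  qed simp
qed

text \<open>Finitely many test pairs and a radius describe a neighbourhood base at \<open>T\<close>.
  Both directions of the theorem work with this form of the closure.\<close>

lemma WG_iff:
  "T \<in> WG s1 s2 K1 K2 \<longleftrightarrow> T \<in> bounded_ops s1 s2 \<and>
    (\<forall>\<Phi> \<epsilon>. finite \<Phi> \<longrightarrow> (\<forall>(g, x)\<in>\<Phi>. g \<in> bounded_ops s2 (*)) \<longrightarrow> \<epsilon> > 0 \<longrightarrow>
      (\<exists>S\<in>G_ops s1 s2 K1 K2. \<forall>(g, x)\<in>\<Phi>. norm (g (S x) - g (T x)) < \<epsilon>))"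
proof (intro iffI conjI allI impI)
  assume T: "T \<in> WG s1 s2 K1 K2"
  then show Tb: "T \<in> bounded_ops s1 s2"
    unfolding WG_def in_closure_of topspace_weak_op by blast
  fix \<Phi> :: "(('b \<Rightarrow> 'k) \<times> 'a) set" and \<epsilon> :: real
  assume \<Phi>: "finite \<Phi>" "\<forall>(g, x)\<in>\<Phi>. g \<in> bounded_ops s2 (*)" "\<epsilon> > 0"
  define V where "V = {S \<in> bounded_ops s1 s2. \<forall>(g, x)\<in>\<Phi>. norm (g (S x) - g (T x)) < \<epsilon>}"
  have "openin (weak_op_topology s1 s2) V"
    unfolding V_def by (rule weak_op_open_basic) (use \<Phi> in auto)
  moreover have "T \<in> V" using Tb \<Phi>(3) by (auto simp: V_def)
  ultimately obtain S where "S \<in> G_ops s1 s2 K1 K2" "S \<in> V"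
    using T unfolding WG_def in_closure_of by blast
  then show "\<exists>S\<in>G_ops s1 s2 K1 K2. \<forall>(g, x)\<in>\<Phi>. norm (g (S x) - g (T x)) < \<epsilon>"
    unfolding V_def by blast
next
  assume T: "T \<in> bounded_ops s1 s2 \<and>
    (\<forall>\<Phi> \<epsilon>. finite \<Phi> \<longrightarrow> (\<forall>(g, x)\<in>\<Phi>. g \<in> bounded_ops s2 (*)) \<longrightarrow> \<epsilon> > 0 \<longrightarrow>
      (\<exists>S\<in>G_ops s1 s2 K1 K2. \<forall>(g, x)\<in>\<Phi>. norm (g (S x) - g (T x)) < \<epsilon>))"
  show "T \<in> WG s1 s2 K1 K2"
    unfolding WG_def in_closure_of topspace_weak_op
  proof (intro conjI allI impI)
    show "T \<in> bounded_ops s1 s2" using T by blast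
    fix V assume V: "T \<in> V \<and> openin (weak_op_topology s1 s2) V"
    then have "openin (weak_op_topology s1 s2) V" "T \<in> V" by auto
    from weak_op_open_nhd[OF this]
    obtain \<Phi> \<epsilon> where \<Phi>: "finite \<Phi>" "\<forall>(g, x)\<in>\<Phi>. g \<in> bounded_ops s2 (*)" "\<epsilon> > 0"
      "{S \<in> bounded_ops s1 s2. \<forall>(g, x)\<in>\<Phi>. norm (g (S x) - g (T x)) < \<epsilon>} \<subseteq> V"
      by blast
    from T[THEN conjunct2, THEN spec, THEN spec, THEN mp, THEN mp, THEN mp, OF \<Phi>(1-3)]
    obtain S where S: "S \<in> G_ops s1 s2 K1 K2" "\<forall>(g, x)\<in>\<Phi>. norm (g (S x) - g (T x)) < \<epsilon>"
      by blast
    then have "S \<in> V" using \<Phi>(4) by (auto simp: G_ops_def)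
    then show "\<exists>S. S \<in> G_ops s1 s2 K1 K2 \<and> S \<in> V" using S(1) by blast
  qed
qed

section \<open>Sufficiency and necessity for diagonal ellipsoids\<close>

text \<open>This component of \<open>T x\<close> stands for the image of \<open>T x\<close> in the
  quotient by the closed span of \<open>f\<close>: it is zero exactly when \<open>T x\<close> lies
  in that space.\<close>

lemma perp_component:
  fixes f :: "nat \<Rightarrow> 'b"
  assumes f: "H2.orthonormal UNIV f" and T: "T \<in> bounded_ops s1 s2"
  shows "(\<lambda>x. T x - H2.proj_seq f (T x)) \<in> bounded_ops s1 s2"
    "H2.ip (T x - H2.proj_seq f (T x)) (f j) = 0"
proof -
  note Td = bounded_opsD(2-5)[OF T]
  obtain M where M: "M > 0" "\<And>x. norm (T x) \<le> M * norm x" using bounded_ops_pos_bound[OF T] by blast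
  show "(\<lambda>x. T x - H2.proj_seq f (T x)) \<in> bounded_ops s1 s2"
  proof (rule bounded_opsI[where M = "2 * M"])
    fix x
    have "norm (T x - H2.proj_seq f (T x)) \<le> norm (T x) + norm (T x)"
      by (rule order_trans[OF norm_triangle_ineq4]) (simp add: H2.norm_proj_seq_le[OF f])
    then show "norm (T x - H2.proj_seq f (T x)) \<le> 2 * M * norm x" using M(2)[of x] by simp
  qed (simp_all add: Td H2.proj_seq_add[OF f] H2.proj_seq_scale[OF f] H2.scale_right_diff_distrib)
  show "H2.ip (T x - H2.proj_seq f (T x)) (f j) = 0"
    by (simp add: H2.ip_diff_left H2.ip_proj_seq[OF f])
qed

lemma proj_seq_idem: "H1.orthonormal UNIV e \<Longrightarrow> H1.proj_seq e (H1.proj_seq e x) = H1.proj_seq e x"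
  by (rule H1.proj_seq_closure[OF _ H1.proj_seq_in_closure])

text \<open>\<open>T'\<close> agrees with \<open>T\<close> at the test vectors and on the complement
  of the closed span of \<open>e\<close>, but maps that closed span to a space of finite dimension.
  This dimension grows with the number of test vectors, so no single shift would suffice for the
  argument.\<close>

lemma WG_ellip_if_all_shifts:
  fixes e :: "nat \<Rightarrow> 'a" and f :: "nat \<Rightarrow> 'b" and a b :: "nat \<Rightarrow> real"
  assumes e: "H1.orthonormal UNIV e" and f: "H2.orthonormal UNIV f"
    and a: "decseq a" "\<And>n. a n > 0" and b: "decseq b" "\<And>n. b n > 0"
    and ba: "\<And>k. \<exists>C>0. \<forall>n. b n \<le> C * a (n + k)"
    and T: "T \<in> bounded_ops s1 s2"
  shows "T \<in> WG s1 s2 (H1.diag_ellipsoid e a) (H2.diag_ellipsoid f b)"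
  unfolding WG_iff
proof (intro conjI T allI impI)
  fix \<Phi> :: "(('b \<Rightarrow> 'k) \<times> 'a) set" and \<epsilon> :: real
  assume \<Phi>: "finite \<Phi>" "\<forall>(g, x)\<in>\<Phi>. g \<in> bounded_ops s2 (*)" "\<epsilon> > 0"
  note Td = bounded_opsD(2-5)[OF T]
  define p where "p = H1.proj_seq e"
  define X where "X = p ` snd ` \<Phi>"
  have finX: "finite X" using \<Phi>(1) by (simp add: X_def)
  have onf0: "H1.orthonormal {} (\<lambda>x. x)" "H2.orthonormal {} (\<lambda>x. x)"
    by (simp_all add: H1.orthonormal_def H2.orthonormal_def)
  obtain P where P: "finite P" "H1.orthonormal P (\<lambda>x. x)" "H1.span P = H1.span X"
    using H1.orthonormal_extend[OF finX onf0(1)] by auto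
  define \<pi> where "\<pi> = H1.proj P (\<lambda>x. x)"
  define T' where "T' x = T (\<pi> (p x)) + T (x - p x)" for x
  obtain M where M: "M > 0" "\<And>x. norm (T x) \<le> M * norm x" using bounded_ops_pos_bound[OF T] by blast
  have T': "T' \<in> bounded_ops s1 s2"
  proof (rule bounded_opsI[where M = "M + M * 2"])
    fix x
    have np: "norm (p x) \<le> norm x" unfolding p_def by (rule H1.norm_proj_seq_le[OF e])
    have "norm (\<pi> (p x)) \<le> norm x"
      unfolding \<pi>_def by (rule order_trans[OF H1.norm_proj_le[OF P(2,1)] np])
    then have 1: "norm (T (\<pi> (p x))) \<le> M * norm x"
      using M(1) by (intro order_trans[OF M(2)] mult_left_mono) auto
    have "norm (x - p x) \<le> 2 * norm x" using norm_triangle_ineq4[of x "p x"] np by simp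
    then have 2: "norm (T (x - p x)) \<le> M * (2 * norm x)"
      using M(1) by (intro order_trans[OF M(2)] mult_left_mono) auto
    show "norm (T' x) \<le> (M + M * 2) * norm x"
      using norm_triangle_ineq[of "T (\<pi> (p x))" "T (x - p x)"] 1 2
        by (simp add: T'_def algebra_simps)
  qed (simp_all add: T'_def \<pi>_def p_def Td H1.proj_seq_add[OF e] H1.proj_seq_scale[OF e] H1.proj_add
      H1.proj_scale H2.scale_right_distrib H2.scale_right_diff_distrib)
  define Q where "Q x = T x - H2.proj_seq f (T x)" for x
  have Q: "Q \<in> bounded_ops s1 s2" "\<And>x j. H2.ip (Q x) (f j) = 0"
    unfolding Q_def[abs_def] using perp_component[OF f T] by auto
  have finQ: "finite (Q ` P)" using P(1) by simp
  obtain W where W: "finite W" "H2.orthonormal W (\<lambda>x. x)" "H2.span W = H2.span (Q ` P)"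
    using H2.orthonormal_extend[OF finQ onf0(2)] by auto
  have Wf: "H2.ip w (f j) = 0" if "w \<in> W" for w j
    by (rule H2.ip_span_0[of w "Q ` P"]) (use that W(3) H2.span_base Q(2) in auto)
  obtain C where C: "C > 0" "\<And>n. b n \<le> C * a (n + card W)" using ba[of "card W"] by blast
  have T'W: "T' (H1.proj_seq e x) - H2.proj_seq f (T' (H1.proj_seq e x)) \<in> H2.span W" for x
  proof -
    have "T' (H1.proj_seq e x) = T (\<pi> (p x))" by (simp add: T'_def p_def proj_seq_idem[OF e] Td)
    then have "T' (H1.proj_seq e x) - H2.proj_seq f (T' (H1.proj_seq e x)) = Q (\<pi> (p x))"
      by (simp add: Q_def)
    also have "\<dots> = (\<Sum>o'\<in>P. s2 (H1.ip (p x) o') (Q o'))"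
      unfolding \<pi>_def H1.proj_def bounded_ops_sum[OF Q(1)] ..
    also have "\<dots> \<in> H2.span (Q ` P)"
      by (intro H2.span_sum H2.span_scale H2.span_base) auto
    finally show ?thesis by (simp add: W(3))
  qed
  have "\<exists>S\<in>G_ops s1 s2 (H1.diag_ellipsoid e a) (H2.diag_ellipsoid f b).
      \<forall>(g, x)\<in>\<Phi>. norm (g (S x) - g (T' x)) < \<epsilon>"
    by (rule weak_approximation[OF e f a b W(1,2) _ C T' T'W \<Phi>(1) _ \<Phi>(3)])
       (use Wf \<Phi>(2) in auto)
  then obtain S where S: "S \<in> G_ops s1 s2 (H1.diag_ellipsoid e a) (H2.diag_ellipsoid f b)"
    "\<forall>(g, x)\<in>\<Phi>. norm (g (S x) - g (T' x)) < \<epsilon>" by blast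
  have "T' x = T x" if "(g, x) \<in> \<Phi>" for g x
  proof -
    have "p x \<in> X" using that by (force simp: X_def)
    then have "p x \<in> H1.span P" using P(3) H1.span_base by blast
    then have "\<pi> (p x) = p x" unfolding \<pi>_def using H1.proj_span[OF P(2,1)] by simp
    then show ?thesis by (simp add: T'_def Td)
  qed
  then have "\<forall>(g, x)\<in>\<Phi>. norm (g (S x) - g (T x)) < \<epsilon>" using S(2) by fastforce
  then show "\<exists>S\<in>G_ops s1 s2 (H1.diag_ellipsoid e a) (H2.diag_ellipsoid f b). \<forall>(g, x)\<in>\<Phi>. norm (g (S
      x) - g (T x)) < \<epsilon>"
    using S(1) by blast
qed

text \<open>\<open>Q\<close> removes the \<open>V2\<close>-component, so the images under
  \<open>Q\<close> of vectors that span \<open>T V1\<close> modulo \<open>V2\<close> span the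
  finite-dimensional defect \<open>W\<close> of \<open>weak_approximation\<close>.\<close>

lemma WG_ellip_if_quotient_dim_le:
  fixes e :: "nat \<Rightarrow> 'a" and f :: "nat \<Rightarrow> 'b" and a b :: "nat \<Rightarrow> real"
  defines "V1 \<equiv> closure (H1.span (range e))" and "V2 \<equiv> closure (H2.span (range f))"
  assumes e: "H1.orthonormal UNIV e" and f: "H2.orthonormal UNIV f"
    and a: "decseq a" "\<And>n. a n > 0" and b: "decseq b" "\<And>n. b n > 0"
    and ba: "C > 0" "\<And>n. b n \<le> C * a (n + k)"
    and T: "T \<in> bounded_ops s1 s2" and dim: "quotient_dim_le s2 V2 (quotient_image V2 (T ` V1)) k"
  shows "T \<in> WG s1 s2 (H1.diag_ellipsoid e a) (H2.diag_ellipsoid f b)"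
  unfolding WG_iff
proof (intro conjI T allI impI)
  fix \<Phi> :: "(('b \<Rightarrow> 'k) \<times> 'a) set" and \<epsilon> :: real
  assume \<Phi>: "finite \<Phi>" "\<forall>(g, x)\<in>\<Phi>. g \<in> bounded_ops s2 (*)" "\<epsilon> > 0"
  interpret p22: hilbert_pair s2 s2
    by (rule hilbert_pair.intro H2.hilbert_space_axioms)+
  have V2: "H2.subspace V2" unfolding V2_def by (intro H2.subspace_closure H2.subspace_span)
  obtain B where B: "B \<subseteq> T ` V1" "finite B" "card B \<le> k" "\<And>x. x \<in> T ` V1 \<Longrightarrow> \<exists>y\<in>H2.span B. x - y \<in> V2"
    using H2.quotient_dim_leD[OF V2 dim] by blast
  define Q where "Q y = y - H2.proj_seq f y" for y
  have id: "(\<lambda>y. y) \<in> bounded_ops s2 s2" by (rule p22.bounded_opsI[where M = 1]) auto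
  have Q: "Q \<in> bounded_ops s2 s2" "\<And>x j. H2.ip (Q x) (f j) = 0"
    unfolding Q_def[abs_def] using p22.perp_component[OF f id] by auto
  interpret Ql: Vector_Spaces.linear s2 s2 Q by (rule p22.bounded_opsD(1)[OF Q(1)])
  have Q0: "Q y = 0" if "y \<in> V2" for y
    using that H2.proj_seq_closure[OF f] by (simp add: Q_def V2_def)
  have onf0: "H2.orthonormal {} (\<lambda>x. x)" by (simp add: H2.orthonormal_def)
  have finQ: "finite (Q ` B)" using B(2) by simp
  obtain W where W: "finite W" "H2.orthonormal W (\<lambda>x. x)" "H2.span W = H2.span (Q ` B)"
    "card W \<le> card (Q ` B)"
    using H2.orthonormal_extend[OF finQ onf0] by auto
  have Wk: "card W \<le> k" using W(4) card_image_le[OF B(2), of Q] B(3) by linarith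
  have Wf: "H2.ip w (f j) = 0" if "w \<in> W" for w j
    by (rule H2.ip_span_0[of w "Q ` B"]) (use that W(3) H2.span_base Q(2) in auto)
  \<comment> \<open>\<open>W\<close> may have fewer than \<open>k\<close> elements; as
    \<open>a\<close> decreases, the bound with shift \<open>k\<close> implies the one with the
    smaller shift.\<close>
  have baW: "b n \<le> C * a (n + card W)" for n
    using ba(1) Wk by (intro order_trans[OF ba(2)] mult_left_mono decseqD[OF a(1)]) auto
  have TW: "T (H1.proj_seq e x) - H2.proj_seq f (T (H1.proj_seq e x)) \<in> H2.span W" for x
  proof -
    have "T (H1.proj_seq e x) \<in> T ` V1" unfolding V1_def
      by (intro imageI H1.proj_seq_in_closure[OF e])
    then obtain y where y: "y \<in> H2.span B" "T (H1.proj_seq e x) - y \<in> V2" using B(4) by blast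
    have "Q (T (H1.proj_seq e x)) = Q y" using Q0[OF y(2)] by (simp add: Ql.diff)
    also have "\<dots> \<in> H2.span (Q ` B)" unfolding Ql.span_image using y(1) by blast
    finally show ?thesis by (simp add: W(3) Q_def)
  qed
  show "\<exists>S\<in>G_ops s1 s2 (H1.diag_ellipsoid e a) (H2.diag_ellipsoid f b). \<forall>(g, x)\<in>\<Phi>. norm (g (S x) - g
      (T x)) < \<epsilon>"
    by (rule weak_approximation[OF e f a b W(1,2) _ ba(1) baW T TW \<Phi>(1) _ \<Phi>(3)])
       (use Wf \<Phi>(2) in auto)
qed

text \<open>If the dimension bound fails, the image of \<open>V1\<close> under \<open>Q\<close>
  contains \<open>k + 1\<close> orthonormal vectors. An operator of \<open>G_ops\<close> weakly
  close to \<open>T\<close> nearly reproduces them, up to projection, from the same preimages, and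
  \<open>covering_width_bound\<close> yields the excluded bound with shift
  \<open>k + 1\<close>.\<close>

lemma quotient_dim_le_if_WG_diag_ellipsoid:
  fixes e :: "nat \<Rightarrow> 'a" and f :: "nat \<Rightarrow> 'b" and a b :: "nat \<Rightarrow> real"
  defines "V1 \<equiv> closure (H1.span (range e))" and "V2 \<equiv> closure (H2.span (range f))"
  assumes inf: "infinite_dimensional s2 (UNIV :: 'b set)"
    and e: "H1.orthonormal UNIV e" and f: "H2.orthonormal UNIV f"
    and a: "decseq a" "\<And>n. a n > 0" and b: "decseq b" "\<And>n. b n > 0"
    and ba: "\<not> (\<exists>C>0. \<forall>n. b n \<le> C * a (n + Suc k))"
    and T: "T \<in> WG s1 s2 (H1.diag_ellipsoid e a) (H2.diag_ellipsoid f b)"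
  shows "quotient_dim_le s2 V2 (quotient_image V2 (T ` V1)) k"
proof (rule ccontr)
  assume nq: "\<not> ?thesis"
  interpret K: hilbert_space "(*) :: 'k \<Rightarrow> 'k \<Rightarrow> 'k" by (rule hilbert_space_scalars)
  interpret F: hilbert_pair s2 "(*) :: 'k \<Rightarrow> 'k \<Rightarrow> 'k"
    by (rule hilbert_pair.intro H2.hilbert_space_axioms K.hilbert_space_axioms)+
  have Tb: "T \<in> bounded_ops s1 s2" using T WG_iff by blast
  interpret Tl: Vector_Spaces.linear s1 s2 T by (rule bounded_opsD(1)[OF Tb])
  define Q where "Q x = T x - H2.proj_seq f (T x)" for x
  have Q: "Q \<in> bounded_ops s1 s2" "\<And>x j. H2.ip (Q x) (f j) = 0"
    unfolding Q_def[abs_def] using perp_component[OF f Tb] by auto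
  interpret Ql: Vector_Spaces.linear s1 s2 Q by (rule bounded_opsD(1)[OF Q(1)])
  have V1: "H1.subspace V1" unfolding V1_def by (intro H1.subspace_closure H1.subspace_span)
  have V2: "H2.subspace V2" unfolding V2_def by (intro H2.subspace_closure H2.subspace_span)
  have QV1: "H2.subspace (Q ` V1)" by (rule Ql.subspace_image[OF V1])
  have QV2: "H2.ip y (Q x) = 0" if "y \<in> V2" for x y
    using that unfolding V2_def
    by (rule H2.ip_closure_0) (use Q(2) H2.ip_eq_0_commute in auto)
  have "\<exists>P. finite P \<and> H2.orthonormal P (\<lambda>x. x) \<and> card P = j \<and> P \<subseteq> Q ` V1" if "j \<le> Suc k" for j
    using that
  proof (induction j)
    case 0
    show ?case by (intro exI[of _ "{}"]) (simp add: H2.orthonormal_def)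
  next
    case (Suc j)
    then obtain P where P: "finite P" "H2.orthonormal P (\<lambda>x. x)" "card P = j" "P \<subseteq> Q ` V1" by auto
    \<comment> \<open>Otherwise the values of \<open>T\<close> at preimages of the
      \<open>j \<le> k\<close> vectors of \<open>P\<close> would span \<open>T V1\<close> modulo
      \<open>V2\<close>, against the assumption.\<close>
    have "\<not> Q ` V1 \<subseteq> H2.span P"
    proof
      assume sub: "Q ` V1 \<subseteq> H2.span P"
      have "\<forall>g\<in>P. \<exists>x. x \<in> V1 \<and> Q x = g" using P(4) by blast
      then obtain x where x: "\<And>g. g \<in> P \<Longrightarrow> x g \<in> V1 \<and> Q (x g) = g" by metis
      define B where "B = (\<lambda>g. T (x g)) ` P"
      have diff: "T u - Q u \<in> V2" for u
        unfolding Q_def V2_def using H2.proj_seq_in_closure[OF f] by simp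
      have "quotient_dim_le s2 V2 (quotient_image V2 (T ` V1)) k"
      proof (rule H2.quotient_dim_leI[OF V2 Tl.subspace_image[OF V1]])
        show "B \<subseteq> T ` V1" using x by (auto simp: B_def)
        show "finite B" "card B \<le> k"
          using P(1,3) card_image_le[OF P(1), of "\<lambda>g. T (x g)"] Suc.prems by (auto simp: B_def)
        have "g = h" if gh: "g \<in> P" "h \<in> P" "T (x g) +o V2 = T (x h) +o V2" for g h
        proof -
          have "T (x g) - T (x h) \<in> V2" using gh(3) H2.coset_eq_iff[OF V2] by blast
          moreover have "(T (x g) - Q (x g)) - (T (x h) - Q (x h)) \<in> V2"
            by (intro H2.subspace_diff[OF V2] diff)
          ultimately have "(T (x g) - T (x h)) - ((T (x g) - Q (x g)) - (T (x h) - Q (x h))) \<in> V2"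
            by (rule H2.subspace_diff[OF V2])
          then have "Q (x g - x h) \<in> V2" by (simp add: Ql.diff algebra_simps)
          \<comment> \<open>The vector lies in \<open>V2\<close> and is orthogonal to
            \<open>V2\<close>.\<close>
          from QV2[OF this, of "x g - x h"] have "Q (x g - x h) = 0" by (simp add: H2.ip_self)
          then show ?thesis using x gh by (simp add: Ql.diff)
        qed
        then show "inj_on (\<lambda>x. x +o V2) B" by (auto simp: B_def inj_on_def)
        fix y assume "y \<in> T ` V1"
        then obtain u where u: "u \<in> V1" "y = T u" by blast
        then have "Q u \<in> H2.span P" using sub by blast
        then obtain c where c: "Q u = (\<Sum>g\<in>P. s2 (c g) g)" unfolding H2.span_finite[OF P(1)] by blast
        define z where "z = (\<Sum>g\<in>P. s2 (c g) (T (x g)))"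
        have "z \<in> H2.span B" unfolding z_def B_def
          by (intro H2.span_sum H2.span_scale H2.span_base) auto
        moreover have "y - z \<in> V2"
        proof -
          have "z - Q u = (\<Sum>g\<in>P. s2 (c g) (T (x g) - Q (x g)))"
            using x by (simp add: z_def c H2.scale_right_diff_distrib sum_subtractf)
          also have "\<dots> \<in> V2"
            by (intro H2.subspace_sum[OF V2] H2.subspace_scale[OF V2] diff)
          finally have "(T u - Q u) - (z - Q u) \<in> V2" by (rule H2.subspace_diff[OF V2 diff])
          then show ?thesis by (simp add: u(2))
        qed
        ultimately show "\<exists>z\<in>H2.span B. y - z \<in> V2" by blast
      qed
      then show False using nq by blast
    qed
    then obtain t where t: "t \<in> Q ` V1" "t \<notin> H2.span P" by blast
    obtain u where u: "u \<in> H2.span (insert t P)" "H2.orthonormal (insert u P) (\<lambda>x. x)" "u \<notin> P"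
      by (rule H2.orthonormal_insert[OF P(2,1) t(2)]) auto
    have "H2.span (insert t P) \<subseteq> Q ` V1" by (rule H2.span_minimal[OF _ QV1]) (use P(4) t(1) in auto)
    then show ?case using P u by (intro exI[of _ "insert u P"]) auto
  qed
  from this[of "Suc k"] obtain P
    where P: "finite P" "H2.orthonormal P (\<lambda>x. x)" "card P = Suc k" "P \<subseteq> Q ` V1"
    by blast
  have "\<forall>g\<in>P. \<exists>x. x \<in> V1 \<and> Q x = g" using P(4) by blast
  then obtain x where x: "\<And>g. g \<in> P \<Longrightarrow> x g \<in> V1 \<and> Q (x g) = g" by metis
  define c where "c = 1 / (2 * (real (card P) + 1))"
  \<comment> \<open>The error after projection is a sum of \<open>card P\<close> terms of norm at
    most \<open>\<epsilon>\<close>; dividing by \<open>card P + 1\<close> keeps it strictly below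
    \<open>c\<close>, the tolerance of \<open>covering_width_bound\<close>.\<close>
  define \<epsilon> where "\<epsilon> = c / (real (card P) + 1)"
  have c: "c > 0" "\<epsilon> > 0" by (simp_all add: c_def \<epsilon>_def add_nonneg_pos)
  \<comment> \<open>The test pairs record all coordinates with respect to \<open>P\<close> of the
    images of the vectors \<open>x h\<close>.\<close>
  define \<Phi> where "\<Phi> = (\<lambda>(g, h). (\<lambda>y. H2.ip y g, x h)) ` (P \<times> P)"
  have "(\<lambda>y. H2.ip y g) \<in> bounded_ops s2 (*)" for g
    by (rule F.bounded_opsI[where M = "norm g"])
       (auto simp: H2.ip_add_left H2.ip_scale_left mult.commute[of "norm g"] H2.norm_ip_le)
  then have "finite \<Phi>" "\<forall>(g, x)\<in>\<Phi>. g \<in> bounded_ops s2 (*)" using P(1) by (auto simp: \<Phi>_def)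
  from T[unfolded WG_iff, THEN conjunct2, THEN spec, THEN spec, THEN mp, THEN mp, THEN mp, OF this
      c(2)]
  obtain S where S: "S \<in> G_ops s1 s2 (H1.diag_ellipsoid e a) (H2.diag_ellipsoid f b)"
    "\<forall>(g, x)\<in>\<Phi>. norm (g (S x) - g (T x)) < \<epsilon>" by blast
  have close: "norm (H2.ip (S (x h)) g - H2.ip (T (x h)) g) < \<epsilon>" if "g \<in> P" "h \<in> P" for g h
    using S(2) that by (force simp: \<Phi>_def)
  have Pf: "H2.ip (f j) g = 0" if g: "g \<in> P" for g j
  proof -
    obtain u where "g = Q u" using g P(4) by blast
    then show ?thesis using Q(2)[of u j] H2.ip_eq_0_commute by blast
  qed
  have near: "norm (H2.proj P (\<lambda>x. x) (S (x h)) - h) < c" if h: "h \<in> P" for h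
  proof -
    \<comment> \<open>The part of \<open>T (x h)\<close> in \<open>V2\<close> is invisible to the
      projection onto \<open>span P\<close>, as \<open>P\<close> is orthogonal to \<open>V2\<close>.
      What remains is \<open>Q (x h) = h\<close>.\<close>
    have "H2.proj P (\<lambda>x. x) (H2.proj_seq f (T (x h))) = 0"
      by (rule H2.proj_perp, rule H2.ip_closure_0[OF H2.proj_seq_in_closure[OF f]]) (use Pf in auto)
    moreover have "T (x h) = h + H2.proj_seq f (T (x h))" using x[OF h]
      by (simp add: Q_def algebra_simps)
    ultimately have "H2.proj P (\<lambda>x. x) (T (x h)) = H2.proj P (\<lambda>x. x) h"
      by (metis H2.proj_add add_0_right)
    also have "\<dots> = h" using H2.proj_span[OF P(2,1)] h H2.span_base by simp
    finally have "H2.proj P (\<lambda>x. x) (S (x h)) - h =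
        H2.proj P (\<lambda>x. x) (S (x h)) - H2.proj P (\<lambda>x. x) (T (x h))" by simp
    also have "\<dots> = (\<Sum>g\<in>P. s2 (H2.ip (S (x h)) g - H2.ip (T (x h)) g) g)"
      by (simp add: H2.proj_def H2.scale_left_diff_distrib sum_subtractf)
    also have "norm \<dots> \<le> (\<Sum>g\<in>P. \<epsilon>)"
    proof (rule sum_norm_le)
      fix g assume "g \<in> P"
      then show "norm (s2 (H2.ip (S (x h)) g - H2.ip (T (x h)) g) g) \<le> \<epsilon>"
        using close[of g h] h H2.orthonormal_norm[OF P(2), of g] by (simp add: H2.norm_scale)
    qed
    also have "\<dots> < c" using c(1) by (simp add: \<epsilon>_def divide_less_eq)
    finally show ?thesis .
  qed
  have "\<exists>C>0. \<forall>n. b n \<le> C * a (n + card P)"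
    by (rule covering_width_bound[OF inf e f a b S(1) P(1,2)])
       (use Pf x near in \<open>auto simp: V1_def c_def\<close>)
  then show False using ba P(3) by simp
qed

end

section \<open>Reduction of arbitrary ellipsoids to diagonal ones\<close>

text \<open>The singular value decomposition eliminates the auxiliary space and the presenting
  operator; the rest of the argument sees only the axes and their lengths.\<close>

lemma ellipsoid_eq_diag_ellipsoid:
  fixes s :: "'k::{real_normed_field,euclidean_space} \<Rightarrow> 'a::{real_inner,complete_space} \<Rightarrow> 'a"
    and s' :: "'k \<Rightarrow> 'c::{real_inner,complete_space} \<Rightarrow> 'c"
  assumes "hilbert_space s" "hilbert_space s'" "ellipsoid s' s A K"
  shows "\<exists>e (a :: nat \<Rightarrow> real). hilbert_space.orthonormal s UNIV e \<and> (\<forall>n. a n > 0) \<and> decseq a \<and>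
    K = hilbert_space.diag_ellipsoid s e a"
proof -
  interpret hilbert_pair s' s using assms by (simp add: hilbert_pair_def)
  have A: "A \<in> bounded_ops s' s" "compact (closure (A ` cball 0 1))"
    "infinite_dimensional s (range A)"
    and K: "K = A ` cball 0 1"
    using assms(3) by (auto simp: ellipsoid_def compact_operator_def)
  show ?thesis
  proof (rule svd[OF A])
    fix e and \<sigma> :: "nat \<Rightarrow> real"
    assume "H2.orthonormal UNIV e" "\<And>n. 0 < \<sigma> n" "decseq \<sigma>" "A ` cball 0 1 = H2.diag_ellipsoid e \<sigma>"
    then show ?thesis using K by blast
  qed
qed

theorem theorem5p4:
  fixes s1 :: "'k::{real_normed_field,euclidean_space} \<Rightarrow> 'a::{real_inner,complete_space} \<Rightarrow> 'a"
    and s2 :: "'k \<Rightarrow> 'b::{real_inner,complete_space} \<Rightarrow> 'b"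
    and s1' :: "'k \<Rightarrow> 'c::{real_inner,complete_space} \<Rightarrow> 'c"
    and s2' :: "'k \<Rightarrow> 'd::{real_inner,complete_space} \<Rightarrow> 'd"
    and A1 :: "'c \<Rightarrow> 'a" and A2 :: "'d \<Rightarrow> 'b"
    and K1 :: "'a set" and K2 :: "'b set"
  assumes "hilbert_space s1" and "hilbert_space s2"
    and "hilbert_space s1'" and "hilbert_space s2'"
    and "infinite_dimensional s1 (UNIV :: 'a set)" and "infinite_dimensional s2 (UNIV :: 'b set)"
    and "separable_space (euclidean :: 'a topology)"
    and "separable_space (euclidean :: 'b topology)"
    and "ellipsoid s1' s1 A1 K1" and "ellipsoid s2' s2 A2 K2"
    and "(\<lambda>n. kolmogorov_width s2 n K2) \<in> O(\<lambda>n. kolmogorov_width s1 n K1)"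
  shows "((\<forall>k. majorizes (left_shift k (\<lambda>n. kolmogorov_width s1 n K1))
                         (\<lambda>n. kolmogorov_width s2 n K2))
            \<longrightarrow> WG s1 s2 K1 K2 = bounded_ops s1 s2)
       \<and> (\<forall>k. majorizes (left_shift k (\<lambda>n. kolmogorov_width s1 n K1))
                        (\<lambda>n. kolmogorov_width s2 n K2)
              \<and> \<not> majorizes (left_shift (k + 1) (\<lambda>n. kolmogorov_width s1 n K1))
                            (\<lambda>n. kolmogorov_width s2 n K2)
            \<longrightarrow> WG s1 s2 K1 K2 =
                {T \<in> bounded_ops s1 s2.
                   quotient_dim_le s2 (closed_span s2 K2)
                     (quotient_image (closed_span s2 K2) (T ` closed_span s1 K1)) k})"
proof -
  interpret hilbert_pair s1 s2 using assms(1,2) by (simp add: hilbert_pair_def)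
  obtain e and a :: "nat \<Rightarrow> real" where e: "H1.orthonormal UNIV e" and a: "\<And>n. a n > 0" "decseq a"
    and K1: "K1 = H1.diag_ellipsoid e a"
    using ellipsoid_eq_diag_ellipsoid[OF assms(1,3,9)] by blast
  obtain f and b :: "nat \<Rightarrow> real" where f: "H2.orthonormal UNIV f" and b: "\<And>n. b n > 0" "decseq b"
    and K2: "K2 = H2.diag_ellipsoid f b"
    using ellipsoid_eq_diag_ellipsoid[OF assms(2,4,10)] by blast
  \<comment> \<open>The widths are the lengths of the axes, so majorization becomes an inequality
    between \<open>b\<close> and a shift of \<open>a\<close>.\<close>
  have maj: "majorizes (left_shift k (\<lambda>n. kolmogorov_width s1 n K1)) (\<lambda>n. kolmogorov_width s2 n K2)
    \<longleftrightarrow> (\<exists>C>0. \<forall>n. b n \<le> C * a (n + k))" for k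
    by (simp add: majorizes_def left_shift_def K1 K2 H1.kolmogorov_width_diag_ellipsoid[OF assms(5)
        e a(2,1)]
        H2.kolmogorov_width_diag_ellipsoid[OF assms(6) f b(2,1)])
  have V: "closed_span s1 K1 = closure (H1.span (range e))"
    "closed_span s2 K2 = closure (H2.span (range f))"
    by (simp_all add: K1 K2 H1.closed_span_diag_ellipsoid[OF e a(2,1)]
        H2.closed_span_diag_ellipsoid[OF f b(2,1)])
  have WG_sub: "WG s1 s2 K1 K2 \<subseteq> bounded_ops s1 s2" using WG_iff by blast
  show ?thesis
    unfolding maj V
  proof (intro conjI allI impI)
    assume "\<forall>k. \<exists>C>0. \<forall>n. b n \<le> C * a (n + k)"
    then have "T \<in> WG s1 s2 K1 K2" if "T \<in> bounded_ops s1 s2" for T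
      unfolding K1 K2 by (intro WG_ellip_if_all_shifts[OF e f a(2,1) b(2,1) _ that]) blast
    then show "WG s1 s2 K1 K2 = bounded_ops s1 s2" using WG_sub by blast
  next
    fix k
    assume k: "(\<exists>C>0. \<forall>n. b n \<le> C * a (n + k)) \<and> \<not> (\<exists>C>0. \<forall>n. b n \<le> C * a (n + (k + 1)))"
    then obtain C where C: "C > 0" "\<And>n. b n \<le> C * a (n + k)" by blast
    have nmaj: "\<not> (\<exists>C>0. \<forall>n. b n \<le> C * a (n + Suc k))" using k by simp
    show "WG s1 s2 K1 K2 = {T \<in> bounded_ops s1 s2. quotient_dim_le s2 (closure (H2.span (range f)))
        (quotient_image (closure (H2.span (range f))) (T ` closure (H1.span (range e)))) k}"
    proof (intro equalityI subsetI CollectI conjI)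
      fix T assume T: "T \<in> WG s1 s2 K1 K2"
      then show "T \<in> bounded_ops s1 s2" using WG_sub by blast
      show "quotient_dim_le s2 (closure (H2.span (range f)))
          (quotient_image (closure (H2.span (range f))) (T ` closure (H1.span (range e)))) k"
        by (rule quotient_dim_le_if_WG_diag_ellipsoid[OF assms(6) e f a(2,1) b(2,1) nmaj T[unfolded
            K1 K2]])
    next
      fix T assume "T \<in> {T \<in> bounded_ops s1 s2. quotient_dim_le s2 (closure (H2.span (range f)))
        (quotient_image (closure (H2.span (range f))) (T ` closure (H1.span (range e)))) k}"
      then show "T \<in> WG s1 s2 K1 K2"
        unfolding K1 K2 by (intro WG_ellip_if_quotient_dim_le[OF e f a(2,1) b(2,1) C]) auto
    qed
  qed
qed

end
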